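(* A necessary and sufficient condition for $\#\mathcal{P}_\mu=1$ is that $H_\mu^{\mathrm{stab}}(\mathbb{P}^0)=H$ for some, and hence all, $\mathbb{P}^0\in\mathcal{P}_\mu^{\mathrm{ex}}$. That is, the following are equivalent: (a) $\#\mathcal{P}_\mu=1$; (b) $H_\mu^{\mathrm{stab}}(\mathbb{P}^0)=H$ for some $\mathbb{P}^0\in\mathcal{P}_\mu^{\mathrm{ex}}$; (c) $H_\mu^{\mathrm{stab}}(\mathbb{P}^0)=H$ for all $\mathbb{P}^0\in\mathcal{P}_\mu^{\mathrm{ex}}$.
   Context: $\mathbb{N}=\{1,2,\dots\}$. Let $(G_k)_{k\in\mathbb{N}}$ be a sequence of compact Hausdorff groups with countable bases, let $\phi_k:G_{k+1}\to G_k$ be a continuous homomorphism for each $k$, and let $G:=\prod_{k\in\mathbb{N}}G_k$ with the product topology. Let $\mu=(\mu_k)_{k\in\mathbb{N}}$, where $\mu_k$ is a Borel probability measure on $G_k$. Let $H:=\{(g_k)_{k\in\mathbb{N}}\in G: g_k=\phi_k(g_{k+1})\ \text{for all } k\in\mathbb{N}\}$, a compact subgroup of $G$. Let $X_k:G\to G_k$ be the $k$-th coordinate map and $Z_k:=\phi_k(X_{k+1})^{-1}X_k$. The set $\mathcal{P}_\mu$ of solutions of the stochastic equation associated with $\mu$ is the set of Borel probability measures $\mathbb{P}$ on $G$ such that for every $k\in\mathbb{N}$ and every bounded Borel $f:G_k\to\mathbb{R}$, the conditional expectation of $f(X_k)$ given $(X_j)_{j>k}$ under $\mathbb{P}$ equals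 $\int_{G_k}f(\phi_k(X_{k+1})z)\,\mu_k(dz)$ $\mathbb{P}$-a.s.; equivalently, for every $k$, under $\mathbb{P}$ the variable $Z_k$ has distribution $\mu_k$ and is independent of $(X_j)_{j>k}$. The set $\mathcal{P}_\mu$ is convex (and compact for weak convergence), and $\mathcal{P}_\mu^{\mathrm{ex}}$ denotes its set of extreme points. For $h=(h_k)_{k\in\mathbb{N}}\in H$ and $\mathbb{P}\in\mathcal{P}_\mu$, $T_h(\mathbb{P})$ is the distribution of $(h_kX_k)_{k\in\mathbb{N}}$ under $\mathbb{P}$. This defines a group action of $H$ on $\mathcal{P}_\mu$ that leaves $\mathcal{P}_\mu^{\mathrm{ex}}$ invariant. For $\mathbb{P}^0\in\mathcal{P}_\mu^{\mathrm{ex}}$, $H_\mu^{\mathrm{stab}}(\mathbb{P}^0):=\{h\in H: T_h(\mathbb{P}^0)=\mathbb{P}^0\}$. *)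

theory Defs
  imports "HOL-Probability.Probability" "HOL-Algebra.Group"
begin

definition is_topological_group :: "('a, 'b) monoid_scheme \<Rightarrow> 'a topology \<Rightarrow> bool" where
  "is_topological_group G T \<longleftrightarrow>
     group G \<and> topspace T = carrier G \<and>
     continuous_map (prod_topology T T) T (\<lambda>(x, y). x \<otimes>\<^bsub>G\<^esub> y) \<and>
     continuous_map T T (\<lambda>x. inv\<^bsub>G\<^esub> x)"

definition borel_of :: "'a topology \<Rightarrow> 'a measure" where
  "borel_of T = sigma (topspace T) {U. openin T U}"

definition borel_prob_measures :: "'a topology \<Rightarrow> 'a measure set" where
  "borel_prob_measures T = {M. prob_space M \<and> sets M = sets (borel_of T)}"

text \<open>
  Sequences indexed by \<open>{1, 2, \<dots>}\<close> are indexed by \<^typ>\<open>nat\<close> here, that is, from \<open>0\<close>; no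
  definition or statement below depends on the value of an index.  The groups \<open>G k\<close> may vary
  with \<open>k\<close>: each has its own carrier, operation and topology on a subset of a common type.
  Points of the product \<open>\<Prod>k. G k\<close> are functions \<open>x\<close> with \<open>x k \<in> carrier (G k)\<close>, and the
  coordinate map \<open>X\<^sub>k\<close> is \<open>\<lambda>x. x k\<close>.
\<close>

abbreviation seq_topology :: "(nat \<Rightarrow> 'a topology) \<Rightarrow> (nat \<Rightarrow> 'a) topology" where
  "seq_topology T \<equiv> product_topology T UNIV"

definition inverse_limit_group ::
    "(nat \<Rightarrow> ('a, 'b) monoid_scheme) \<Rightarrow> (nat \<Rightarrow> 'a \<Rightarrow> 'a) \<Rightarrow> (nat \<Rightarrow> 'a) set" where
  "inverse_limit_group G \<phi> =
     {g. (\<forall>k. g k \<in> carrier (G k)) \<and> (\<forall>k. g k = \<phi> k (g (Suc k)))}"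

text \<open>
  The \<open>\<sigma>\<close>-algebra on the product generated by \<open>(X\<^sub>j)\<close> with \<open>j > k\<close>, regarded as one random element
  of the measurable product of the Borel spaces \<open>G j\<close>, \<open>j > k\<close>.  Only the \<open>\<sigma>\<close>-algebra of this
  measure space is used.
\<close>

definition tail_algebra :: "(nat \<Rightarrow> 'a topology) \<Rightarrow> nat \<Rightarrow> (nat \<Rightarrow> 'a) measure" where
  "tail_algebra T k =
     vimage_algebra (topspace (seq_topology T)) (\<lambda>x. restrict x {k<..})
       (PiM {k<..} (\<lambda>j. borel_of (T j)))"

definition solutions ::
    "(nat \<Rightarrow> ('a, 'b) monoid_scheme) \<Rightarrow> (nat \<Rightarrow> 'a topology) \<Rightarrow> (nat \<Rightarrow> 'a \<Rightarrow> 'a) \<Rightarrow>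
     (nat \<Rightarrow> 'a measure) \<Rightarrow> (nat \<Rightarrow> 'a) measure set" where
  "solutions G T \<phi> \<mu> =
     {P \<in> borel_prob_measures (seq_topology T).
        \<forall>k. \<forall>f \<in> borel_measurable (borel_of (T k)).
          (\<exists>B. \<forall>y \<in> carrier (G k). \<bar>f y :: real\<bar> \<le> B) \<longrightarrow>
          (AE x in P. real_cond_exp P (tail_algebra T k) (\<lambda>x. f (x k)) x =
             (\<integral>z. f (\<phi> k (x (Suc k)) \<otimes>\<^bsub>G k\<^esub> z) \<partial>\<mu> k))}"

text \<open>
  Measures do not form a real vector space in the library, so the notion of extreme point from
  \<open>extreme_point_of\<close> (no representation as a proper convex combination of two distinct members)
  is spelled out setwise.
\<close>

definition is_convex_combination ::
    "real \<Rightarrow> 'c measure \<Rightarrow> 'c measure \<Rightarrow> 'c measure \<Rightarrow> bool" where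
  "is_convex_combination t Q R P \<longleftrightarrow>
     (\<forall>A \<in> sets P. measure P A = (1 - t) * measure Q A + t * measure R A)"

definition extreme_measures :: "'c measure set \<Rightarrow> 'c measure set" where
  "extreme_measures S =
     {P \<in> S. \<forall>Q \<in> S. \<forall>R \<in> S. \<forall>t. 0 < t \<and> t < 1 \<and> is_convex_combination t Q R P \<longrightarrow> Q = R}"

definition translate ::
    "(nat \<Rightarrow> ('a, 'b) monoid_scheme) \<Rightarrow> (nat \<Rightarrow> 'a topology) \<Rightarrow> (nat \<Rightarrow> 'a) \<Rightarrow>
     (nat \<Rightarrow> 'a) measure \<Rightarrow> (nat \<Rightarrow> 'a) measure" where
  "translate G T h P = distr P (borel_of (seq_topology T)) (\<lambda>x k. h k \<otimes>\<^bsub>G k\<^esub> x k)"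

definition stabilizer ::
    "(nat \<Rightarrow> ('a, 'b) monoid_scheme) \<Rightarrow> (nat \<Rightarrow> 'a topology) \<Rightarrow> (nat \<Rightarrow> 'a \<Rightarrow> 'a) \<Rightarrow>
     (nat \<Rightarrow> 'a) measure \<Rightarrow> (nat \<Rightarrow> 'a) set" where
  "stabilizer G T \<phi> P = {h \<in> inverse_limit_group G \<phi>. translate G T h P = P}"

end

theory Submission
  imports Defs
begin

text \<open>
  Let \<open>H\<close> be the inverse limit group. If there is exactly one solution, it is extreme, and every
  translate of it by \<open>H\<close> is again a solution, hence equal to it. The converse has two parts:
  extreme solutions exist (so that a statement about all of them is not empty), and an extreme
  solution \<open>P\<^sub>0\<close> that is invariant under \<open>H\<close> is the only solution.

  Existence rests on weak sequential compactness of the Borel probability measures on a compact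
  space with a countable base (\<open>borel_prob_measures_weakly_sequentially_compact\<close>). The equation at
  level \<open>k\<close> is an identity between the laws of two continuous images of \<open>P\<close> and \<open>P \<otimes> \<mu>\<^sub>k\<close>
  (\<open>solution_if_solves\<close>, \<open>solves_if_solution\<close>), so it survives weak limits. Running the
  recursion \<open>x\<^sub>k = \<phi>\<^sub>k(x\<^sub>k\<^sub>+\<^sub>1) z\<^sub>k\<close> downwards from a point mass at level \<open>m\<close> solves the equations
  below \<open>m\<close>, and a limit as \<open>m \<rightarrow> \<infinity>\<close> solves all of them. A maximiser of a weakly continuous,
  strictly convex functional on the weakly closed set of solutions is an extreme point
  (\<open>extreme_measures_nonempty\<close>).

  For uniqueness, let \<open>P\<^sub>0\<close> be an invariant solution and \<open>P\<close> any solution. The recursion multiplies by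
  the same noise on the right for every starting point, so the averages of a test function over the
  levels below \<open>m\<close> compare only points whose quotient \<open>x y\<^sup>-\<^sup>1\<close> satisfies the relations of \<open>H\<close> below
  \<open>m\<close>. For a continuous function that is invariant under left multiplication by \<open>H\<close>, compactness
  forces the oscillation of these averages to \<open>0\<close>; therefore all solutions give such a function the
  same integral (\<open>solutions_agree_on_invariant\<close>). The projections of \<open>P\<^sub>0\<close> onto sequences that
  are compatible below \<open>m\<close> accumulate at a left-invariant probability measure \<open>\<eta>\<close> on \<open>H\<close>
  (\<open>invariant_measure_on_H\<close>). Averaging test functions over \<open>\<eta>\<close> makes them invariant, which yields
  that \<open>P\<^sub>0\<close> is the \<open>\<eta>\<close>-mixture of the translates of \<open>P\<close>
  (\<open>invariant_solution_eq_mixture\<close>). If moreover \<open>P\<^sub>0\<close> is extreme, then almost every one of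
  these translates equals \<open>P\<^sub>0\<close> (\<open>extreme_mixture_integral\<close>), and translating back gives \<open>P = P\<^sub>0\<close>.
\<close>

section \<open>Borel measures on compact spaces with a countable base\<close>

text \<open>
  These are the compact metrizable spaces.
\<close>

definition compactum :: "'a topology \<Rightarrow> bool" where
  "compactum X \<longleftrightarrow> compact_space X \<and> Hausdorff_space X \<and> second_countable X"

lemma space_borel_of [simp]: "space (borel_of X) = topspace X"
  unfolding borel_of_def by (rule space_measure_of) (auto dest: openin_subset)

lemma sets_borel_of: "sets (borel_of X) = sigma_sets (topspace X) {U. openin X U}"
  unfolding borel_of_def by (rule sets_measure_of) (auto dest: openin_subset)

lemma openin_in_borel_of: "openin X U \<Longrightarrow> U \<in> sets (borel_of X)"
  by (auto simp: sets_borel_of)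

lemma closedin_in_borel_of:
  assumes "closedin X C" shows "C \<in> sets (borel_of X)"
proof -
  have "topspace X - (topspace X - C) \<in> sets (borel_of X)"
    using openin_in_borel_of[of X "topspace X - C"] sets.compl_sets[of _ "borel_of X"] assms
    by (auto simp: closedin_def)
  then show ?thesis
    using closedin_subset[OF assms] by (simp add: double_diff)
qed

lemma continuous_map_measurable_borel_of:
  assumes "continuous_map X Y f"
  shows "f \<in> borel_of X \<rightarrow>\<^sub>M borel_of Y"
proof (rule measurable_sigma_sets[OF sets_borel_of])
  show "{U. openin Y U} \<subseteq> Pow (topspace Y)"
    by (auto dest: openin_subset)
  show "f \<in> space (borel_of X) \<rightarrow> topspace Y"
    using assms by (auto simp: continuous_map_def)
  show "f -` U \<inter> space (borel_of X) \<in> sets (borel_of X)" if "U \<in> {U. openin Y U}" for U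
  proof -
    have "f -` U \<inter> topspace X = {x \<in> topspace X. f x \<in> U}" by auto
    then show ?thesis
      using assms that by (auto simp: continuous_map_def intro!: openin_in_borel_of)
  qed
qed

lemma borel_of_euclidean: "borel_of (euclidean :: 'a::topological_space topology) = borel"
  by (simp add: borel_of_def borel_def)

lemma continuous_map_borel_measurable:
  "continuous_map X euclidean f \<Longrightarrow> f \<in> borel_measurable (borel_of X)"
  using continuous_map_measurable_borel_of[of X euclidean f] by (simp add: borel_of_euclidean)

definition countable_base :: "'a topology \<Rightarrow> 'a set set \<Rightarrow> bool" where
  "countable_base X \<B> \<longleftrightarrow> countable \<B> \<and> (\<forall>V\<in>\<B>. openin X V) \<and>
     (\<forall>U x. openin X U \<and> x \<in> U \<longrightarrow> (\<exists>V\<in>\<B>. x \<in> V \<and> V \<subseteq> U))"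

lemma second_countable_iff_base: "second_countable X \<longleftrightarrow> (\<exists>\<B>. countable_base X \<B>)"
  unfolding second_countable_def countable_base_def by simp

lemma countable_baseD:
  assumes "countable_base X \<B>"
  shows "countable \<B>" "V \<in> \<B> \<Longrightarrow> openin X V"
    "openin X U \<Longrightarrow> x \<in> U \<Longrightarrow> \<exists>V\<in>\<B>. x \<in> V \<and> V \<subseteq> U"
  using assms unfolding countable_base_def by auto

text \<open>
  Every open set is a countable union of members of a countable base. For a product space with its
  base of rectangles this makes the Borel sets the product \<open>\<sigma>\<close>-algebra.
\<close>

lemma sets_borel_of_subset_if_base:
  assumes base: "countable_base X \<B>" and M: "space M = topspace X" "\<B> \<subseteq> sets M"
  shows "sets (borel_of X) \<subseteq> sets M"
proof -
  have "U \<in> sets M" if U: "openin X U" for U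
  proof -
    have "U = \<Union>{V \<in> \<B>. V \<subseteq> U}" using countable_baseD(3)[OF base U] by blast
    also have "\<dots> \<in> sets M"
      using M(2) countable_baseD(1)[OF base] by (intro sets.countable_Union) auto
    finally show ?thesis .
  qed
  then show ?thesis
    unfolding sets_borel_of M(1)[symmetric] by (intro sets.sigma_sets_subset) auto
qed

lemma countable_base_prod_topology:
  assumes B: "countable_base X \<B>" and C: "countable_base Y \<C>"
  shows "countable_base (prod_topology X Y) ((\<lambda>(U, V). U \<times> V) ` (\<B> \<times> \<C>))"
  unfolding countable_base_def
proof (intro conjI allI impI ballI)
  show "countable ((\<lambda>(U, V). U \<times> V) ` (\<B> \<times> \<C>))"
    using countable_baseD(1)[OF B] countable_baseD(1)[OF C]
    by (intro countable_image countable_SIGMA)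
  show "openin (prod_topology X Y) W" if "W \<in> (\<lambda>(U, V). U \<times> V) ` (\<B> \<times> \<C>)" for W
    using that countable_baseD(2)[OF B] countable_baseD(2)[OF C]
    by (auto simp: openin_prod_Times_iff)
  show "\<exists>V\<in>(\<lambda>(U, V). U \<times> V) ` (\<B> \<times> \<C>). x \<in> V \<and> V \<subseteq> W"
    if W: "openin (prod_topology X Y) W \<and> x \<in> W" for W x
  proof -
    have "(fst x, snd x) \<in> W" using W by simp
    then obtain U V where UV: "openin X U" "openin Y V" "fst x \<in> U" "snd x \<in> V" "U \<times> V \<subseteq> W"
      using W unfolding openin_prod_topology_alt by blast
    obtain U' V' where "U' \<in> \<B>" "fst x \<in> U'" "U' \<subseteq> U" "V' \<in> \<C>" "snd x \<in> V'" "V' \<subseteq> V"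
      using countable_baseD(3)[OF B UV(1,3)] countable_baseD(3)[OF C UV(2,4)] by blast
    then show ?thesis
      using UV by (intro bexI[of _ "U' \<times> V'"]) (auto simp: mem_Times_iff)
  qed
qed

lemma sets_subset_if_id_measurable:
  assumes "(\<lambda>x. x) \<in> M \<rightarrow>\<^sub>M N" "space M = space N"
  shows "sets N \<subseteq> sets M"
proof
  fix A assume A: "A \<in> sets N"
  then have "(\<lambda>x. x) -` A \<inter> space M \<in> sets M" using assms(1) by (rule measurable_sets[rotated])
  moreover have "(\<lambda>x. x) -` A \<inter> space M = A" using sets.sets_into_space[OF A] assms(2) by auto
  ultimately show "A \<in> sets M" by simp
qed

lemma sets_borel_of_prod_topology:
  assumes "second_countable X" "second_countable Y"
  shows "sets (borel_of X \<Otimes>\<^sub>M borel_of Y) = sets (borel_of (prod_topology X Y))"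
proof
  obtain \<B> \<C> where B: "countable_base X \<B>" and C: "countable_base Y \<C>"
    using assms unfolding second_countable_iff_base by blast
  show "sets (borel_of (prod_topology X Y)) \<subseteq> sets (borel_of X \<Otimes>\<^sub>M borel_of Y)"
  proof (rule sets_borel_of_subset_if_base[OF countable_base_prod_topology[OF B C]])
    show "(\<lambda>(U, V). U \<times> V) ` (\<B> \<times> \<C>) \<subseteq> sets (borel_of X \<Otimes>\<^sub>M borel_of Y)"
      using countable_baseD(2)[OF B] countable_baseD(2)[OF C]
      by (auto intro!: pair_measureI openin_in_borel_of)
  qed (simp add: space_pair_measure)
  have "(\<lambda>x. x) \<in> borel_of (prod_topology X Y) \<rightarrow>\<^sub>M borel_of X \<Otimes>\<^sub>M borel_of Y"
    using continuous_map_measurable_borel_of[OF continuous_map_fst[of X Y]]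
      continuous_map_measurable_borel_of[OF continuous_map_snd[of X Y]]
    by (intro measurable_pair) (simp_all add: comp_def)
  then show "sets (borel_of X \<Otimes>\<^sub>M borel_of Y) \<subseteq> sets (borel_of (prod_topology X Y))"
    by (rule sets_subset_if_id_measurable) (simp add: space_pair_measure)
qed

text \<open>
  The usual base of a product topology, built from bases of the factors.
\<close>

definition box_base :: "(nat \<Rightarrow> 'a topology) \<Rightarrow> (nat \<Rightarrow> 'a set set) \<Rightarrow> (nat \<Rightarrow> 'a) set set" where
  "box_base T \<B> = (\<Union>J\<in>Collect finite.
     (\<lambda>V. PiE UNIV (\<lambda>k. if k \<in> J then V k else topspace (T k))) ` PiE J \<B>)"

lemma countable_base_seq_topology:
  fixes T :: "nat \<Rightarrow> 'a topology"
  assumes B: "\<And>k. countable_base (T k) (\<B> k)"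
  shows "countable_base (seq_topology T) (box_base T \<B>)"
  unfolding countable_base_def
proof (intro conjI allI impI ballI)
  show "countable (box_base T \<B>)"
    unfolding box_base_def
  proof (intro countable_UN countable_image)
    show "countable (Collect finite :: nat set set)" by (rule countable_Collect_finite)
    show "countable (PiE J \<B>)" if "J \<in> Collect finite" for J
      using that countable_baseD(1)[OF B] by (intro countable_PiE) simp_all
  qed
  show "openin (seq_topology T) W" if "W \<in> box_base T \<B>" for W
  proof -
    have "\<exists>J\<in>Collect finite. \<exists>V\<in>PiE J \<B>. W = PiE UNIV (\<lambda>k. if k \<in> J then V k else topspace (T k))"
      using that unfolding box_base_def by (simp only: UN_iff image_iff)
    then obtain J V where J: "J \<in> Collect finite" and V: "V \<in> PiE J \<B>"
      and W: "W = PiE UNIV (\<lambda>k. if k \<in> J then V k else topspace (T k))"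
      by (elim bexE) 
    have "openin (T k) (if k \<in> J then V k else topspace (T k))" for k
      using V countable_baseD(2)[OF B] by (auto simp: PiE_iff)
    moreover have "finite {k. (if k \<in> J then V k else topspace (T k)) \<noteq> topspace (T k)}"
      by (rule finite_subset[of _ J]) (use J in auto)
    ultimately show ?thesis unfolding W by (auto simp: openin_PiE_gen)
  qed
  show "\<exists>V\<in>box_base T \<B>. x \<in> V \<and> V \<subseteq> W" if W: "openin (seq_topology T) W \<and> x \<in> W" for W x
  proof -
    obtain U where U: "finite {k \<in> UNIV. U k \<noteq> topspace (T k)}" "\<And>k. openin (T k) (U k)"
      "x \<in> PiE UNIV U" "PiE UNIV U \<subseteq> W"
      using W unfolding openin_product_topology_alt by auto
    define J where "J = {k. U k \<noteq> topspace (T k)}"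
    have "\<exists>V. V \<in> \<B> k \<and> x k \<in> V \<and> V \<subseteq> U k" for k
      using countable_baseD(3)[OF B U(2)[of k], of "x k"] U(3) by (auto simp: PiE_iff)
    then obtain V where V: "\<And>k. V k \<in> \<B> k" "\<And>k. x k \<in> V k" "\<And>k. V k \<subseteq> U k"
      by metis
    let ?W = "PiE UNIV (\<lambda>k. if k \<in> J then restrict V J k else topspace (T k))"
    have "x \<in> ?W" using V U(3) by (auto simp: PiE_iff J_def)
    moreover have "?W \<subseteq> PiE UNIV U"
      using V by (intro PiE_mono) (auto simp: J_def)
    moreover have "?W \<in> box_base T \<B>"
      unfolding box_base_def
    proof (intro UN_I[of J] imageI)
      show "J \<in> Collect finite" using U(1) by (simp add: J_def)
      show "restrict V J \<in> PiE J \<B>" using V(1) by (simp add: restrict_PiE_iff)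
    qed
    ultimately show ?thesis by (intro bexI[of _ ?W] conjI subset_trans[OF _ U(4)])
  qed
qed

lemma second_countable_seq_topology:
  fixes T :: "nat \<Rightarrow> 'a topology"
  assumes "\<And>k. second_countable (T k)"
  shows "second_countable (seq_topology T)"
proof -
  obtain \<B> where "\<And>k. countable_base (T k) (\<B> k)"
    using assms unfolding second_countable_iff_base by metis
  then show ?thesis
    using countable_base_seq_topology unfolding second_countable_iff_base by blast
qed

lemma sets_borel_of_seq_topology:
  fixes T :: "nat \<Rightarrow> 'a topology"
  assumes "\<And>k. second_countable (T k)"
  shows "sets (PiM UNIV (\<lambda>k. borel_of (T k))) = sets (borel_of (seq_topology T))"
proof
  obtain \<B> where B: "\<And>k. countable_base (T k) (\<B> k)"
    using assms unfolding second_countable_iff_base by metis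
  show "sets (borel_of (seq_topology T)) \<subseteq> sets (PiM UNIV (\<lambda>k. borel_of (T k)))"
  proof (rule sets_borel_of_subset_if_base[OF countable_base_seq_topology[OF B]])
    have "PiE UNIV (\<lambda>k. if k \<in> J then V k else topspace (T k)) \<in> sets (PiM UNIV (\<lambda>k. borel_of (T k)))"
      if "V \<in> PiE J \<B>" for J V
      using that countable_baseD(2)[OF B]
      by (intro sets_PiM_I_countable openin_in_borel_of) (auto simp: PiE_iff)
    then show "box_base T \<B> \<subseteq> sets (PiM UNIV (\<lambda>k. borel_of (T k)))"
      unfolding box_base_def by blast
  qed (simp add: space_PiM)
  have "(\<lambda>x k. x k) \<in> borel_of (seq_topology T) \<rightarrow>\<^sub>M PiM UNIV (\<lambda>k. borel_of (T k))"
  proof (rule measurable_PiM_single')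
    show "(\<lambda>x. x k) \<in> borel_of (seq_topology T) \<rightarrow>\<^sub>M borel_of (T k)" for k
      by (rule continuous_map_measurable_borel_of[OF continuous_map_product_projection]) simp
  qed simp
  then show "sets (PiM UNIV (\<lambda>k. borel_of (T k))) \<subseteq> sets (borel_of (seq_topology T))"
    by (rule sets_subset_if_id_measurable) (simp add: space_PiM)
qed

lemma compactum_seq_topology:
  fixes T :: "nat \<Rightarrow> 'a topology"
  assumes "\<And>k. compactum (T k)" shows "compactum (seq_topology T)"
  using assms second_countable_seq_topology[of T]
  by (auto simp: compactum_def compact_space_product_topology Hausdorff_space_product_topology)

lemma space_borel_prob: "P \<in> borel_prob_measures X \<Longrightarrow> space P = topspace X"
  unfolding borel_prob_measures_def using sets_eq_imp_space_eq[of P "borel_of X"] by auto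

lemma sets_borel_prob: "P \<in> borel_prob_measures X \<Longrightarrow> sets P = sets (borel_of X)"
  unfolding borel_prob_measures_def by auto

lemma prob_space_borel_prob: "P \<in> borel_prob_measures X \<Longrightarrow> prob_space P"
  unfolding borel_prob_measures_def by auto

lemma measurable_borel_prob:
  "P \<in> borel_prob_measures X \<Longrightarrow> measurable P N = measurable (borel_of X) N"
  by (intro measurable_cong_sets sets_borel_prob) auto

lemma (in prob_space) integrable_bounded:
  assumes "f \<in> borel_measurable M" "\<And>x. x \<in> space M \<Longrightarrow> \<bar>f x\<bar> \<le> (B::real)"
  shows "integrable M f"
  using assms by (intro integrable_const_bound[of _ B] AE_I2) auto

lemma (in prob_space) abs_integral_le:
  assumes "f \<in> borel_measurable M" "\<And>x. x \<in> space M \<Longrightarrow> \<bar>f x\<bar> \<le> (B::real)"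
  shows "\<bar>integral\<^sup>L M f\<bar> \<le> B"
proof -
  have int: "integrable M f" by (rule integrable_bounded[OF assms])
  have "\<bar>integral\<^sup>L M f\<bar> \<le> (\<integral>x. \<bar>f x\<bar> \<partial>M)" by (rule integral_abs_bound)
  also have "\<dots> \<le> (\<integral>x. B \<partial>M)" using int assms(2) by (intro integral_mono) auto
  finally show ?thesis by (simp add: prob_space)
qed

lemma (in prob_space) integral_uniform_measure:
  fixes f :: "'a \<Rightarrow> real"
  assumes A: "A \<in> sets M" "0 < measure M A" and f: "f \<in> borel_measurable M"
  shows "integral\<^sup>L (uniform_measure M A) f = (\<integral>x\<in>A. f x \<partial>M) / measure M A"
proof -
  have eq: "indicator A x / emeasure M A = ennreal (indicator A x / measure M A)" for x
    using A(2) by (simp add: emeasure_eq_measure divide_ennreal ennreal_indicator[symmetric])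
  have "integral\<^sup>L (uniform_measure M A) f = (\<integral>x. (indicator A x / measure M A) *\<^sub>R f x \<partial>M)"
    unfolding uniform_measure_def eq using A f by (intro integral_density) auto
  also have "\<dots> = (\<integral>x\<in>A. f x \<partial>M) / measure M A"
    by (simp add: set_lebesgue_integral_def)
  finally show ?thesis .
qed

lemma compact_continuous_bounded:
  assumes "compact_space X" "continuous_map X euclideanreal f"
  shows "\<exists>B. \<forall>x\<in>topspace X. \<bar>f x\<bar> \<le> B"
proof -
  have "compactin euclidean (f ` topspace X)"
    using image_compactin[OF _ assms(2)] assms(1) by (auto simp: compact_space_def)
  then have "bounded (f ` topspace X)" by (simp add: compact_imp_bounded)
  then show ?thesis by (auto simp: bounded_iff)
qed

lemma integrable_continuous_map:
  assumes "compactum X" "P \<in> borel_prob_measures X" "continuous_map X euclideanreal f"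
  shows "integrable P f"
proof -
  obtain B where "\<forall>x\<in>topspace X. \<bar>f x\<bar> \<le> B"
    using compact_continuous_bounded assms unfolding compactum_def by blast
  then show ?thesis
    using assms(2,3) prob_space_borel_prob[OF assms(2)]
    by (intro prob_space.integrable_bounded)
       (auto simp: measurable_borel_prob space_borel_prob continuous_map_borel_measurable)
qed

lemma compactum_Urysohn:
  assumes X: "compactum X" and C: "closedin X C" "openin X U" "C \<subseteq> U"
  shows "\<exists>f. continuous_map X euclideanreal f \<and> (\<forall>x\<in>topspace X. 0 \<le> f x \<and> f x \<le> 1) \<and>
    (\<forall>x\<in>C. f x = 1) \<and> (\<forall>x\<in>topspace X. x \<notin> U \<longrightarrow> f x = 0)"
proof -
  have "normal_space X"
    using X by (auto simp: compactum_def intro: compact_Hausdorff_or_regular_imp_normal_space)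
  moreover have "closedin X (topspace X - U)" "disjnt (topspace X - U) C"
    using C by (auto simp: disjnt_def)
  ultimately obtain f :: "'a \<Rightarrow> real" where f: "continuous_map X (top_of_set {0..1}) f" 
    "f ` (topspace X - U) \<subseteq> {0}" "f ` C \<subseteq> {1}"
    using C(1) unfolding normal_space_iff_Urysohn by metis
  show ?thesis
    using f by (intro exI[of _ f]) (auto simp: continuous_map_in_subtopology)
qed

text \<open>
  For a base that is closed under finite unions, every open set is the union of the members whose
  closure lies in it, and by compactness each such closure lies in a further member inside the open
  set.  Urysohn functions for the countably many pairs of members therefore recover the measure of
  every open set as a supremum of integrals.
\<close>

lemma countable_determining_functions:
  assumes X: "compactum X"
  obtains F :: "nat \<Rightarrow> 'a \<Rightarrow> real" where "\<And>i. continuous_map X euclideanreal (F i)"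
    "\<And>i x. x \<in> topspace X \<Longrightarrow> 0 \<le> F i x \<and> F i x \<le> 1"
    "\<And>P Q. P \<in> borel_prob_measures X \<Longrightarrow> Q \<in> borel_prob_measures X \<Longrightarrow>
       (\<And>i. integral\<^sup>L P (F i) = integral\<^sup>L Q (F i)) \<Longrightarrow> P = Q"
proof -
  obtain \<B>0 where "countable_base X \<B>0"
    using X unfolding compactum_def second_countable_iff_base by blast
  note B0 = countable_baseD[OF this]
  \<comment> \<open>closing the base under finite unions leaves it countable\<close>
  define \<B> where "\<B> = Union ` {\<C>. \<C> \<subseteq> \<B>0 \<and> finite \<C>}"
  have cB: "countable \<B>"
    unfolding \<B>_def using countable_Collect_finite_subset[OF B0(1)]
    by (metis (no_types, lifting) Collect_cong countable_image)
  have oB: "openin X V" if "V \<in> \<B>" for V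
    using that B0(2) by (auto simp: \<B>_def)
  have BUn: "V \<union> W \<in> \<B>" if VW: "V \<in> \<B>" "W \<in> \<B>" for V W
  proof -
    obtain \<C> \<D> where "V = \<Union>\<C>" "W = \<Union>\<D>" "\<C> \<subseteq> \<B>0" "finite \<C>" "\<D> \<subseteq> \<B>0" "finite \<D>"
      using VW by (auto simp: \<B>_def)
    then show ?thesis unfolding \<B>_def by (intro image_eqI[of _ _ "\<C> \<union> \<D>"]) auto
  qed
  have B0B: "V \<in> \<B>" if "V \<in> \<B>0" for V
    unfolding \<B>_def using that by (intro image_eqI[of _ _ "{V}"]) auto
  have eB: "{} \<in> \<B>" unfolding \<B>_def by (intro image_eqI[of _ _ "{}"]) auto
  have reg: "regular_space X"
    using X by (auto simp: compactum_def compact_Hausdorff_imp_regular_space)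
  have between: "\<exists>V'\<in>\<B>. C \<subseteq> V' \<and> V' \<subseteq> U" if U: "openin X U" "closedin X C" "C \<subseteq> U" for U C
  proof -
    have "compactin X C" using U X by (simp add: closedin_compact_space compactum_def)
    moreover have "C \<subseteq> \<Union>{V\<in>\<B>0. V \<subseteq> U}" using U B0(3)[OF U(1)] by blast
    ultimately obtain \<F> where "finite \<F>" "\<F> \<subseteq> {V\<in>\<B>0. V \<subseteq> U}" "C \<subseteq> \<Union>\<F>"
      using B0(2) by (metis (no_types, lifting) compactin_def mem_Collect_eq)
    then show ?thesis by (intro bexI[of _ "\<Union>\<F>"]) (auto simp: \<B>_def)
  qed
  define \<P> where "\<P> = {(V, W). V \<in> \<B> \<and> W \<in> \<B> \<and> X closure_of V \<subseteq> W}"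
  have cP: "countable \<P>" by (rule countable_subset[OF _ countable_SIGMA[OF cB cB]]) (auto simp: \<P>_def)
  have "({}, {}) \<in> \<P>" by (simp add: \<P>_def eB)
  then have neP: "\<P> \<noteq> {}" by blast
  have "\<forall>p\<in>\<P>. \<exists>f. continuous_map X euclideanreal f \<and> (\<forall>x\<in>topspace X. 0 \<le> f x \<and> f x \<le> 1) \<and>
      (\<forall>x\<in>X closure_of fst p. f x = 1) \<and> (\<forall>x\<in>topspace X. x \<notin> snd p \<longrightarrow> f x = 0)"
  proof
    fix p assume "p \<in> \<P>"
    then have p: "X closure_of fst p \<subseteq> snd p" "snd p \<in> \<B>" by (auto simp: \<P>_def)
    show "\<exists>f. continuous_map X euclideanreal f \<and> (\<forall>x\<in>topspace X. 0 \<le> f x \<and> f x \<le> 1) \<and>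
      (\<forall>x\<in>X closure_of fst p. f x = 1) \<and> (\<forall>x\<in>topspace X. x \<notin> snd p \<longrightarrow> f x = 0)"
      by (rule compactum_Urysohn[OF X closedin_closure_of oB[OF p(2)] p(1)])
  qed
  from bchoice[OF this] obtain u where u0: "\<forall>p\<in>\<P>. continuous_map X euclideanreal (u p) \<and>
      (\<forall>x\<in>topspace X. 0 \<le> u p x \<and> u p x \<le> 1) \<and>
      (\<forall>x\<in>X closure_of fst p. u p x = 1) \<and> (\<forall>x\<in>topspace X. x \<notin> snd p \<longrightarrow> u p x = 0)"
    by blast
  have u: "continuous_map X euclideanreal (u p)"
    "\<And>x. x \<in> topspace X \<Longrightarrow> 0 \<le> u p x \<and> u p x \<le> 1"
    "\<And>x. x \<in> X closure_of fst p \<Longrightarrow> u p x = 1"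
    "\<And>x. x \<in> topspace X \<Longrightarrow> x \<notin> snd p \<Longrightarrow> u p x = 0" if "p \<in> \<P>" for p
    using u0 that by auto
  have le: "measure P U \<le> measure Q U"
    if PQ: "P \<in> borel_prob_measures X" "Q \<in> borel_prob_measures X"
      "\<And>p. p \<in> \<P> \<Longrightarrow> integral\<^sup>L P (u p) = integral\<^sup>L Q (u p)" and U: "openin X U" for P Q U
  proof -
    interpret P: prob_space P using prob_space_borel_prob[OF PQ(1)] .
    interpret Q: prob_space Q using prob_space_borel_prob[OF PQ(2)] .
    have UP: "S \<in> sets P" "S \<in> sets Q" if "openin X S" for S
      using that PQ by (auto simp: sets_borel_prob openin_in_borel_of)
    have small: "measure P V \<le> measure Q U" if V: "V \<in> \<B>" "X closure_of V \<subseteq> U" for V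
    proof -
      obtain W where W: "W \<in> \<B>" "X closure_of V \<subseteq> W" "W \<subseteq> U"
        using between[OF U closedin_closure_of V(2)] by blast
      have p: "(V, W) \<in> \<P>" using V W by (auto simp: \<P>_def)
      have VX: "V \<subseteq> X closure_of V" "V \<subseteq> topspace X" 
        using oB[OF V(1)] closure_of_subset openin_subset by metis+
      have int: "integrable P (u (V, W))" "integrable Q (u (V, W))"
        using u(1)[OF p] integrable_continuous_map[OF X] PQ by auto
      have ind: "integrable P (indicat_real V)" "integrable Q (indicat_real U)"
        using UP(1)[OF oB[OF V(1)]] UP(2)[OF U] P.emeasure_finite Q.emeasure_finite
        by (auto simp: less_top[symmetric])
      have "measure P V = (\<integral>x. indicator V x \<partial>P)"
        using UP(1)[OF oB[OF V(1)]] by simp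
      also have "\<dots> \<le> integral\<^sup>L P (u (V, W))"
        using u[OF p] VX by (intro integral_mono int ind)
           (auto simp: indicator_def space_borel_prob[OF PQ(1)])
      also have "\<dots> = integral\<^sup>L Q (u (V, W))" using PQ(3)[OF p] .
      also have "\<dots> \<le> (\<integral>x. indicator U x \<partial>Q)"
      proof (intro integral_mono int ind)
        fix x assume "x \<in> space Q"
        then have x: "x \<in> topspace X" by (simp add: space_borel_prob[OF PQ(2)])
        show "u (V, W) x \<le> indicator U x"
          using u(2)[OF p x] u(4)[OF p x] W(3) by (cases "x \<in> W") auto
      qed
      also have "\<dots> = measure Q U" using UP(2)[OF U] by simp
      finally show ?thesis .
    qed
    define \<V> where "\<V> = {V \<in> \<B>. X closure_of V \<subseteq> U}"
    have cV: "countable \<V>" "\<V> \<noteq> {}" using cB eB by (auto simp: \<V>_def)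
    have UV: "U = \<Union>\<V>"
    proof
      show "\<Union>\<V> \<subseteq> U"
      proof
        fix x assume "x \<in> \<Union>\<V>"
        then obtain V where V: "V \<in> \<B>" "X closure_of V \<subseteq> U" "x \<in> V" by (auto simp: \<V>_def)
        then show "x \<in> U" using closure_of_subset[OF openin_subset[OF oB[OF V(1)]]] by blast
      qed
      show "U \<subseteq> \<Union>\<V>"
      proof
        fix x assume x: "x \<in> U"
        then obtain S K where SK: "openin X S" "closedin X K" "x \<in> S" "S \<subseteq> K" "K \<subseteq> U"
          using reg[folded neighbourhood_base_of_closedin, unfolded neighbourhood_base_of, rule_format, of U x]
            U by blast
        obtain V where V: "V \<in> \<B>0" "x \<in> V" "V \<subseteq> S" using B0(3)[OF SK(1,3)] by blast
        have "X closure_of V \<subseteq> K" using V SK closure_of_minimal by (metis subset_trans)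
        then show "x \<in> \<Union>\<V>"
          using V SK B0B unfolding \<V>_def by (intro UnionI[of V]) auto
      qed
    qed
    define e where "e = from_nat_into \<V>"
    have re: "range e = \<V>" unfolding e_def by (rule range_from_nat_into[OF cV(2,1)])
    have fin: "(\<Union>i\<le>n. e i) \<in> \<V>" for n
    proof (induction n)
      case 0 then show ?case using re by auto
    next
      case (Suc n)
      have "e (Suc n) \<in> \<V>" using re by auto
      then show ?case using Suc BUn by (auto simp: \<V>_def atMost_Suc closure_of_Un Un_commute)
    qed
    have "(\<lambda>n. measure P (\<Union>i\<le>n. e i)) \<longlonglongrightarrow> measure P (\<Union>n. \<Union>i\<le>n. e i)"
    proof (rule P.finite_Lim_measure_incseq)
      show "range (\<lambda>n. \<Union>i\<le>n. e i) \<subseteq> sets P" using fin UP(1) oB by (auto simp: \<V>_def)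
      show "incseq (\<lambda>n. \<Union>i\<le>n. e i)" by (force simp: incseq_def)
    qed
    moreover have "(\<Union>n. \<Union>i\<le>n. e i) = U" using UV re by auto
    ultimately show ?thesis
      using small fin by (intro LIMSEQ_le_const2) (auto simp: \<V>_def)
  qed
  show thesis
  proof (rule that[of "\<lambda>i. u (from_nat_into \<P> i)"])
    show "continuous_map X euclideanreal (u (from_nat_into \<P> i))" for i
      using u from_nat_into[OF neP] by auto
    show "0 \<le> u (from_nat_into \<P> i) x \<and> u (from_nat_into \<P> i) x \<le> 1" if "x \<in> topspace X" for i x
      using u from_nat_into[OF neP] that by auto
    show "P = Q" if PQ: "P \<in> borel_prob_measures X" "Q \<in> borel_prob_measures X"
      "\<And>i. integral\<^sup>L P (u (from_nat_into \<P> i)) = integral\<^sup>L Q (u (from_nat_into \<P> i))" for P Q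
    proof -
      interpret P: prob_space P using prob_space_borel_prob[OF PQ(1)] .
      interpret Q: prob_space Q using prob_space_borel_prob[OF PQ(2)] .
      have eq: "integral\<^sup>L P (u p) = integral\<^sup>L Q (u p)" if "p \<in> \<P>" for p
        using PQ(3) range_from_nat_into[OF neP cP] that by (metis imageE)
      have "measure P U = measure Q U" if "openin X U" for U
        using le[OF PQ(1,2) eq that] le[OF PQ(2,1) eq[symmetric] that] by simp
      then have em: "emeasure P U = emeasure Q U" if "openin X U" for U
        using that by (simp add: P.emeasure_eq_measure Q.emeasure_eq_measure)
      show ?thesis
      proof (rule measure_eqI_generator_eq[where E = "{U. openin X U}" and A = "\<lambda>_. topspace X"])
        show "Int_stable {U. openin X U}" by (auto simp: Int_stable_def)
        show "{U. openin X U} \<subseteq> Pow (topspace X)" by (auto dest: openin_subset)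
        show "sets P = sigma_sets (topspace X) {U. openin X U}" "sets Q = sigma_sets (topspace X) {U. openin X U}"
          using PQ by (auto simp: sets_borel_prob sets_borel_of)
      qed (use em in auto)
    qed
  qed
qed

lemma borel_prob_eqI:
  assumes X: "compactum X" and P: "P \<in> borel_prob_measures X" "Q \<in> borel_prob_measures X"
    and eq: "\<And>f. continuous_map X euclideanreal f \<Longrightarrow> integral\<^sup>L P f = integral\<^sup>L Q f"
  shows "P = Q"
proof -
  obtain F :: "nat \<Rightarrow> 'a \<Rightarrow> real" where F: "\<And>i. continuous_map X euclideanreal (F i)"
    "\<And>i x. x \<in> topspace X \<Longrightarrow> 0 \<le> F i x \<and> F i x \<le> 1"
    "\<And>P Q. P \<in> borel_prob_measures X \<Longrightarrow> Q \<in> borel_prob_measures X \<Longrightarrow>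
       (\<And>i. integral\<^sup>L P (F i) = integral\<^sup>L Q (F i)) \<Longrightarrow> P = Q"
    using countable_determining_functions[OF X] by blast
  show ?thesis by (rule F(3)[OF P eq[OF F(1)]])
qed

text \<open>
  Compactness of \<open>Y\<close> makes \<open>F x'\<close> uniformly close to \<open>F x\<close> for \<open>x'\<close> in a neighbourhood of \<open>x\<close>.
\<close>

lemma continuous_map_integral_parameter:
  assumes Y: "compact_space Y" "P \<in> borel_prob_measures Y"
    and F: "continuous_map (prod_topology X Y) euclideanreal (\<lambda>(x, y). F x y)"
  shows "continuous_map X euclideanreal (\<lambda>x. \<integral>y. F x y \<partial>P)"
proof -
  interpret P: prob_space P using prob_space_borel_prob[OF Y(2)] .
  have cont: "continuous_map Y euclideanreal (F x)" if "x \<in> topspace X" for x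
  proof -
    have "continuous_map Y (prod_topology X Y) (\<lambda>y. (x, y))"
      using that by (simp add: continuous_map_pairwise comp_def)
    from continuous_map_compose[OF this F] show ?thesis by (simp add: comp_def)
  qed
  have int: "integrable P (F x)" if x: "x \<in> topspace X" for x
  proof -
    obtain B where "\<forall>y\<in>topspace Y. \<bar>F x y\<bar> \<le> B"
      using compact_continuous_bounded[OF Y(1) cont[OF x]] by blast
    then show ?thesis
      using cont[OF x] by (intro P.integrable_bounded)
       (auto simp: measurable_borel_prob[OF Y(2)] space_borel_prob[OF Y(2)] continuous_map_borel_measurable)
  qed
  have "\<exists>U. openin X U \<and> x \<in> U \<and> (\<forall>x'\<in>U. \<bar>(\<integral>y. F x' y \<partial>P) - (\<integral>y. F x y \<partial>P)\<bar> < e)"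
    if x: "x \<in> topspace X" and e: "0 < e" for x e
  proof -
    define W where "W = {p \<in> topspace (prod_topology X Y). F (fst p) (snd p) - F x (snd p) \<in> {-e/2<..<e/2}}"
    have "continuous_map (prod_topology X Y) euclideanreal (\<lambda>p. F (fst p) (snd p) - F x (snd p))"
      using F continuous_map_compose[OF continuous_map_snd cont[OF x], of X]
      by (intro continuous_map_diff) (auto simp: comp_def case_prod_unfold)
    then have W: "openin (prod_topology X Y) W"
      unfolding W_def by (rule openin_continuous_map_preimage) simp
    have "{x} \<times> topspace Y \<subseteq> W" using x e by (auto simp: W_def)
    then obtain U V where UV: "openin X U" "openin Y V" "{x} \<subseteq> U" "topspace Y \<subseteq> V" "U \<times> V \<subseteq> W"
      using Wallace_theorem_prod_topology[OF _ _ W, of "{x}" "topspace Y"] x Y(1)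
      unfolding compact_space_def by (auto simp del: singleton_insert_inj_eq)
    have "\<bar>(\<integral>y. F x' y \<partial>P) - (\<integral>y. F x y \<partial>P)\<bar> < e" if x': "x' \<in> U" for x'
    proof -
      have xX: "x' \<in> topspace X" using UV x' openin_subset by blast
      have "\<bar>F x' y - F x y\<bar> \<le> e/2" if "y \<in> space P" for y
      proof -
        have "(x', y) \<in> W" using UV x' that space_borel_prob[OF Y(2)] by auto
        then have "F x' y - F x y \<in> {-e/2<..<e/2}" by (simp add: W_def del: greaterThanLessThan_iff)
        then have "- (e/2) < F x' y - F x y \<and> F x' y - F x y < e/2" by simp
        then show ?thesis by linarith
      qed
      then have "\<bar>\<integral>y. F x' y - F x y \<partial>P\<bar> \<le> e/2"
        using int[OF xX] int[OF x] by (intro P.abs_integral_le) auto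
      then show ?thesis using int[OF xX] int[OF x] e by simp
    qed
    then show ?thesis using UV by auto
  qed
  then show ?thesis
    unfolding Met_TC.continuous_map_to_metric[of X, unfolded mtopology_is_euclidean]
    by (simp add: dist_real_def abs_minus_commute)
qed

section \<open>Sequential weak compactness\<close>

text \<open>
  Weak limits are first formed on the Cantor space \<open>nat \<Rightarrow> bool\<close>. The sets that depend on finitely many
  coordinates are its clopen subsets; there are countably many of them, and finite additivity on them is
  enough to define a measure.
\<close>

definition cylinders :: "(nat \<Rightarrow> bool) set set" where
  "cylinders = {A. \<exists>n. \<forall>b b'. (\<forall>i<n. b i = b' i) \<longrightarrow> (b \<in> A \<longleftrightarrow> b' \<in> A)}"

lemma cylindersI: "(\<And>b b'. (\<And>i. i < n \<Longrightarrow> b i = b' i) \<Longrightarrow> b \<in> A \<Longrightarrow> b' \<in> A) \<Longrightarrow> A \<in> cylinders"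
  unfolding cylinders_def by (intro CollectI exI[of _ n]) metis

lemma ring_of_sets_cylinders: "ring_of_sets UNIV cylinders"
proof (rule ring_of_setsI)
  show "{} \<in> cylinders" by (auto simp: cylinders_def)
  fix A B assume A: "A \<in> cylinders" "B \<in> cylinders"
  obtain n where n: "\<And>b b'. \<forall>i<n. b i = b' i \<Longrightarrow> b \<in> A \<longleftrightarrow> b' \<in> A"
    using A(1) by (auto simp: cylinders_def)
  obtain m where m: "\<And>b b'. \<forall>i<m. b i = b' i \<Longrightarrow> b \<in> B \<longleftrightarrow> b' \<in> B"
    using A(2) by (auto simp: cylinders_def)
  have 1: "b' \<in> A \<union> B" if "\<And>i. i < max n m \<Longrightarrow> b i = b' i" "b \<in> A \<union> B" for b b'
    using that n[of b b'] m[of b b'] by auto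
  have 2: "b' \<in> A - B" if "\<And>i. i < max n m \<Longrightarrow> b i = b' i" "b \<in> A - B" for b b'
    using that n[of b b'] m[of b b'] by auto
  show "A \<union> B \<in> cylinders" using 1 by (rule cylindersI)
  show "A - B \<in> cylinders" using 2 by (rule cylindersI)
qed auto

lemma countable_cylinders: "countable cylinders"
proof -
  have "A \<in> (\<Union>n. (\<lambda>S. {b. map b [0..<n] \<in> S}) ` Pow {l. length l = n})" if A: "A \<in> cylinders" for A
  proof -
    obtain n where n: "\<And>b b'. \<forall>i<n. b i = b' i \<Longrightarrow> b \<in> A \<longleftrightarrow> b' \<in> A"
      using A by (auto simp: cylinders_def)
    have "b \<in> A" if "map b [0..<n] = map b' [0..<n]" "b' \<in> A" for b b'
      using n[of b b'] that by auto
    then have "A = {b. map b [0..<n] \<in> (\<lambda>b. map b [0..<n]) ` A}" by auto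
    then show ?thesis by (intro UN_I[of n] image_eqI[of _ _ "(\<lambda>b. map b [0..<n]) ` A"]) auto
  qed
  moreover have "finite {l :: bool list. length l = n}" for n
    using finite_lists_length_eq[of "UNIV :: bool set" n] by simp
  then have "countable ((\<lambda>S. {b :: nat \<Rightarrow> bool. map b [0..<n] \<in> S}) ` Pow {l. length l = n})" for n
    by (simp add: countable_finite)
  then have "countable (\<Union>n. (\<lambda>S. {b :: nat \<Rightarrow> bool. map b [0..<n] \<in> S}) ` Pow {l. length l = n})"
    by simp
  ultimately show ?thesis by (meson countable_subset subsetI)
qed

text \<open>
  A cylinder is clopen in the compact product topology, so a decreasing sequence of nonempty cylinders
  has a common point.
\<close>

lemma cylinders_nested:
  assumes A: "range A \<subseteq> cylinders" "decseq A" "\<And>n::nat. A n \<noteq> {}"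
  shows "(\<Inter>n. A n) \<noteq> {}"
proof -
  let ?X = "seq_topology (\<lambda>_. discrete_topology (UNIV :: bool set))"
  have "closedin ?X B" if B: "B \<in> cylinders" for B
  proof -
    obtain n where n: "\<And>b b'. \<forall>i<n. b i = b' i \<Longrightarrow> b \<in> B \<longleftrightarrow> b' \<in> B"
      using B by (auto simp: cylinders_def)
    have "\<exists>U. finite {i \<in> UNIV. U i \<noteq> UNIV} \<and> (\<forall>i\<in>UNIV. openin (discrete_topology UNIV) (U i)) \<and>
        b \<in> PiE UNIV U \<and> PiE UNIV U \<subseteq> - B" if b: "b \<notin> B" for b
    proof (intro exI conjI)
      show "finite {i \<in> UNIV. (if i < n then {b i} else UNIV) \<noteq> UNIV}"
        by (rule finite_subset[of _ "{..<n}"]) auto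
      show "PiE UNIV (\<lambda>i. if i < n then {b i} else UNIV) \<subseteq> - B"
      proof
        fix b' assume b': "b' \<in> PiE UNIV (\<lambda>i. if i < n then {b i} else UNIV)"
        have "b' i = b i" if "i < n" for i
          using b' that by (auto simp: PiE_iff split: if_splits dest!: spec[of _ i])
        then show "b' \<in> - B" using n[of b' b] b by auto
      qed
    qed (auto simp: PiE_iff)
    then have "openin ?X (- B)"
      unfolding openin_product_topology_alt by auto
    then show ?thesis by (simp add: closedin_def Compl_eq_Diff_UNIV)
  qed
  moreover have "compact_space ?X"
    by (auto simp: compact_space_product_topology compact_space_discrete_topology)
  ultimately show ?thesis
    using A by (intro compact_space_imp_nest[of ?X]) auto
qed

text \<open>
  A decreasing sequence of cylinders with empty intersection is eventually empty, so a finitely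
  additive function on the cylinders is continuous at the empty set and Caratheodory's extension applies.
\<close>

lemma cylinders_extension:
  assumes nonneg: "\<And>A. A \<in> cylinders \<Longrightarrow> 0 \<le> p A"
    and add: "\<And>A B. A \<in> cylinders \<Longrightarrow> B \<in> cylinders \<Longrightarrow> A \<inter> B = {} \<Longrightarrow> p (A \<union> B) = p A + p B"
    and one: "p UNIV = (1::real)"
  shows "\<exists>M. prob_space M \<and> space M = UNIV \<and> cylinders \<subseteq> sets M \<and> (\<forall>A\<in>cylinders. measure M A = p A)"
proof -
  interpret ring_of_sets UNIV cylinders by (rule ring_of_sets_cylinders)
  have p0: "p {} = 0" using add[of "{}" "{}"] by simp
  have "\<exists>\<mu>. (\<forall>A\<in>cylinders. \<mu> A = ennreal (p A)) \<and> measure_space UNIV (sigma_sets UNIV cylinders) \<mu>"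
  proof (rule caratheodory_empty_continuous)
    show "positive cylinders (\<lambda>A. ennreal (p A))" by (simp add: positive_def p0)
    show "additive cylinders (\<lambda>A. ennreal (p A))"
      using add nonneg by (simp add: additive_def ennreal_plus[symmetric] del: ennreal_plus)
    show "(\<lambda>i. ennreal (p (A i))) \<longlonglongrightarrow> 0"
      if A: "range A \<subseteq> cylinders" "decseq A" "(\<Inter>i. A i) = {}" for A
    proof -
      obtain n where n: "A n = {}" using cylinders_nested[OF A(1,2)] A(3) by blast
      have "A i = {}" if "n \<le> i" for i using decseqD[OF A(2) that] n by auto
      then have "eventually (\<lambda>i. ennreal (p (A i)) = 0) sequentially"
        using p0 by (intro eventually_sequentiallyI[of n]) simp
      then show ?thesis by (rule tendsto_eventually)
    qed
  qed simp
  then obtain \<mu> where mu: "\<forall>A\<in>cylinders. \<mu> A = ennreal (p A)"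
    "measure_space UNIV (sigma_sets UNIV cylinders) \<mu>" by blast
  define M where "M = measure_of UNIV cylinders \<mu>"
  have sp: "space M = UNIV" and se: "sets M = sigma_sets UNIV cylinders"
    by (auto simp: M_def)
  have em: "emeasure M A = \<mu> A" if "A \<in> sigma_sets UNIV cylinders" for A
    unfolding M_def using mu(2) that
    by (intro emeasure_measure_of[OF refl]) (auto simp: measure_space_def)
  have cyl: "A \<in> sets M" if "A \<in> cylinders" for A using that se by auto
  have me: "measure M A = p A" if "A \<in> cylinders" for A
    using em[of A] mu(1) nonneg that by (simp add: measure_def)
  have U: "UNIV \<in> cylinders" by (auto simp: cylinders_def)
  have "prob_space M"
    using em[of UNIV] mu(1) U one sp by (intro prob_spaceI) auto
  then show ?thesis using sp cyl me by blast
qed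

text \<open>
  The diagonal argument, in the form that a countable product of unit intervals is sequentially
  compact.
\<close>

lemma bounded_real_sequences_common_subseq:
  fixes q :: "nat \<Rightarrow> nat \<Rightarrow> real"
  assumes "\<And>m i. q m i \<in> {0..1}"
  shows "\<exists>r l. strict_mono (r :: nat \<Rightarrow> nat) \<and> (\<forall>i. (\<lambda>m. q (r m) i) \<longlonglongrightarrow> l i)"
proof -
  have "compactin (product_topology (\<lambda>_. euclideanreal) UNIV) (PiE UNIV (\<lambda>_::nat. {0..1}))"
    by (auto simp: compactin_PiE)
  then have "seq_compact (PiE UNIV (\<lambda>_::nat. {0..1::real}))"
    by (simp add: euclidean_product_topology compact_eq_seq_compact_metric)
  moreover have "\<forall>m. q m \<in> PiE UNIV (\<lambda>_. {0..1})" using assms by (auto simp: PiE_iff)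
  ultimately obtain l r where "strict_mono (r :: nat \<Rightarrow> nat)" "(q \<circ> r) \<longlonglongrightarrow> l"
    unfolding seq_compact_def by blast
  then show ?thesis
  proof (intro exI conjI allI)
    have "isCont (\<lambda>x. x i) l" for i
      using continuous_on_product_coordinates[of i]
        continuous_on_eq_continuous_at[OF open_UNIV, of "\<lambda>x. x i"] by blast
    from isCont_tendsto_compose[OF this \<open>(q \<circ> r) \<longlonglongrightarrow> l\<close>]
    show "(\<lambda>m. q (r m) i) \<longlonglongrightarrow> l i" for i by (simp add: comp_def)
  qed
qed

lemma convergent_subseq_on_cylinders:
  assumes "\<And>m A. A \<in> cylinders \<Longrightarrow> p m A \<in> {0..1::real}"
  shows "\<exists>r l. strict_mono (r :: nat \<Rightarrow> nat) \<and> (\<forall>A\<in>cylinders. (\<lambda>m. p (r m) A) \<longlonglongrightarrow> l A)"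
proof -
  have "{} \<in> cylinders" by (auto simp: cylinders_def)
  then have ne: "cylinders \<noteq> {}" by blast
  let ?e = "from_nat_into cylinders"
  have "p m (?e i) \<in> {0..1}" for m i by (intro assms from_nat_into ne)
  then obtain r l where r: "strict_mono (r :: nat \<Rightarrow> nat)" "\<forall>i. (\<lambda>m. p (r m) (?e i)) \<longlonglongrightarrow> l i"
    using bounded_real_sequences_common_subseq[of "\<lambda>m i. p m (?e i)"] by blast
  have "(\<lambda>m. p (r m) A) \<longlonglongrightarrow> l (to_nat_on cylinders A)" if "A \<in> cylinders" for A
    using r(2)[rule_format, of "to_nat_on cylinders A"] from_nat_into_to_nat_on[OF countable_cylinders that] by simp
  then show ?thesis
    using r(1) by (intro exI[of _ r] exI[of _ "\<lambda>A. l (to_nat_on cylinders A)"]) blast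
qed

text \<open>
  The sum counts the levels \<open>j / n\<close> that \<open>t\<close> has reached, so it rounds \<open>n t\<close> down to an integer.
\<close>

lemma staircase_bounds:
  fixes t :: real
  assumes t: "0 \<le> t" "t \<le> 1" and n: "0 < n"
  shows "(\<Sum>j=1..n. of_bool (real j / real n \<le> t)) / real n \<le> t"
    and "t \<le> 1 / real n + (\<Sum>j=1..n. of_bool (real j / real n \<le> t)) / real n"
proof -
  let ?k = "nat \<lfloor>real n * t\<rfloor>"
  have le: "?k \<le> n"
  proof -
    have "real n * t \<le> real n" using t n by (simp add: mult_left_le)
    then have "\<lfloor>real n * t\<rfloor> \<le> \<lfloor>real n\<rfloor>" by (rule floor_mono)
    then show ?thesis by simp
  qed
  have iff: "real j / real n \<le> t \<longleftrightarrow> j \<le> ?k" for j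
  proof -
    have "real j / real n \<le> t \<longleftrightarrow> real j \<le> real n * t" using n by (simp add: pos_divide_le_eq mult.commute)
    also have "\<dots> \<longleftrightarrow> int j \<le> \<lfloor>real n * t\<rfloor>" by (simp add: le_floor_iff)
    also have "\<dots> \<longleftrightarrow> j \<le> ?k" using n t by (simp add: le_nat_iff)
    finally show ?thesis .
  qed
  have "{1..n} \<inter> {j. j \<le> ?k} = {1..?k}" using le by auto
  then have "(\<Sum>j=1..n. of_bool (real j / real n \<le> t)) = real ?k"
    unfolding iff by (simp add: sum_of_bool_eq)
  moreover have "real ?k \<le> real n * t" "real n * t \<le> 1 + real ?k"
    using t n by (simp_all add: of_nat_nat) linarith
  ultimately show "(\<Sum>j=1..n. of_bool (real j / real n \<le> t)) / real n \<le> t"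
    "t \<le> 1 / real n + (\<Sum>j=1..n. of_bool (real j / real n \<le> t)) / real n"
    using n by (simp_all add: field_simps)
qed

text \<open>
  A function with values in the unit interval is within \<open>1 / n\<close> of the average of the indicators of
  its closed superlevel sets at the levels \<open>j / n\<close>; this carries upper bounds for the measures of closed
  sets over to its integral.
\<close>

lemma weak_convergence_upper:
  assumes X: "compactum X" and N: "\<And>m::nat. N m \<in> borel_prob_measures X" "P \<in> borel_prob_measures X"
    and K: "\<And>K e. closedin X K \<Longrightarrow> 0 < e \<Longrightarrow> \<forall>\<^sub>F m in sequentially. measure (N m) K < measure P K + e"
    and f: "continuous_map X euclideanreal f" "\<And>x. x \<in> topspace X \<Longrightarrow> 0 \<le> f x \<and> f x \<le> 1" and e: "0 < e"
  shows "\<forall>\<^sub>F m in sequentially. integral\<^sup>L (N m) f < integral\<^sup>L P f + e"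
proof -
  obtain n :: nat where n: "0 < n" "1 / real n < e / 2"
    using e by (metis half_gt_zero nat_approx_posE of_nat_0_less_iff zero_less_Suc)
  define K where "K j = {x \<in> topspace X. f x \<in> {real j / real n..}}" for j
  define g where "g x = (\<Sum>j=1..n. indicat_real (K j) x) / real n" for x
  have K: "closedin X (K j)" for j
    unfolding K_def by (rule closedin_continuous_map_preimage[OF f(1)]) simp
  have g: "g x \<le> f x" "f x \<le> 1 / real n + g x" if "x \<in> topspace X" for x
  proof -
    have "g x = (\<Sum>j=1..n. of_bool (real j / real n \<le> f x)) / real n"
      unfolding g_def using that by (auto simp: K_def indicator_def intro!: sum.cong)
    then show "g x \<le> f x" "f x \<le> 1 / real n + g x"
      using staircase_bounds[of "f x" n] f(2)[OF that] n(1) by auto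
  qed
  have intg: "integrable Q (indicat_real (K j))" "integral\<^sup>L Q g = (\<Sum>j=1..n. measure Q (K j)) / real n" "integrable Q g"
    if Q: "Q \<in> borel_prob_measures X" for Q j
  proof -
    interpret Q: prob_space Q using prob_space_borel_prob[OF Q] .
    have S: "K j \<in> sets Q" for j
      using K by (simp add: sets_borel_prob[OF Q] closedin_in_borel_of)
    show I: "integrable Q (indicat_real (K j))" for j
      using S[of j] Q.emeasure_finite by (auto simp: less_top[symmetric])
    show "integral\<^sup>L Q g = (\<Sum>j=1..n. measure Q (K j)) / real n"
      unfolding g_def using S by (simp add: I)
    show "integrable Q g"
      unfolding g_def using I by (intro integrable_divide Bochner_Integration.integrable_sum) auto
  qed
  have "\<forall>\<^sub>F m in sequentially. \<forall>j\<in>{1..n}. measure (N m) (K j) < measure P (K j) + e / 2"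
    using K assms(4) e by (intro eventually_ball_finite) auto
  then show ?thesis
  proof eventually_elim
    case (elim m)
    interpret Nm: prob_space "N m" using prob_space_borel_prob[OF N(1)] .
    have "integral\<^sup>L (N m) f \<le> (\<integral>x. 1 / real n + g x \<partial>N m)"
      using g(2) intg(3)[OF N(1)] space_borel_prob[OF N(1)]
      by (intro integral_mono integrable_continuous_map[OF X N(1) f(1)]) auto
    also have "\<dots> = 1 / real n + (\<Sum>j=1..n. measure (N m) (K j)) / real n"
      using intg[OF N(1)[of m]] by (simp add: Nm.prob_space)
    also have "\<dots> \<le> 1 / real n + (\<Sum>j=1..n. measure P (K j) + e / 2) / real n"
      using elim by (intro add_left_mono divide_right_mono sum_mono) (auto intro: less_imp_le)
    also have "\<dots> = 1 / real n + integral\<^sup>L P g + e / 2"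
      using n(1) by (simp add: intg(2)[OF N(2)] sum.distrib add_divide_distrib)
    also have "\<dots> < e + integral\<^sup>L P g" using n(2) by simp
    also have "\<dots> \<le> e + integral\<^sup>L P f"
      using g(1) intg(3)[OF N(2)] space_borel_prob[OF N(2)]
      by (intro add_left_mono integral_mono integrable_continuous_map[OF X N(2) f(1)]) auto
    finally show ?case by simp
  qed
qed

text \<open>
  One half of the portmanteau theorem. Rescaling \<open>f\<close> and \<open>-f\<close> into the unit interval gives the upper
  and the lower bound.
\<close>

lemma weak_convergence_if_closed:
  assumes X: "compactum X" and N: "\<And>m::nat. N m \<in> borel_prob_measures X" "P \<in> borel_prob_measures X"
    and K: "\<And>K e. closedin X K \<Longrightarrow> 0 < e \<Longrightarrow> \<forall>\<^sub>F m in sequentially. measure (N m) K < measure P K + e"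
    and f: "continuous_map X euclideanreal f"
  shows "(\<lambda>m. integral\<^sup>L (N m) f) \<longlonglongrightarrow> integral\<^sup>L P f"
proof -
  obtain B0 where B0: "\<forall>x\<in>topspace X. \<bar>f x\<bar> \<le> B0"
    using compact_continuous_bounded X f unfolding compactum_def by blast
  define B where "B = max B0 1"
  have B: "0 < B" "\<And>x. x \<in> topspace X \<Longrightarrow> \<bar>f x\<bar> \<le> B" using B0 by (auto simp: B_def)
  note integrable = integrable_continuous_map[OF X _ f]
  have upper: "\<forall>\<^sub>F m in sequentially. s * integral\<^sup>L (N m) f < s * integral\<^sup>L P f + e"
    if e: "0 < e" and s: "s = 1 \<or> s = -1" for e s
  proof -
    define g where "g x = (s * f x + B) / (2 * B)" for x
    have g: "integral\<^sup>L Q g = (s * integral\<^sup>L Q f + B) / (2 * B)" if Q: "Q \<in> borel_prob_measures X" for Q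
      using integrable[OF Q] prob_space.prob_space[OF prob_space_borel_prob[OF Q]] 
        prob_space.finite_measure[OF prob_space_borel_prob[OF Q]]
      by (simp add: g_def[abs_def] finite_measure.integrable_const)
    have "continuous_map X euclideanreal g"
      unfolding g_def[abs_def] divide_inverse using f
      by (intro continuous_map_real_mult continuous_map_add) auto
    moreover have "0 \<le> g x \<and> g x \<le> 1" if "x \<in> topspace X" for x
      using B(2)[OF that] s B(1) by (auto simp: g_def field_simps abs_le_iff)
    ultimately have "\<forall>\<^sub>F m in sequentially. integral\<^sup>L (N m) g < integral\<^sup>L P g + e / (2 * B)"
      using e B(1) by (intro weak_convergence_upper[OF X N K]) auto
    then show ?thesis
    proof eventually_elim
      case (elim m)
      then have "(s * integral\<^sup>L (N m) f + B) / (2 * B) < (s * integral\<^sup>L P f + B + e) / (2 * B)"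
        by (simp add: g[OF N(1)] g[OF N(2)] add_divide_distrib)
      then show ?case using B(1) by (simp add: divide_less_cancel)
    qed
  qed
  show ?thesis
  proof (rule order_tendstoI)
    show "\<forall>\<^sub>F m in sequentially. a < integral\<^sup>L (N m) f" if "a < integral\<^sup>L P f" for a
      using upper[of "integral\<^sup>L P f - a" "-1"] that by simp
    show "\<forall>\<^sub>F m in sequentially. integral\<^sup>L (N m) f < a" if "integral\<^sup>L P f < a" for a
      using upper[of "a - integral\<^sup>L P f" 1] that by simp
  qed
qed

definition weakly_converges :: "'a topology \<Rightarrow> (nat \<Rightarrow> 'a measure) \<Rightarrow> 'a measure \<Rightarrow> bool" where
  "weakly_converges X N P \<longleftrightarrow>
     (\<forall>f. continuous_map X euclideanreal f \<longrightarrow> (\<lambda>m. integral\<^sup>L (N m) f) \<longlonglongrightarrow> integral\<^sup>L P f)"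

text \<open>
  Code a point by the sequence of its memberships in the members \<open>U i\<close> of a base. Along a
  subsequence the laws of the codes converge on all cylinders, and the limits extend to a measure on the
  Cantor space. It is transported back by decoding: a sequence \<open>b\<close> stands for the point that all the
  closed sets \<open>F i (b i)\<close> have in common, where \<open>F i\<close> is the closure of \<open>U i\<close> or the complement of
  \<open>U i\<close>. There is at most one such point, because the space is Hausdorff. Passing from \<open>U i\<close> to its
  closure only enlarges sets, which is why the limit is first controlled from above on closed sets.
\<close>

theorem borel_prob_measures_weakly_sequentially_compact:
  assumes X: "compactum X" and N: "\<And>m::nat. N m \<in> borel_prob_measures X"
  shows "\<exists>r P. strict_mono (r :: nat \<Rightarrow> nat) \<and> P \<in> borel_prob_measures X \<and>
     weakly_converges X (\<lambda>m. N (r m)) P \<and>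
     (\<forall>K e. closedin X K \<longrightarrow> 0 < e \<longrightarrow> (\<forall>\<^sub>F m in sequentially. measure (N (r m)) K < measure P K + e))"
proof -
  have "prob_space (N 0)" using prob_space_borel_prob[OF N] .
  then have neX: "topspace X \<noteq> {}" using prob_space.not_empty space_borel_prob[OF N] by metis
  then obtain x0 where x0: "x0 \<in> topspace X" by blast
  obtain \<B> where B: "countable_base X \<B>" using X unfolding compactum_def second_countable_iff_base by blast
  have neB: "\<B> \<noteq> {}" using countable_baseD(3)[OF B openin_topspace x0] by blast
  define U where "U = from_nat_into \<B>"
  have oU: "openin X (U i)" for i unfolding U_def using from_nat_into[OF neB] countable_baseD(2)[OF B] by blast
  have rU: "range U = \<B>" unfolding U_def using range_from_nat_into[OF neB countable_baseD(1)[OF B]] .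
  define F where "F i b = (if b then X closure_of U i else topspace X - U i)" for i b
  have cF: "closedin X (F i b)" for i b using oU by (auto simp: F_def)
  define code where "code x = (\<lambda>i. x \<in> U i)" for x
  have code: "x \<in> F i (code x i)" if "x \<in> topspace X" for x i
    using that closure_of_subset[OF openin_subset[OF oU[of i]]] by (auto simp: F_def code_def)
  define cell where "cell K n b = K \<inter> (\<Inter>i\<in>{..<n}. F i (b i))" for K n and b :: "nat \<Rightarrow> bool"
  have sep: "x = y" if xy: "\<And>i. x \<in> F i (b i)" "\<And>i. y \<in> F i (b i)" for x y and b :: "nat \<Rightarrow> bool"
  proof (rule ccontr)
    assume ne: "x \<noteq> y"
    have "x \<in> topspace X" "y \<in> topspace X" using xy[of 0] closedin_subset[OF cF] by blast+
    then obtain V W where VW: "openin X V" "openin X W" "x \<in> V" "y \<in> W" "disjnt V W"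
      using X ne unfolding compactum_def Hausdorff_space_def by metis
    obtain i where i: "x \<in> U i" "U i \<subseteq> V" using countable_baseD(3)[OF B VW(1,3)] rU by (metis imageE)
    have "U i \<inter> W = {}" using i VW(5) by (auto simp: disjnt_def)
    then have "y \<notin> X closure_of U i" using VW(2,4) by (auto simp: in_closure_of)
    then show False using xy[of i] i(1) by (auto simp: F_def split: if_splits)
  qed
  \<comment> \<open>the codes that are consistent with a point of \<open>K\<close> as far as the first \<open>n\<close> memberships tell\<close>
  define C where "C K n = {b. cell K n b \<noteq> {}}" for K n
  have C_cyl: "C K n \<in> cylinders" for K n
  proof (rule cylindersI)
    fix b b' assume "\<And>i. i < n \<Longrightarrow> b i = b' i" and b: "b \<in> C K n"
    then have "cell K n b = cell K n b'" by (auto simp: cell_def)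
    then show "b' \<in> C K n" using b by (simp add: C_def)
  qed
  have decC: "decseq (C K)" for K
    by (force simp: decseq_def C_def cell_def)
  have point: "\<exists>x\<in>K. \<forall>i. x \<in> F i (b i)" if K: "closedin X K" and b: "b \<in> (\<Inter>n. C K n)" for K b
  proof -
    have "(\<Inter>n. cell K n b) \<noteq> {}"
    proof (rule compact_space_imp_nest[of X])
      show "compact_space X" using X by (simp add: compactum_def)
      show "closedin X (cell K n b)" for n
        unfolding cell_def using K cF
        by (induction n) (auto simp: lessThan_Suc Int_left_commute[of K] intro!: closedin_Int)
      show "cell K n b \<noteq> {}" for n using b by (auto simp: C_def)
      show "decseq (\<lambda>n. cell K n b)" by (force simp: decseq_def cell_def)
    qed
    then show ?thesis unfolding cell_def by blast
  qed
  \<comment> \<open>sequences that code no point are sent to the arbitrary point \<open>x0\<close>\<close>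
  define decode where "decode b = (if b \<in> (\<Inter>n. C (topspace X) n) then SOME x. \<forall>i. x \<in> F i (b i) else x0)" for b
  have decode_F: "decode b \<in> F i (b i)" if b: "b \<in> (\<Inter>n. C (topspace X) n)" for b i
  proof -
    have "\<exists>x. \<forall>i. x \<in> F i (b i)" using point[OF closedin_topspace b] by blast
    then have "\<forall>i. (SOME x. \<forall>i. x \<in> F i (b i)) \<in> F i (b i)" by (rule someI_ex)
    then show ?thesis using b by (simp add: decode_def)
  qed
  have decode_X: "decode b \<in> topspace X" for b
  proof (cases "b \<in> (\<Inter>n. C (topspace X) n)")
    case True then show ?thesis using decode_F[OF True, of 0] closedin_subset[OF cF] by blast
  next
    case False
    then have "decode b = x0" unfolding decode_def by (rule if_not_P)
    then show ?thesis using x0 by simp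
  qed
  have CX: "(\<Inter>n. C K n) \<subseteq> (\<Inter>n. C (topspace X) n)" if "closedin X K" for K
    using closedin_subset[OF that] by (fastforce simp: C_def cell_def)
  have decode_K: "decode b \<in> K" if K: "closedin X K" "b \<in> (\<Inter>n. C K n)" for K b
  proof -
    obtain x where x: "x \<in> K" "\<forall>i. x \<in> F i (b i)" using point[OF K] by blast
    have "b \<in> (\<Inter>n. C (topspace X) n)" using CX[OF K(1)] K(2) by blast
    then have "decode b = x" using decode_F x(2) by (intro sep[of _ b]) auto
    then show ?thesis using x by simp
  qed
  have decode_vimage: "decode -` K = (\<Inter>n. C K n) \<union> (if x0 \<in> K then - (\<Inter>n. C (topspace X) n) else {})"
    if K: "closedin X K" for K
  proof -
    have "b \<in> (\<Inter>n. C K n)" if b: "b \<in> (\<Inter>n. C (topspace X) n)" "decode b \<in> K" for b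
      using decode_F[OF b(1)] b(2) by (auto simp: C_def cell_def)
    moreover have "decode b = x0" if "b \<notin> (\<Inter>n. C (topspace X) n)" for b
      using that unfolding decode_def by (rule if_not_P)
    ultimately have iff: "decode b \<in> K \<longleftrightarrow> (if b \<in> (\<Inter>n. C (topspace X) n) then b \<in> (\<Inter>n. C K n) else x0 \<in> K)" for b
      using decode_K[OF K] by metis
    show ?thesis
    proof (rule Set.set_eqI)
      show "b \<in> decode -` K \<longleftrightarrow>
          b \<in> (\<Inter>n. C K n) \<union> (if x0 \<in> K then - (\<Inter>n. C (topspace X) n) else {})" for b
        using CX[OF K] iff[of b]
        by (cases "x0 \<in> K"; cases "b \<in> (\<Inter>n. C (topspace X) n)") (auto simp del: INT_iff)
    qed
  qed
  define p where "p m A = measure (N m) (code -` A \<inter> topspace X)" for m A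
  have spN: "space (N m) = topspace X" for m using space_borel_prob[OF N] .
  have code_meas: "code -` A \<inter> topspace X \<in> sets (N m)" if A: "A \<in> cylinders" for A m
  proof -
    obtain n where n: "\<And>b b'. \<forall>i<n. b i = b' i \<Longrightarrow> b \<in> A \<longleftrightarrow> b' \<in> A"
      using A by (auto simp: cylinders_def)
    define S where "S = {I. I \<subseteq> {..<n} \<and> (\<lambda>i. i \<in> I) \<in> A}"
    have "finite S" by (rule finite_subset[of _ "Pow {..<n}"]) (auto simp: S_def)
    have eq: "code -` A \<inter> topspace X = (\<Union>I\<in>S. {x \<in> topspace X. \<forall>i\<in>{..<n}. x \<in> U i \<longleftrightarrow> i \<in> I})"
    proof (intro Set.set_eqI iffI)
      fix x assume x: "x \<in> code -` A \<inter> topspace X"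
      let ?I = "{i. i < n \<and> x \<in> U i}"
      have "?I \<in> S" using x n[of "code x" "\<lambda>i. i \<in> ?I"] by (auto simp: S_def code_def)
      then show "x \<in> (\<Union>I\<in>S. {x \<in> topspace X. \<forall>i\<in>{..<n}. x \<in> U i \<longleftrightarrow> i \<in> I})"
        using x by (intro UN_I[of ?I]) auto
    next
      fix x assume "x \<in> (\<Union>I\<in>S. {x \<in> topspace X. \<forall>i\<in>{..<n}. x \<in> U i \<longleftrightarrow> i \<in> I})"
      then obtain I where I: "I \<in> S" "x \<in> topspace X" "\<forall>i\<in>{..<n}. x \<in> U i \<longleftrightarrow> i \<in> I" by blast
      then show "x \<in> code -` A \<inter> topspace X"
        using n[of "code x" "\<lambda>i. i \<in> I"] by (auto simp: S_def code_def)
    qed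
    have [measurable]: "U i \<in> sets (N m)" for i using oU openin_in_borel_of sets_borel_prob[OF N] by metis
    have "{x \<in> topspace X. \<forall>i\<in>{..<n}. x \<in> U i \<longleftrightarrow> i \<in> I} \<in> sets (N m)" for I
      unfolding spN[symmetric, of m] by measurable
    then show ?thesis unfolding eq using \<open>finite S\<close> by (intro sets.finite_UN) auto
  qed
  have p01: "p m A \<in> {0..1}" for m A
    using prob_space.prob_le_1[OF prob_space_borel_prob[OF N]] by (auto simp: p_def)
  then obtain r l where r: "strict_mono (r :: nat \<Rightarrow> nat)" "\<forall>A\<in>cylinders. (\<lambda>m. p (r m) A) \<longlonglongrightarrow> l A"
    using convergent_subseq_on_cylinders[of p] by blast
  have "\<exists>M. prob_space M \<and> space M = UNIV \<and> cylinders \<subseteq> sets M \<and> (\<forall>A\<in>cylinders. measure M A = l A)"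
  proof (rule cylinders_extension)
    show "0 \<le> l A" if A: "A \<in> cylinders" for A
      using p01 by (intro LIMSEQ_le_const[OF r(2)[rule_format, OF A]]) auto
    have "p m UNIV = 1" for m
      using prob_space.prob_space[OF prob_space_borel_prob[OF N[of m]]] by (simp add: p_def spN)
    moreover have "UNIV \<in> cylinders" by (auto simp: cylinders_def)
    ultimately show "l UNIV = 1" using r(2) LIMSEQ_unique[OF _ tendsto_const[of 1]] by fastforce
    show "l (A \<union> A') = l A + l A'" if A: "A \<in> cylinders" "A' \<in> cylinders" "A \<inter> A' = {}" for A A'
    proof (rule LIMSEQ_unique)
      have "A \<union> A' \<in> cylinders" using A ring_of_sets.Un[OF ring_of_sets_cylinders] by blast
      then show "(\<lambda>m. p (r m) (A \<union> A')) \<longlonglongrightarrow> l (A \<union> A')" using r(2) by blast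
      have "p m (A \<union> A') = p m A + p m A'" for m
      proof -
        interpret prob_space "N m" using prob_space_borel_prob[OF N] .
        have "code -` (A \<union> A') \<inter> topspace X = (code -` A \<inter> topspace X) \<union> (code -` A' \<inter> topspace X)" by auto
        then show ?thesis
          unfolding p_def using A code_meas
          by (simp only:) (intro finite_measure_Union; auto)
      qed
      then show "(\<lambda>m. p (r m) (A \<union> A')) \<longlonglongrightarrow> l A + l A'"
        using tendsto_add[OF r(2)[rule_format, OF A(1)] r(2)[rule_format, OF A(2)]] by simp
    qed
  qed
  then obtain M where M: "prob_space M" "space M = UNIV" "cylinders \<subseteq> sets M"
    "\<And>A. A \<in> cylinders \<Longrightarrow> measure M A = l A" by blast
  interpret M: prob_space M by (rule M(1))
  have CM: "(\<Inter>n. C K n) \<in> sets M" for K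
    using M(3) C_cyl by (intro sets.countable_INT) auto
  have dec_closed: "decode -` K \<in> sets M" if "closedin X K" for K
    unfolding decode_vimage[OF that] using CM sets.compl_sets[OF CM[of "topspace X"]] M(2)
    by (auto simp: Compl_eq_Diff_UNIV)
  have dec: "decode \<in> M \<rightarrow>\<^sub>M borel_of X"
  proof (rule measurable_sigma_sets[OF sets_borel_of])
    show "decode -` V \<inter> space M \<in> sets M" if "V \<in> {U. openin X U}" for V
    proof -
      have "decode -` V \<inter> space M = space M - decode -` (topspace X - V)"
        using decode_X by (auto simp: M(2))
      also have "\<dots> \<in> sets M" using that by (intro sets.compl_sets dec_closed) auto
      finally show ?thesis .
    qed
  qed (use decode_X in \<open>auto dest: openin_subset\<close>)
  define P where "P = distr M (borel_of X) decode"
  have P: "P \<in> borel_prob_measures X"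
    unfolding borel_prob_measures_def P_def using M.prob_space_distr[OF dec] by simp
  have closed: "\<forall>\<^sub>F m in sequentially. measure (N (r m)) K < measure P K + e"
    if K: "closedin X K" and e: "0 < e" for K e
  proof -
    have "(\<lambda>n. measure M (C K n)) \<longlonglongrightarrow> measure M (\<Inter>n. C K n)"
      using M(3) C_cyl decC by (intro M.finite_Lim_measure_decseq) auto
    moreover have "measure M (\<Inter>n. C K n) < measure M (\<Inter>n. C K n) + e" using e by simp
    ultimately have "\<forall>\<^sub>F n in sequentially. measure M (C K n) < measure M (\<Inter>n. C K n) + e"
      by (rule order_tendstoD)
    then obtain n where n: "measure M (C K n) < measure M (\<Inter>n. C K n) + e"
      by (auto simp: eventually_sequentially)
    have "measure M (\<Inter>n. C K n) \<le> measure M (decode -` K)"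
      using decode_K[OF K] by (intro M.finite_measure_mono dec_closed[OF K]) auto
    also have "\<dots> = measure P K"
      unfolding P_def using dec closedin_in_borel_of[OF K] by (simp add: measure_distr M(2))
    finally have "l (C K n) < measure P K + e" using n M(4)[OF C_cyl, of K n] by simp
    then have "\<forall>\<^sub>F m in sequentially. p (r m) (C K n) < measure P K + e"
      by (intro order_tendstoD(2)[OF r(2)[rule_format, OF C_cyl]])
    then show ?thesis
    proof eventually_elim
      case (elim m)
      interpret Nm: prob_space "N (r m)" using prob_space_borel_prob[OF N] .
      have "K \<subseteq> code -` C K n \<inter> topspace X"
        using code closedin_subset[OF K] by (fastforce simp: C_def cell_def)
      then have "measure (N (r m)) K \<le> p (r m) (C K n)"
        unfolding p_def by (intro Nm.finite_measure_mono code_meas C_cyl)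
      then show ?case using elim by simp
    qed
  qed
  show ?thesis
    unfolding weakly_converges_def
    using r(1) P closed weak_convergence_if_closed[OF X N[of "r _"] P closed] by blast
qed

section \<open>Extreme points of weakly closed sets of measures\<close>

lemma nn_integral_convex_combination:
  assumes P: "P \<in> borel_prob_measures X" "Q \<in> borel_prob_measures X" "R \<in> borel_prob_measures X"
    and t: "0 < t" "t < 1" and comb: "is_convex_combination t Q R P"
    and f: "f \<in> borel_measurable (borel_of X)"
  shows "integral\<^sup>N P f = ennreal (1 - t) * integral\<^sup>N Q f + ennreal t * integral\<^sup>N R f"
proof -
  interpret P: prob_space P using prob_space_borel_prob[OF P(1)] .
  interpret Q: prob_space Q using prob_space_borel_prob[OF P(2)] .
  interpret R: prob_space R using prob_space_borel_prob[OF P(3)] .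
  note meas = measurable_borel_prob[OF P(1)] measurable_borel_prob[OF P(2)] measurable_borel_prob[OF P(3)]
  note spaces = space_borel_prob[OF P(1)] space_borel_prob[OF P(2)] space_borel_prob[OF P(3)]
  note setss = sets_borel_prob[OF P(1)] sets_borel_prob[OF P(2)] sets_borel_prob[OF P(3)]
  show ?thesis
    using f
  proof (induction f rule: borel_measurable_induct)
    case (cong f g)
    have "integral\<^sup>N P f = integral\<^sup>N P g" "integral\<^sup>N Q f = integral\<^sup>N Q g" "integral\<^sup>N R f = integral\<^sup>N R g"
      using cong(3) spaces by (auto intro!: nn_integral_cong)
    then show ?case using cong by simp
  next
    case (set A)
    have "measure P A = (1 - t) * measure Q A + t * measure R A"
      using comb set setss by (auto simp: is_convex_combination_def)
    then have "emeasure P A = ennreal (1 - t) * emeasure Q A + ennreal t * emeasure R A"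
      using t by (simp add: P.emeasure_eq_measure Q.emeasure_eq_measure R.emeasure_eq_measure
          ennreal_mult[symmetric] ennreal_plus[symmetric] del: ennreal_plus)
    then show ?case using set setss by simp
  next
    case (mult u c)
    have "u \<in> borel_measurable P" "u \<in> borel_measurable Q" "u \<in> borel_measurable R"
      using mult(2) unfolding meas by auto
    then show ?case
      by (simp add: nn_integral_cmult mult.IH distrib_left mult.left_commute)
  next
    case (add u v)
    have "u \<in> borel_measurable P" "u \<in> borel_measurable Q" "u \<in> borel_measurable R"
      using add.hyps(1) unfolding meas by auto
    moreover have "v \<in> borel_measurable P" "v \<in> borel_measurable Q" "v \<in> borel_measurable R"
      using add.hyps(3) unfolding meas by auto
    ultimately show ?case
      by (simp add: nn_integral_add add.IH distrib_left add.assoc add.left_commute)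
  next
    case (seq U)
    have [simp]: "(SUP i. U i) = (\<lambda>x. SUP i. U i x)" by (rule ext) (rule SUP_apply)
    have conv: "integral\<^sup>N M (\<lambda>x. SUP i. U i x) = (SUP i. integral\<^sup>N M (U i))"
      if "sets M = sets (borel_of X)" for M
      using seq that measurable_cong_sets[OF that refl]
      by (intro nn_integral_monotone_convergence_SUP) auto
    have inc: "incseq (\<lambda>i. c * integral\<^sup>N M (U i))" for c :: ennreal and M
      using seq(3) by (auto simp: incseq_def le_fun_def intro!: mult_left_mono nn_integral_mono)
    show ?case
      using seq by (simp add: conv setss SUP_mult_left_ennreal ennreal_SUP_add[OF inc inc])
  qed
qed

lemma integral_convex_combination:
  assumes P: "P \<in> borel_prob_measures X" "Q \<in> borel_prob_measures X" "R \<in> borel_prob_measures X"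
    and t: "0 < t" "t < 1" and comb: "is_convex_combination t Q R P"
    and f: "f \<in> borel_measurable (borel_of X)" "\<And>x. x \<in> topspace X \<Longrightarrow> 0 \<le> f x \<and> f x \<le> (1::real)"
  shows "integral\<^sup>L P f = (1 - t) * integral\<^sup>L Q f + t * integral\<^sup>L R f"
proof -
  have eq: "integral\<^sup>N M (\<lambda>x. ennreal (f x)) = ennreal (integral\<^sup>L M f)" "0 \<le> integral\<^sup>L M f"
    if M: "M \<in> borel_prob_measures X" for M
  proof -
    interpret prob_space M using prob_space_borel_prob[OF M] .
    have "integrable M f"
      using f by (intro integrable_bounded[of _ 1]) (auto simp: measurable_borel_prob[OF M] space_borel_prob[OF M])
    then show "integral\<^sup>N M (\<lambda>x. ennreal (f x)) = ennreal (integral\<^sup>L M f)"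
      using f(2) by (intro nn_integral_eq_integral) (auto simp: space_borel_prob[OF M])
    show "0 \<le> integral\<^sup>L M f"
      using f(2) by (intro integral_nonneg_AE AE_I2) (auto simp: space_borel_prob[OF M])
  qed
  have "ennreal (integral\<^sup>L P f) = ennreal ((1 - t) * integral\<^sup>L Q f + t * integral\<^sup>L R f)"
    using nn_integral_convex_combination[OF P t comb, of "\<lambda>x. ennreal (f x)"] f(1) t eq(2)[OF P(2)] eq(2)[OF P(3)]
    by (simp add: eq(1)[OF P(1)] eq(1)[OF P(2)] eq(1)[OF P(3)] ennreal_mult ennreal_plus)
  then show ?thesis
    using t eq(2)[OF P(1)] eq(2)[OF P(2)] eq(2)[OF P(3)] by (subst (asm) ennreal_inj) auto
qed

text \<open>
  The functional \<open>\<Sum>i. (\<integral> F i dP)\<^sup>2 / 2 ^ i\<close> over a countable determining family is weakly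
  continuous and strictly convex, hence attains its maximum on a weakly closed set, and any maximiser
  is an extreme point.
\<close>

theorem extreme_measures_nonempty:
  assumes X: "compactum X" and S: "S \<subseteq> borel_prob_measures X" "S \<noteq> {}"
    and closed: "\<And>N P. (\<And>m. N m \<in> S) \<Longrightarrow> P \<in> borel_prob_measures X \<Longrightarrow> weakly_converges X N P \<Longrightarrow> P \<in> S"
  shows "extreme_measures S \<noteq> {}"
proof -
  obtain F :: "nat \<Rightarrow> 'a \<Rightarrow> real" where F: "\<And>i. continuous_map X euclideanreal (F i)"
    "\<And>i x. x \<in> topspace X \<Longrightarrow> 0 \<le> F i x \<and> F i x \<le> 1"
    "\<And>P Q. P \<in> borel_prob_measures X \<Longrightarrow> Q \<in> borel_prob_measures X \<Longrightarrow>
       (\<And>i. integral\<^sup>L P (F i) = integral\<^sup>L Q (F i)) \<Longrightarrow> P = Q"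
    using countable_determining_functions[OF X] by blast
  define \<Phi> where "\<Phi> P = (\<Sum>i. (integral\<^sup>L P (F i))\<^sup>2 * (1/2) ^ i)" for P
  have int01: "\<bar>integral\<^sup>L P (F i)\<bar> \<le> 1" if "P \<in> S" for P i
  proof -
    have P: "P \<in> borel_prob_measures X" using S that by blast
    show ?thesis
      using F(2) prob_space_borel_prob[OF P]
      by (intro prob_space.abs_integral_le)
         (auto simp: measurable_borel_prob[OF P] space_borel_prob[OF P] intro: continuous_map_borel_measurable[OF F(1)])
  qed
  have term_le: "norm ((integral\<^sup>L P (F i))\<^sup>2 * (1/2) ^ i) \<le> (1/2) ^ i" if "P \<in> S" for P i
    using int01[OF that, of i] by (simp add: abs_mult abs_square_le_1 mult_left_le_one_le)
  have geo: "summable (\<lambda>i. (1/2 :: real) ^ i)" by (rule summable_geometric) simp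
  have summ: "summable (\<lambda>i. (integral\<^sup>L P (F i))\<^sup>2 * (1/2) ^ i)" if "P \<in> S" for P
    using term_le[OF that] by (intro summable_comparison_test'[OF geo, of 0])
  have le2: "\<Phi> P \<le> 2" if "P \<in> S" for P
  proof -
    have "\<Phi> P \<le> (\<Sum>i. (1/2) ^ i)"
      unfolding \<Phi>_def using term_le[OF that] by (intro suminf_le summ that geo) (auto dest: abs_le_D1)
    then show ?thesis by (simp add: suminf_geometric)
  qed
  have bdd: "bdd_above (\<Phi> ` S)" using le2 by (auto intro!: bdd_aboveI)
  define s where "s = Sup (\<Phi> ` S)"
  have s: "\<Phi> P \<le> s" if "P \<in> S" for P unfolding s_def using that bdd by (intro cSup_upper) auto
  have "\<exists>P\<in>S. s - 1 / real (Suc m) < \<Phi> P" for m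
  proof -
    have "s - 1 / real (Suc m) < Sup (\<Phi> ` S)" unfolding s_def by simp
    then show ?thesis using less_cSup_iff[OF _ bdd] S(2) by auto
  qed
  then obtain N where N: "\<And>m. N m \<in> S" "\<And>m. s - 1 / real (Suc m) < \<Phi> (N m)" by metis
  obtain r P where r: "strict_mono (r :: nat \<Rightarrow> nat)" and P: "P \<in> borel_prob_measures X"
    and lim: "weakly_converges X (\<lambda>m. N (r m)) P"
    using borel_prob_measures_weakly_sequentially_compact[OF X, of N] N(1) S(1) by blast
  have PS: "P \<in> S" using closed[of "\<lambda>m. N (r m)" P] N(1) P lim by blast
  have "(\<lambda>m. \<Phi> (N (r m))) \<longlonglongrightarrow> \<Phi> P"
    unfolding \<Phi>_def
  proof (rule conjunct2[OF conjunct2[OF tannerys_theorem]])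
    show "(\<lambda>m. (integral\<^sup>L (N (r m)) (F i))\<^sup>2 * (1/2) ^ i) \<longlonglongrightarrow> (integral\<^sup>L P (F i))\<^sup>2 * (1/2) ^ i" for i
      using lim F(1) unfolding weakly_converges_def by (intro tendsto_intros) auto
    show "\<forall>\<^sub>F (i, m) in sequentially \<times>\<^sub>F sequentially.
        norm ((integral\<^sup>L (N (r m)) (F i))\<^sup>2 * (1/2) ^ i) \<le> (1/2) ^ i"
      using term_le[OF N(1)] by (intro always_eventually) auto
  qed (use geo in auto)
  moreover have "(\<lambda>m. s - 1 / real (Suc (r m))) \<longlonglongrightarrow> s - 0"
    using LIMSEQ_subseq_LIMSEQ[OF lim_1_over_n[THEN LIMSEQ_Suc] r]
    by (intro tendsto_intros) (simp add: comp_def)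
  ultimately have "s - 0 \<le> \<Phi> P"
    using N(2) by (intro LIMSEQ_le[of _ "s - 0" _ "\<Phi> P"]) (auto intro: less_imp_le)
  then have max: "\<Phi> Q \<le> \<Phi> P" if "Q \<in> S" for Q using s[OF that] by simp
  have "P \<in> extreme_measures S"
    unfolding extreme_measures_def
  proof (intro CollectI conjI PS ballI allI impI)
    fix Q R t assume Q: "Q \<in> S" and R: "R \<in> S" and t: "0 < t \<and> t < 1 \<and> is_convex_combination t Q R P"
    have QR: "Q \<in> borel_prob_measures X" "R \<in> borel_prob_measures X" using Q R S(1) by auto
    define q where "q i = integral\<^sup>L Q (F i)" for i
    define u where "u i = integral\<^sup>L R (F i)" for i
    have comb: "integral\<^sup>L P (F i) = (1 - t) * q i + t * u i" for i
      unfolding q_def u_def using t F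
      by (intro integral_convex_combination[OF P QR]) (auto intro: continuous_map_borel_measurable)
    let ?d = "\<lambda>i. (q i - u i)\<^sup>2 * (1/2) ^ i"
    \<comment> \<open>strict convexity of the square, in quantitative form\<close>
    have eq: "(1 - t) * t * ?d i = (1 - t) * ((q i)\<^sup>2 * (1/2) ^ i) + t * ((u i)\<^sup>2 * (1/2) ^ i)
        - (integral\<^sup>L P (F i))\<^sup>2 * (1/2) ^ i" for i
      unfolding comb by (simp add: power2_eq_square algebra_simps)
    have Qs: "summable (\<lambda>i. (q i)\<^sup>2 * (1/2) ^ i)" and Rs: "summable (\<lambda>i. (u i)\<^sup>2 * (1/2) ^ i)"
      using summ[OF Q] summ[OF R] by (simp_all add: q_def u_def)
    have "(\<lambda>i. (1 - t) * t * ?d i) sums ((1 - t) * \<Phi> Q + t * \<Phi> R - \<Phi> P)"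
      unfolding eq \<Phi>_def q_def[symmetric] u_def[symmetric]
      by (intro sums_diff sums_add sums_mult summable_sums Qs Rs summ PS)
    moreover have "(1 - t) * \<Phi> Q + t * \<Phi> R - \<Phi> P \<le> 0"
    proof -
      have "(1 - t) * \<Phi> Q \<le> (1 - t) * \<Phi> P" "t * \<Phi> R \<le> t * \<Phi> P"
        using t max[OF Q] max[OF R] by (auto intro!: mult_left_mono)
      then show ?thesis by (simp add: algebra_simps)
    qed
    moreover have nonneg: "0 \<le> (1 - t) * t * ?d i" for i using t by simp
    ultimately have "(1 - t) * t * ?d i = 0" for i
      using sums_le[of "\<lambda>j. if j = i then (1 - t) * t * ?d i else 0" _ _ _] sums_single[of i "\<lambda>j. (1 - t) * t * ?d i"]
      by (smt (verit) sums_le)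
    then have "q i = u i" for i using t by simp
    then show "Q = R" using QR by (intro F(3)) (auto simp: q_def u_def)
  qed
  then show ?thesis by blast
qed

section \<open>The stochastic equation\<close>

locale group_system =
  fixes G :: "nat \<Rightarrow> ('a, 'b) monoid_scheme"
    and T :: "nat \<Rightarrow> 'a topology"
    and \<phi> :: "nat \<Rightarrow> 'a \<Rightarrow> 'a"
    and \<mu> :: "nat \<Rightarrow> 'a measure"
  assumes topological_group: "\<And>k. is_topological_group (G k) (T k)"
    and compact_T: "\<And>k. compact_space (T k)"
    and Hausdorff_T: "\<And>k. Hausdorff_space (T k)"
    and second_countable_T: "\<And>k. second_countable (T k)"
    and hom_phi: "\<And>k. \<phi> k \<in> hom (G (Suc k)) (G k)"
    and continuous_phi: "\<And>k. continuous_map (T (Suc k)) (T k) (\<phi> k)"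
    and prob_mu: "\<And>k. \<mu> k \<in> borel_prob_measures (T k)"
begin

abbreviation X :: "(nat \<Rightarrow> 'a) topology" where "X \<equiv> seq_topology T"
definition \<Omega> :: "(nat \<Rightarrow> 'a) set" where "\<Omega> = {x. \<forall>k. x k \<in> carrier (G k)}"
abbreviation H :: "(nat \<Rightarrow> 'a) set" where "H \<equiv> inverse_limit_group G \<phi>"

lemma compactum_T: "compactum (T k)"
  using compact_T Hausdorff_T second_countable_T by (simp add: compactum_def)

lemma compactum_X: "compactum X"
  by (rule compactum_seq_topology[OF compactum_T])

lemma group_G: "group (G k)"
  using topological_group unfolding is_topological_group_def by blast

lemma monoid_G: "monoid (G k)"
  using group_G group.is_monoid by blast

lemma topspace_T: "topspace (T k) = carrier (G k)"
  using topological_group unfolding is_topological_group_def by blast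

lemma in_Omega: "x \<in> \<Omega> \<longleftrightarrow> (\<forall>k. x k \<in> carrier (G k))"
  by (simp add: \<Omega>_def)

lemma topspace_X: "topspace X = \<Omega>"
  by (auto simp: PiE_iff topspace_T \<Omega>_def)

declare topspace_product_topology [simp del] topspace_X [simp]

lemma phi_closed: "x \<in> carrier (G (Suc k)) \<Longrightarrow> \<phi> k x \<in> carrier (G k)"
  using hom_phi by (auto simp: hom_def)

lemma phi_mult: "x \<in> carrier (G (Suc k)) \<Longrightarrow> y \<in> carrier (G (Suc k)) \<Longrightarrow>
    \<phi> k (x \<otimes>\<^bsub>G (Suc k)\<^esub> y) = \<phi> k x \<otimes>\<^bsub>G k\<^esub> \<phi> k y"
  using hom_phi by (auto simp: hom_def)

lemma phi_inv: "x \<in> carrier (G (Suc k)) \<Longrightarrow> \<phi> k (inv\<^bsub>G (Suc k)\<^esub> x) = inv\<^bsub>G k\<^esub> \<phi> k x"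
  using group_hom.hom_inv[of "G (Suc k)" "G k" "\<phi> k" x] hom_phi group_G
  by (simp add: group_hom_def group_hom_axioms_def)

lemma mult_closed: "x \<in> carrier (G k) \<Longrightarrow> y \<in> carrier (G k) \<Longrightarrow> x \<otimes>\<^bsub>G k\<^esub> y \<in> carrier (G k)"
  using monoid_G monoid.m_closed by metis

lemma inv_closed: "x \<in> carrier (G k) \<Longrightarrow> inv\<^bsub>G k\<^esub> x \<in> carrier (G k)"
  using group_G group.inv_closed by metis

lemma one_closed: "\<one>\<^bsub>G k\<^esub> \<in> carrier (G k)"
  using monoid_G monoid.one_closed by metis

lemma continuous_mult:
  assumes "continuous_map Z (T k) f" "continuous_map Z (T k) g"
  shows "continuous_map Z (T k) (\<lambda>z. f z \<otimes>\<^bsub>G k\<^esub> g z)"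
proof -
  have "continuous_map (prod_topology (T k) (T k)) (T k) (\<lambda>(x, y). x \<otimes>\<^bsub>G k\<^esub> y)"
    using topological_group unfolding is_topological_group_def by blast
  moreover have "continuous_map Z (prod_topology (T k) (T k)) (\<lambda>z. (f z, g z))"
    using assms by (simp add: continuous_map_pairwise comp_def)
  ultimately have "continuous_map Z (T k) ((\<lambda>(x, y). x \<otimes>\<^bsub>G k\<^esub> y) \<circ> (\<lambda>z. (f z, g z)))"
    by (rule continuous_map_compose[rotated])
  then show ?thesis by (simp add: comp_def)
qed

lemma continuous_inv:
  assumes "continuous_map Z (T k) f"
  shows "continuous_map Z (T k) (\<lambda>z. inv\<^bsub>G k\<^esub> f z)"
proof -
  have "continuous_map (T k) (T k) (\<lambda>x. inv\<^bsub>G k\<^esub> x)"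
    using topological_group unfolding is_topological_group_def by blast
  from continuous_map_compose[OF assms this] show ?thesis by (simp add: comp_def)
qed

lemma continuous_phi_comp:
  assumes "continuous_map Z (T (Suc k)) f"
  shows "continuous_map Z (T k) (\<lambda>z. \<phi> k (f z))"
  using continuous_map_compose[OF assms continuous_phi] by (simp add: comp_def)

lemma continuous_coord: "continuous_map X (T k) (\<lambda>x. x k)"
  by (rule continuous_map_product_projection) simp

lemma continuous_coord_comp: "continuous_map Z X f \<Longrightarrow> continuous_map Z (T k) (\<lambda>z. f z k)"
  by (simp add: continuous_map_componentwise_UNIV)

lemma sets_X: "sets (borel_of X) = sets (PiM UNIV (\<lambda>k. borel_of (T k)))"
  using sets_borel_of_seq_topology[OF second_countable_T] by simp

text \<open>
  Replacing the \<open>k\<close>-th coordinate by \<open>\<phi>\<^sub>k(x\<^sub>k\<^sub>+\<^sub>1) z\<close> with a fresh sample \<open>z\<close> of \<open>\<mu>\<^sub>k\<close> is the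
  transition that the equation describes at level \<open>k\<close>.
\<close>

definition update :: "nat \<Rightarrow> (nat \<Rightarrow> 'a) \<Rightarrow> 'a \<Rightarrow> nat \<Rightarrow> 'a" where
  "update k x z = x(k := \<phi> k (x (Suc k)) \<otimes>\<^bsub>G k\<^esub> z)"

definition step :: "nat \<Rightarrow> ((nat \<Rightarrow> 'a) \<Rightarrow> real) \<Rightarrow> (nat \<Rightarrow> 'a) \<Rightarrow> real" where
  "step k F x = (\<integral>z. F (update k x z) \<partial>\<mu> k)"

text \<open>
  Overwriting the coordinates below \<open>k\<close> by units makes the joint law of the coordinates from \<open>k\<close> on a
  measure on the whole product, so that all levels live on the same space.
\<close>

definition drop_below :: "nat \<Rightarrow> (nat \<Rightarrow> 'a) \<Rightarrow> nat \<Rightarrow> 'a" where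
  "drop_below k x = (\<lambda>j. if j < k then \<one>\<^bsub>G j\<^esub> else x j)"

definition depends_from :: "nat \<Rightarrow> ((nat \<Rightarrow> 'a) \<Rightarrow> real) \<Rightarrow> bool" where
  "depends_from k F \<longleftrightarrow> (\<forall>x\<in>\<Omega>. \<forall>y\<in>\<Omega>. (\<forall>j\<ge>k. x j = y j) \<longrightarrow> F x = F y)"

definition bounded_Borel :: "((nat \<Rightarrow> 'a) \<Rightarrow> real) \<Rightarrow> bool" where
  "bounded_Borel F \<longleftrightarrow> F \<in> borel_measurable (borel_of X) \<and> (\<exists>B. \<forall>x\<in>\<Omega>. \<bar>F x\<bar> \<le> B)"

text \<open>
  The equation at level \<open>k\<close>: the joint law of \<open>(x\<^sub>k, x\<^sub>k\<^sub>+\<^sub>1, \<dots>)\<close> is not changed by the transition at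
  level \<open>k\<close>. In contrast to a conditional expectation, an equality of two measures can be tested on
  continuous functions and therefore passes to weak limits.
\<close>

definition solves :: "nat \<Rightarrow> (nat \<Rightarrow> 'a) measure \<Rightarrow> bool" where
  "solves k P \<longleftrightarrow> distr P (borel_of X) (drop_below k) =
     distr (P \<Otimes>\<^sub>M \<mu> k) (borel_of X) (\<lambda>(x, z). drop_below k (update k x z))"

lemma update_in_Omega: "x \<in> \<Omega> \<Longrightarrow> z \<in> carrier (G k) \<Longrightarrow> update k x z \<in> \<Omega>"
  by (simp add: in_Omega update_def mult_closed phi_closed)

lemma continuous_update: "continuous_map (prod_topology X (T k)) X (\<lambda>(x, z). update k x z)"
  unfolding continuous_map_componentwise_UNIV
proof
  fix j
  have fst: "continuous_map (prod_topology X (T k)) X fst" and snd: "continuous_map (prod_topology X (T k)) (T k) snd"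
    by (simp_all add: continuous_map_fst continuous_map_snd)
  have *: "continuous_map (prod_topology X (T k)) (T k) (\<lambda>p. \<phi> k (fst p (Suc k)) \<otimes>\<^bsub>G k\<^esub> snd p)"
    by (rule continuous_mult[OF continuous_phi_comp[OF continuous_coord_comp[OF fst]] snd])
  show "continuous_map (prod_topology X (T k)) (T j) (\<lambda>p. (case p of (x, z) \<Rightarrow> update k x z) j)"
  proof (cases "j = k")
    case True
    then show ?thesis using * by (simp add: update_def case_prod_unfold)
  next
    case False
    then show ?thesis using continuous_coord_comp[OF fst, of j] by (simp add: update_def case_prod_unfold)
  qed
qed

lemma continuous_drop_below: "continuous_map X X (drop_below k)"
  unfolding continuous_map_componentwise_UNIV drop_below_def
  by (auto simp: topspace_T one_closed intro: continuous_coord)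

lemma drop_below_in_Omega: "x \<in> \<Omega> \<Longrightarrow> drop_below k x \<in> \<Omega>"
  by (simp add: in_Omega drop_below_def one_closed)

lemma depends_fromD:
  "depends_from k F \<Longrightarrow> x \<in> \<Omega> \<Longrightarrow> y \<in> \<Omega> \<Longrightarrow> (\<And>j. k \<le> j \<Longrightarrow> x j = y j) \<Longrightarrow> F x = F y"
  unfolding depends_from_def by blast

lemma depends_from_drop_below:
  assumes "depends_from k F" "x \<in> \<Omega>" shows "F (drop_below k x) = F x"
  by (rule depends_fromD[OF assms(1) drop_below_in_Omega[OF assms(2)] assms(2)]) (simp add: drop_below_def)

lemma depends_from_comp_drop_below: "depends_from k (\<lambda>x. F (drop_below k x))"
proof -
  have "drop_below k x = drop_below k y" if "\<forall>j\<ge>k. x j = y j" for x y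
    using that by (auto simp: drop_below_def)
  then show ?thesis unfolding depends_from_def by (metis (no_types))
qed

lemma depends_from_mono: "depends_from k F \<Longrightarrow> j \<le> k \<Longrightarrow> depends_from j F"
  unfolding depends_from_def by (meson order_trans)

text \<open>
  The transition at level \<open>k\<close> integrates the \<open>k\<close>-th coordinate out.
\<close>

lemma depends_from_step:
  assumes "depends_from k F" shows "depends_from (Suc k) (step k F)"
  unfolding depends_from_def
proof (intro ballI impI)
  fix x y assume xy: "x \<in> \<Omega>" "y \<in> \<Omega>" "\<forall>j\<ge>Suc k. x j = y j"
  have "F (update k x z) = F (update k y z)" if "z \<in> space (\<mu> k)" for z
  proof -
    have "z \<in> carrier (G k)" using that by (simp add: space_borel_prob[OF prob_mu] topspace_T)
    moreover have "update k x z j = update k y z j" if "k \<le> j" for j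
      using xy(3) that by (simp add: update_def)
    ultimately show ?thesis
      by (intro depends_fromD[OF assms] update_in_Omega xy(1,2))
  qed
  then show "step k F x = step k F y"
    unfolding step_def by (intro Bochner_Integration.integral_cong) auto
qed

lemma step_eq:
  assumes F: "depends_from (Suc k) F" and x: "x \<in> \<Omega>"
  shows "step k F x = F x"
proof -
  interpret prob_space "\<mu> k" by (rule prob_space_borel_prob[OF prob_mu])
  have "F (update k x z) = F x" if "z \<in> space (\<mu> k)" for z
  proof -
    have "z \<in> carrier (G k)" using that by (simp add: space_borel_prob[OF prob_mu] topspace_T)
    then have "update k x z \<in> \<Omega>" using x by (rule update_in_Omega[rotated])
    then show ?thesis
      by (rule depends_fromD[OF F _ x]) (simp add: update_def)
  qed
  then have "step k F x = (\<integral>z. F x \<partial>\<mu> k)"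
    unfolding step_def by (intro Bochner_Integration.integral_cong) auto
  then show ?thesis by (simp add: prob_space)
qed

lemma step_cong:
  assumes "\<And>y. y \<in> \<Omega> \<Longrightarrow> F y = F' y" "x \<in> \<Omega>"
  shows "step k F x = step k F' x"
  unfolding step_def using assms update_in_Omega
  by (intro Bochner_Integration.integral_cong) (auto simp: space_borel_prob[OF prob_mu] topspace_T)

lemma measurable_pair_X:
  assumes "P \<in> borel_prob_measures X"
  shows "measurable (P \<Otimes>\<^sub>M \<mu> k) N = measurable (borel_of (prod_topology X (T k))) N"
proof (rule measurable_cong_sets)
  have "sets (P \<Otimes>\<^sub>M \<mu> k) = sets (borel_of X \<Otimes>\<^sub>M borel_of (T k))"
    by (intro sets_pair_measure_cong sets_borel_prob assms prob_mu)
  also have "\<dots> = sets (borel_of (prod_topology X (T k)))"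
    using compactum_X second_countable_T by (intro sets_borel_of_prod_topology) (auto simp: compactum_def)
  finally show "sets (P \<Otimes>\<^sub>M \<mu> k) = sets (borel_of (prod_topology X (T k)))" .
qed simp

lemma measurable_update:
  "P \<in> borel_prob_measures X \<Longrightarrow> (\<lambda>(x, z). update k x z) \<in> P \<Otimes>\<^sub>M \<mu> k \<rightarrow>\<^sub>M borel_of X"
  by (simp add: measurable_pair_X continuous_map_measurable_borel_of continuous_update)

lemma measurable_drop_below: "drop_below k \<in> borel_of X \<rightarrow>\<^sub>M borel_of X"
  by (rule continuous_map_measurable_borel_of[OF continuous_drop_below])

lemma bounded_Borel_drop_below: "bounded_Borel F \<Longrightarrow> bounded_Borel (\<lambda>x. F (drop_below k x))"
  unfolding bounded_Borel_def
  using measurable_compose[OF measurable_drop_below] drop_below_in_Omega by blast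

lemma bounded_Borel_integrable:
  assumes P: "P \<in> borel_prob_measures X" and F: "bounded_Borel F"
  shows "integrable P F"
proof -
  obtain B where "\<forall>x\<in>\<Omega>. \<bar>F x\<bar> \<le> B" using F by (auto simp: bounded_Borel_def)
  then show ?thesis
    using F by (intro prob_space.integrable_bounded[OF prob_space_borel_prob[OF P], of _ B])
       (auto simp: bounded_Borel_def measurable_borel_prob[OF P] space_borel_prob[OF P])
qed

lemma bounded_Borel_continuous: "continuous_map X euclideanreal F \<Longrightarrow> bounded_Borel F"
  using compact_continuous_bounded[of X F] compactum_X
  by (auto simp: bounded_Borel_def compactum_def continuous_map_borel_measurable)

lemma point_mass: "x \<in> \<Omega> \<Longrightarrow> return (borel_of X) x \<in> borel_prob_measures X"
  by (simp add: borel_prob_measures_def prob_space_return)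

lemma bounded_Borel_step:
  assumes F: "bounded_Borel F" shows "bounded_Borel (step k F)"
proof -
  interpret mu: prob_space "\<mu> k" by (rule prob_space_borel_prob[OF prob_mu])
  obtain B where B: "\<forall>x\<in>\<Omega>. \<bar>F x\<bar> \<le> B" using F by (auto simp: bounded_Borel_def)
  have "(\<lambda>k. \<one>\<^bsub>G k\<^esub>) \<in> \<Omega>" by (simp add: in_Omega one_closed)
  from point_mass[OF this] obtain P where P: "P \<in> borel_prob_measures X" by blast
  have FX: "F \<in> borel_measurable (borel_of X)" using F by (simp add: bounded_Borel_def)
  have m: "(\<lambda>(x, z). F (update k x z)) \<in> borel_measurable (P \<Otimes>\<^sub>M \<mu> k)"
    using measurable_compose[OF measurable_update[OF P] FX] by (simp add: case_prod_unfold)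
  then have "step k F \<in> borel_measurable P"
    unfolding step_def[abs_def] by (rule mu.borel_measurable_lebesgue_integral)
  moreover have "\<bar>step k F x\<bar> \<le> B" if x: "x \<in> \<Omega>" for x
    unfolding step_def
  proof (rule mu.abs_integral_le)
    show "(\<lambda>z. F (update k x z)) \<in> borel_measurable (\<mu> k)"
      using measurable_Pair2[OF m] x by (simp add: space_borel_prob[OF P])
    show "\<bar>F (update k x z)\<bar> \<le> B" if "z \<in> space (\<mu> k)" for z
      using B update_in_Omega[OF x] that by (simp add: space_borel_prob[OF prob_mu] topspace_T)
  qed
  ultimately show ?thesis by (auto simp: bounded_Borel_def measurable_borel_prob[OF P])
qed

lemma continuous_step:
  assumes "continuous_map X euclideanreal F" shows "continuous_map X euclideanreal (step k F)"
  unfolding step_def[abs_def]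
proof (rule continuous_map_integral_parameter[OF compact_T prob_mu])
  show "continuous_map (prod_topology X (T k)) euclideanreal (\<lambda>(x, z). F (update k x z))"
    using continuous_map_compose[OF continuous_update assms] by (simp add: comp_def case_prod_unfold)
qed

lemma integral_update:
  assumes P: "P \<in> borel_prob_measures X" and F: "bounded_Borel F"
  shows "(\<integral>p. F (update k (fst p) (snd p)) \<partial>(P \<Otimes>\<^sub>M \<mu> k)) = integral\<^sup>L P (step k F)"
proof -
  interpret Pr: prob_space P by (rule prob_space_borel_prob[OF P])
  interpret mu: prob_space "\<mu> k" by (rule prob_space_borel_prob[OF prob_mu])
  interpret pair_prob_space P "\<mu> k" ..
  obtain B where B: "\<forall>x\<in>\<Omega>. \<bar>F x\<bar> \<le> B" using F by (auto simp: bounded_Borel_def)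
  have FX: "F \<in> borel_measurable (borel_of X)" using F by (simp add: bounded_Borel_def)
  have "integrable (P \<Otimes>\<^sub>M \<mu> k) (\<lambda>p. F (update k (fst p) (snd p)))"
  proof (rule integrable_bounded)
    show "(\<lambda>p. F (update k (fst p) (snd p))) \<in> borel_measurable (P \<Otimes>\<^sub>M \<mu> k)"
      using measurable_compose[OF measurable_update[OF P] FX] by (simp add: case_prod_unfold)
    show "\<bar>F (update k (fst p) (snd p))\<bar> \<le> B" if "p \<in> space (P \<Otimes>\<^sub>M \<mu> k)" for p
      using B update_in_Omega that
      by (auto simp: space_pair_measure space_borel_prob[OF P] space_borel_prob[OF prob_mu] topspace_T mem_Times_iff)
  qed
  from integral_fst'[OF this] show ?thesis by (simp add: step_def[abs_def])
qed

lemma integral_distr_drop_below: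
  assumes P: "P \<in> borel_prob_measures X" and F: "bounded_Borel F"
  shows "integral\<^sup>L (distr P (borel_of X) (drop_below k)) F = (\<integral>x. F (drop_below k x) \<partial>P)"
  using F measurable_drop_below
  by (intro integral_distr) (auto simp: measurable_borel_prob[OF P] bounded_Borel_def)

lemma measurable_drop_below_update:
  "P \<in> borel_prob_measures X \<Longrightarrow>
     (\<lambda>(x, z). drop_below k (update k x z)) \<in> P \<Otimes>\<^sub>M \<mu> k \<rightarrow>\<^sub>M borel_of X"
  using measurable_compose[OF measurable_update measurable_drop_below]
  by (simp add: case_prod_unfold)

lemma integral_distr_drop_below_update:
  assumes P: "P \<in> borel_prob_measures X" and F: "bounded_Borel F"
  shows "integral\<^sup>L (distr (P \<Otimes>\<^sub>M \<mu> k) (borel_of X) (\<lambda>(x, z). drop_below k (update k x z))) F =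
    integral\<^sup>L P (step k (\<lambda>x. F (drop_below k x)))"
proof -
  have "integral\<^sup>L (distr (P \<Otimes>\<^sub>M \<mu> k) (borel_of X) (\<lambda>(x, z). drop_below k (update k x z))) F =
      (\<integral>p. F (case p of (x, z) \<Rightarrow> drop_below k (update k x z)) \<partial>(P \<Otimes>\<^sub>M \<mu> k))"
    using F measurable_drop_below_update[OF P] by (intro integral_distr) (auto simp: bounded_Borel_def)
  also have "\<dots> = integral\<^sup>L P (step k (\<lambda>x. F (drop_below k x)))"
    using integral_update[OF P bounded_Borel_drop_below[OF F]] by (simp add: case_prod_unfold)
  finally show ?thesis .
qed

lemma distr_in_borel_prob:
  assumes P: "prob_space P" and f: "f \<in> P \<rightarrow>\<^sub>M borel_of X"
  shows "distr P (borel_of X) f \<in> borel_prob_measures X"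
  using prob_space.prob_space_distr[OF P f] by (simp add: borel_prob_measures_def)

lemma prob_space_pair:
  assumes P: "P \<in> borel_prob_measures X" shows "prob_space (P \<Otimes>\<^sub>M \<mu> k)"
proof -
  interpret Pr: prob_space P by (rule prob_space_borel_prob[OF P])
  interpret mu: prob_space "\<mu> k" by (rule prob_space_borel_prob[OF prob_mu])
  interpret pair_prob_space P "\<mu> k" ..
  show ?thesis by (rule prob_space_axioms)
qed

lemma solvesD:
  assumes P: "P \<in> borel_prob_measures X" and sol: "solves k P"
    and F: "bounded_Borel F" "depends_from k F"
  shows "integral\<^sup>L P F = integral\<^sup>L P (step k F)"
proof -
  have "integral\<^sup>L P F = (\<integral>x. F (drop_below k x) \<partial>P)"
    using depends_from_drop_below[OF F(2)]
    by (intro Bochner_Integration.integral_cong) (auto simp: space_borel_prob[OF P])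
  also have "\<dots> = integral\<^sup>L P (step k (\<lambda>x. F (drop_below k x)))"
    unfolding integral_distr_drop_below[OF P F(1), symmetric]
      integral_distr_drop_below_update[OF P F(1), symmetric] sol[unfolded solves_def] ..
  also have "\<dots> = integral\<^sup>L P (step k F)"
    using depends_from_drop_below[OF F(2)]
    by (intro Bochner_Integration.integral_cong step_cong) (auto simp: space_borel_prob[OF P])
  finally show ?thesis .
qed

text \<open>
  Continuous test functions suffice because they determine Borel measures.
\<close>

lemma solvesI:
  assumes P: "P \<in> borel_prob_measures X"
    and eq: "\<And>F. continuous_map X euclideanreal F \<Longrightarrow> depends_from k F \<Longrightarrow>
      integral\<^sup>L P F = integral\<^sup>L P (step k F)"
  shows "solves k P"
  unfolding solves_def
proof (rule borel_prob_eqI[OF compactum_X])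
  show "distr P (borel_of X) (drop_below k) \<in> borel_prob_measures X"
    using measurable_drop_below
    by (intro distr_in_borel_prob prob_space_borel_prob[OF P]) (simp add: measurable_borel_prob[OF P])
  show "distr (P \<Otimes>\<^sub>M \<mu> k) (borel_of X) (\<lambda>(x, z). drop_below k (update k x z)) \<in> borel_prob_measures X"
    by (intro distr_in_borel_prob prob_space_pair measurable_drop_below_update P)
  fix F assume F: "continuous_map X euclideanreal F"
  have "continuous_map X euclideanreal (\<lambda>x. F (drop_below k x))"
    using continuous_map_compose[OF continuous_drop_below F] by (simp add: comp_def)
  from eq[OF this depends_from_comp_drop_below]
  show "integral\<^sup>L (distr P (borel_of X) (drop_below k)) F =
      integral\<^sup>L (distr (P \<Otimes>\<^sub>M \<mu> k) (borel_of X) (\<lambda>(x, z). drop_below k (update k x z))) F"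
    unfolding integral_distr_drop_below[OF P bounded_Borel_continuous[OF F]]
      integral_distr_drop_below_update[OF P bounded_Borel_continuous[OF F]] .
qed

lemma space_tail_algebra [simp]: "space (tail_algebra T k) = \<Omega>"
  by (simp add: tail_algebra_def)

lemma restrict_tail: "(\<lambda>x. restrict x {k<..}) \<in> topspace X \<rightarrow> space (PiM {k<..} (\<lambda>j. borel_of (T j)))"
  unfolding topspace_X by (simp add: space_PiM restrict_PiE_iff in_Omega topspace_T)

lemma measurable_tail_coord:
  assumes "k < j" shows "(\<lambda>x. x j) \<in> tail_algebra T k \<rightarrow>\<^sub>M borel_of (T j)"
proof -
  have "(\<lambda>x. restrict x {k<..}) \<in> tail_algebra T k \<rightarrow>\<^sub>M PiM {k<..} (\<lambda>j. borel_of (T j))"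
    unfolding tail_algebra_def by (rule measurable_vimage_algebra1[OF restrict_tail])
  from measurable_compose[OF this measurable_component_singleton[of j]] assms
  show ?thesis by simp
qed

lemma measurable_coord: "(\<lambda>x. x j) \<in> borel_of X \<rightarrow>\<^sub>M borel_of (T j)"
  by (rule continuous_map_measurable_borel_of[OF continuous_coord])

lemma in_tail_algebra:
  assumes "B \<in> sets (tail_algebra T k)"
  shows "B \<in> sets (borel_of X)" "B \<subseteq> \<Omega>"
    and "\<And>x y. x \<in> \<Omega> \<Longrightarrow> y \<in> \<Omega> \<Longrightarrow> \<forall>j>k. x j = y j \<Longrightarrow> x \<in> B \<longleftrightarrow> y \<in> B"
proof -
  have "\<exists>A. B = (\<lambda>x. restrict x {k<..}) -` A \<inter> topspace X \<and> A \<in> sets (PiM {k<..} (\<lambda>j. borel_of (T j)))"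
    using assms unfolding tail_algebra_def sets_vimage_algebra2[OF restrict_tail] by (rule CollectD)
  then obtain A where A: "A \<in> sets (PiM {k<..} (\<lambda>j. borel_of (T j)))" "B = (\<lambda>x. restrict x {k<..}) -` A \<inter> \<Omega>"
    unfolding topspace_X by (elim exE conjE)
  have "(\<lambda>x. restrict x {k<..}) \<in> borel_of X \<rightarrow>\<^sub>M PiM {k<..} (\<lambda>j. borel_of (T j))"
    by (intro measurable_restrict measurable_coord)
  from measurable_sets[OF this A(1)] show "B \<in> sets (borel_of X)" using A(2) by simp
  show "B \<subseteq> \<Omega>" using A(2) by blast
  fix x y assume xy: "x \<in> \<Omega>" "y \<in> \<Omega>" "\<forall>j>k. x j = y j"
  have "restrict x {k<..} = restrict y {k<..}" using xy(3) by (auto simp: restrict_def)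
  then show "x \<in> B \<longleftrightarrow> y \<in> B" using A(2) xy(1,2) by auto
qed

lemma subalgebra_tail:
  assumes "P \<in> borel_prob_measures X" shows "subalgebra P (tail_algebra T k)"
  using in_tail_algebra(1) by (auto simp: subalgebra_def space_borel_prob[OF assms] sets_borel_prob[OF assms])

lemma finite_measure_subalgebra_tail:
  assumes "P \<in> borel_prob_measures X" shows "finite_measure_subalgebra P (tail_algebra T k)"
  using subalgebra_tail[OF assms] prob_space.finite_measure[OF prob_space_borel_prob[OF assms]]
  by (simp add: finite_measure_subalgebra_def finite_measure_subalgebra_axioms_def)

lemma step_coord_indicator:
  assumes B: "B \<in> sets (tail_algebra T k)" and x: "x \<in> \<Omega>"
  shows "step k (\<lambda>x. indicator B x * f (x k)) x =
    indicator B x * (\<integral>z. f (\<phi> k (x (Suc k)) \<otimes>\<^bsub>G k\<^esub> z) \<partial>\<mu> k)"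
proof -
  have "step k (\<lambda>x. indicator B x * f (x k)) x =
      (\<integral>z. indicator B x * f (\<phi> k (x (Suc k)) \<otimes>\<^bsub>G k\<^esub> z) \<partial>\<mu> k)"
    unfolding step_def
  proof (rule Bochner_Integration.integral_cong[OF refl])
    fix z assume "z \<in> space (\<mu> k)"
    then have "z \<in> carrier (G k)" by (simp add: space_borel_prob[OF prob_mu] topspace_T)
    then have "update k x z \<in> B \<longleftrightarrow> x \<in> B"
      using update_in_Omega[OF x] x by (intro in_tail_algebra(3)[OF B]) (auto simp: update_def)
    then show "indicator B (update k x z) * f (update k x z k) =
        indicator B x * f (\<phi> k (x (Suc k)) \<otimes>\<^bsub>G k\<^esub> z)"
      by (simp add: indicator_def update_def)
  qed
  then show ?thesis by simp
qed

lemma bounded_Borel_coord_indicator: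
  assumes B: "B \<in> sets (tail_algebra T k)"
    and f: "f \<in> borel_measurable (borel_of (T k))" "\<And>y. y \<in> carrier (G k) \<Longrightarrow> \<bar>f y\<bar> \<le> (C::real)"
  shows "bounded_Borel (\<lambda>x. indicator B x * f (x k))" "depends_from k (\<lambda>x. indicator B x * f (x k))"
proof -
  have "(\<lambda>x. f (x k)) \<in> borel_measurable (borel_of X)"
    by (rule measurable_compose[OF measurable_coord f(1)])
  then have "(\<lambda>x. indicator B x * f (x k)) \<in> borel_measurable (borel_of X)"
    using in_tail_algebra(1)[OF B] by (intro borel_measurable_times borel_measurable_indicator)
  moreover have "\<bar>indicator B x * f (x k)\<bar> \<le> C" if "x \<in> \<Omega>" for x
    using f(2)[of "x k"] that order_trans[OF abs_ge_zero f(2)[of "x k"]] unfolding in_Omega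
    by (simp add: indicator_def)
  ultimately show "bounded_Borel (\<lambda>x. indicator B x * f (x k))" by (auto simp: bounded_Borel_def)
  show "depends_from k (\<lambda>x. indicator B x * f (x k))"
    unfolding depends_from_def
  proof (intro ballI impI)
    fix x y assume xy: "x \<in> \<Omega>" "y \<in> \<Omega>" "\<forall>j\<ge>k. x j = y j"
    then have "x \<in> B \<longleftrightarrow> y \<in> B" by (intro in_tail_algebra(3)[OF B]) auto
    then show "indicator B x * f (x k) = indicator B y * f (y k)" using xy(3) by (simp add: indicator_def)
  qed
qed

lemma transition_tail_measurable:
  assumes f: "f \<in> borel_measurable (borel_of (T k))" "\<And>y. y \<in> carrier (G k) \<Longrightarrow> \<bar>f y\<bar> \<le> (C::real)"
  defines "g \<equiv> \<lambda>x. \<integral>z. f (\<phi> k (x (Suc k)) \<otimes>\<^bsub>G k\<^esub> z) \<partial>\<mu> k"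
  shows "g \<in> borel_measurable (tail_algebra T k)" "\<And>x. x \<in> \<Omega> \<Longrightarrow> \<bar>g x\<bar> \<le> C"
proof -
  interpret mu: prob_space "\<mu> k" by (rule prob_space_borel_prob[OF prob_mu])
  have sets: "sets (borel_of (T (Suc k)) \<Otimes>\<^sub>M \<mu> k) = sets (borel_of (prod_topology (T (Suc k)) (T k)))"
    using sets_borel_of_prod_topology[OF second_countable_T second_countable_T]
      sets_pair_measure_cong[OF refl sets_borel_prob[OF prob_mu]] by metis
  have "continuous_map (prod_topology (T (Suc k)) (T k)) (T k) (\<lambda>p. \<phi> k (fst p) \<otimes>\<^bsub>G k\<^esub> snd p)"
    by (intro continuous_mult continuous_phi_comp continuous_map_fst continuous_map_snd)
  from measurable_compose[OF continuous_map_measurable_borel_of[OF this] f(1)]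
  have m: "(\<lambda>(y, z). f (\<phi> k y \<otimes>\<^bsub>G k\<^esub> z)) \<in> borel_measurable (borel_of (T (Suc k)) \<Otimes>\<^sub>M \<mu> k)"
    by (simp add: measurable_cong_sets[OF sets refl] case_prod_unfold)
  then have "(\<lambda>y. \<integral>z. f (\<phi> k y \<otimes>\<^bsub>G k\<^esub> z) \<partial>\<mu> k) \<in> borel_measurable (borel_of (T (Suc k)))"
    by (rule mu.borel_measurable_lebesgue_integral)
  from measurable_compose[OF measurable_tail_coord[of k "Suc k"] this]
  show "g \<in> borel_measurable (tail_algebra T k)" by (simp add: g_def)
  fix x assume x: "x \<in> \<Omega>"
  then have xk: "x (Suc k) \<in> carrier (G (Suc k))" by (simp only: in_Omega)
  show "\<bar>g x\<bar> \<le> C"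
    unfolding g_def
  proof (rule mu.abs_integral_le)
    show "(\<lambda>z. f (\<phi> k (x (Suc k)) \<otimes>\<^bsub>G k\<^esub> z)) \<in> borel_measurable (\<mu> k)"
      using measurable_Pair2[OF m, of "x (Suc k)"] xk by (simp add: topspace_T)
    show "\<bar>f (\<phi> k (x (Suc k)) \<otimes>\<^bsub>G k\<^esub> z)\<bar> \<le> C" if "z \<in> space (\<mu> k)" for z
      using that xk by (intro f(2) mult_closed phi_closed) (simp_all add: space_borel_prob[OF prob_mu] topspace_T)
  qed
qed

text \<open>
  The defining property of a conditional expectation on a tail event \<open>B\<close> is the equation tested on
  \<open>x \<mapsto> 1\<^sub>B(x) f(x\<^sub>k)\<close>.
\<close>

lemma solution_if_solves:
  assumes P: "P \<in> borel_prob_measures X" and sol: "\<And>k. solves k P"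
  shows "P \<in> solutions G T \<phi> \<mu>"
  unfolding solutions_def
proof (intro CollectI conjI P allI ballI impI)
  fix k and f :: "'a \<Rightarrow> real"
  assume f: "f \<in> borel_measurable (borel_of (T k))" and "\<exists>C. \<forall>y\<in>carrier (G k). \<bar>f y\<bar> \<le> C"
  then obtain C where C: "\<And>y. y \<in> carrier (G k) \<Longrightarrow> \<bar>f y\<bar> \<le> C" by blast
  let ?g = "\<lambda>x. \<integral>z. f (\<phi> k (x (Suc k)) \<otimes>\<^bsub>G k\<^esub> z) \<partial>\<mu> k"
  interpret finite_measure_subalgebra P "tail_algebra T k" by (rule finite_measure_subalgebra_tail[OF P])
  note g = transition_tail_measurable[OF f C]
  have gP: "?g \<in> borel_measurable P" by (rule measurable_from_subalg[OF subalg g(1)])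
  have fP: "(\<lambda>x. f (x k)) \<in> borel_measurable P"
    using measurable_compose[OF measurable_coord f] by (simp add: measurable_borel_prob[OF P])
  show "AE x in P. real_cond_exp P (tail_algebra T k) (\<lambda>x. f (x k)) x = ?g x"
  proof (rule real_cond_exp_charact)
    show "integrable P ?g"
      using g(2) gP by (intro prob_space.integrable_bounded[OF prob_space_borel_prob[OF P], of _ C])
        (auto simp: space_borel_prob[OF P])
    show "integrable P (\<lambda>x. f (x k))"
      using C fP by (intro prob_space.integrable_bounded[OF prob_space_borel_prob[OF P], of _ C])
        (auto simp: space_borel_prob[OF P] in_Omega)
    show "?g \<in> borel_measurable (tail_algebra T k)" by (rule g(1))
    fix B assume B: "B \<in> sets (tail_algebra T k)"
    have "(\<integral>x. indicator B x * f (x k) \<partial>P) = integral\<^sup>L P (step k (\<lambda>x. indicator B x * f (x k)))"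
      by (rule solvesD[OF P sol bounded_Borel_coord_indicator[OF B f C]])
    also have "\<dots> = (\<integral>x. indicator B x * ?g x \<partial>P)"
      by (intro Bochner_Integration.integral_cong refl step_coord_indicator[OF B])
         (simp add: space_borel_prob[OF P])
    finally show "(\<integral>x\<in>B. f (x k) \<partial>P) = (\<integral>x\<in>B. ?g x \<partial>P)"
      by (simp add: set_lebesgue_integral_def)
  qed
qed

text \<open>
  Finite-dimensional cylinders determine a measure on the product. Restricted to sequences that are
  trivial below \<open>k\<close>, the indicator of a cylinder is a product \<open>1\<^sub>B(x) f(x\<^sub>k)\<close> with a tail event \<open>B\<close>, to
  which the conditional expectation applies.
\<close>

lemma solves_if_solution:
  assumes sol: "P \<in> solutions G T \<phi> \<mu>"
  shows "P \<in> borel_prob_measures X" "solves k P"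
proof -
  show P: "P \<in> borel_prob_measures X" using sol by (simp add: solutions_def)
  interpret finite_measure_subalgebra P "tail_algebra T k" by (rule finite_measure_subalgebra_tail[OF P])
  let ?M1 = "distr P (borel_of X) (drop_below k)"
  let ?M2 = "distr (P \<Otimes>\<^sub>M \<mu> k) (borel_of X) (\<lambda>(x, z). drop_below k (update k x z))"
  have M1: "?M1 \<in> borel_prob_measures X"
    using measurable_drop_below
    by (intro distr_in_borel_prob prob_space_borel_prob[OF P]) (simp add: measurable_borel_prob[OF P])
  have M2: "?M2 \<in> borel_prob_measures X"
    by (intro distr_in_borel_prob prob_space_pair measurable_drop_below_update P)
  interpret M1: prob_space ?M1 by (rule prob_space_borel_prob[OF M1])
  interpret M2: prob_space ?M2 by (rule prob_space_borel_prob[OF M2])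
  show "solves k P"
    unfolding solves_def
  proof (rule measure_eqI_PiM_infinite[where I = UNIV and M = "\<lambda>j. borel_of (T j)"])
    show "sets ?M1 = sets (PiM UNIV (\<lambda>j. borel_of (T j)))" "sets ?M2 = sets (PiM UNIV (\<lambda>j. borel_of (T j)))"
      by (simp_all add: sets_X)
    show "finite_measure ?M1" by (rule M1.finite_measure_axioms)
    fix A and J :: "nat set"
    assume J: "finite J" and A: "\<And>j. j \<in> J \<Longrightarrow> A j \<in> sets (borel_of (T j))"
    define C where "C = prod_emb UNIV (\<lambda>j. borel_of (T j)) J (PiE J A)"
    have "C \<in> sets (PiM UNIV (\<lambda>j. borel_of (T j)))"
      unfolding C_def using J A by (intro sets_PiM_I) auto
    then have C: "C \<in> sets (borel_of X)" by (simp add: sets_X)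
    have inC: "x \<in> C \<longleftrightarrow> (\<forall>j\<in>J. x j \<in> A j)" if "x \<in> \<Omega>" for x
      using that by (auto simp: C_def prod_emb_def PiE_iff in_Omega topspace_T)
    \<comment> \<open>the coordinates below \<open>k\<close> are units, so they contribute a constant factor\<close>
    define c :: real where "c = of_bool (\<forall>j\<in>J. j < k \<longrightarrow> \<one>\<^bsub>G j\<^esub> \<in> A j)"
    define f where "f y = c * indicator (if k \<in> J then A k else carrier (G k)) y" for y
    define B where "B = {x \<in> \<Omega>. \<forall>j\<in>J \<inter> {k<..}. x j \<in> A j}"
    have B: "B \<in> sets (tail_algebra T k)"
    proof -
      have "{x \<in> space (tail_algebra T k). x j \<in> A j} \<in> sets (tail_algebra T k)" if "j \<in> J \<inter> {k<..}" for j
      proof -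
        have "(\<lambda>x. x j) -` A j \<inter> space (tail_algebra T k) \<in> sets (tail_algebra T k)"
          using that by (intro measurable_sets[OF measurable_tail_coord A]) auto
        moreover have "(\<lambda>x. x j) -` A j \<inter> space (tail_algebra T k) = {x \<in> space (tail_algebra T k). x j \<in> A j}"
          by auto
        ultimately show ?thesis by simp
      qed
      then have "{x \<in> space (tail_algebra T k). \<forall>j\<in>J \<inter> {k<..}. x j \<in> A j} \<in> sets (tail_algebra T k)"
        using J by (intro sets.sets_Collect_finite_All) auto
      then show ?thesis by (simp only: B_def space_tail_algebra)
    qed
    have fm: "f \<in> borel_measurable (borel_of (T k))"
      unfolding f_def using A[of k] sets.top[of "borel_of (T k)"]
      by (intro borel_measurable_times borel_measurable_indicator) (auto simp: topspace_T)
    have f1: "\<bar>f y\<bar> \<le> 1" for y by (simp add: f_def c_def indicator_def)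
    have ind: "indicator C (drop_below k x) = indicator B x * f (x k)" if x: "x \<in> \<Omega>" for x
    proof -
      have xk: "x k \<in> carrier (G k)" using x by (simp only: in_Omega)
      have "drop_below k x \<in> C \<longleftrightarrow> (\<forall>j\<in>J. drop_below k x j \<in> A j)"
        by (rule inC[OF drop_below_in_Omega[OF x]])
      also have "\<dots> \<longleftrightarrow> (\<forall>j\<in>J. j < k \<longrightarrow> \<one>\<^bsub>G j\<^esub> \<in> A j) \<and> (k \<in> J \<longrightarrow> x k \<in> A k) \<and>
          (\<forall>j\<in>J \<inter> {k<..}. x j \<in> A j)"
      proof -
        have "drop_below k x j \<in> A j \<longleftrightarrow> (j < k \<longrightarrow> \<one>\<^bsub>G j\<^esub> \<in> A j) \<and> (j = k \<longrightarrow> x k \<in> A k) \<and> (k < j \<longrightarrow> x j \<in> A j)" for j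
          by (cases j k rule: linorder_cases) (simp_all add: drop_below_def)
        then show ?thesis by auto
      qed
      finally show ?thesis using x xk by (simp add: indicator_def f_def c_def B_def)
    qed
    have indC: "bounded_Borel (indicator C)"
      using C by (auto simp: bounded_Borel_def indicator_def intro!: exI[of _ 1])
    have C_Int: "C \<inter> \<Omega> = C" using sets.sets_into_space[OF C] by auto
    have "measure ?M1 C = integral\<^sup>L ?M1 (indicator C)" using C by (simp add: C_Int)
    also have "\<dots> = (\<integral>x. indicator C (drop_below k x) \<partial>P)"
      by (rule integral_distr_drop_below[OF P indC])
    also have "\<dots> = (\<integral>x\<in>B. f (x k) \<partial>P)"
      unfolding set_lebesgue_integral_def
      by (intro Bochner_Integration.integral_cong refl) (simp add: space_borel_prob[OF P] ind)
    also have "\<dots> = (\<integral>x\<in>B. real_cond_exp P (tail_algebra T k) (\<lambda>x. f (x k)) x \<partial>P)"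
    proof (rule real_cond_exp_intA[OF _ B])
      show "integrable P (\<lambda>x. f (x k))"
        using measurable_compose[OF measurable_coord fm] f1
        by (intro prob_space.integrable_bounded[OF prob_space_borel_prob[OF P], of _ 1])
           (simp_all add: measurable_borel_prob[OF P])
    qed
    also have "\<dots> = (\<integral>x\<in>B. (\<integral>z. f (\<phi> k (x (Suc k)) \<otimes>\<^bsub>G k\<^esub> z) \<partial>\<mu> k) \<partial>P)"
    proof (rule set_lebesgue_integral_cong_AE)
      show "B \<in> sets P" using in_tail_algebra(1)[OF B] by (simp add: sets_borel_prob[OF P])
      show "real_cond_exp P (tail_algebra T k) (\<lambda>x. f (x k)) \<in> borel_measurable P" by simp
      show "(\<lambda>x. \<integral>z. f (\<phi> k (x (Suc k)) \<otimes>\<^bsub>G k\<^esub> z) \<partial>\<mu> k) \<in> borel_measurable P"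
        by (rule measurable_from_subalg[OF subalg transition_tail_measurable(1)[OF fm f1]])
      have "AE x in P. real_cond_exp P (tail_algebra T k) (\<lambda>x. f (x k)) x =
          (\<integral>z. f (\<phi> k (x (Suc k)) \<otimes>\<^bsub>G k\<^esub> z) \<partial>\<mu> k)"
        using sol fm f1 unfolding solutions_def by blast
      then show "AE x\<in>B in P. real_cond_exp P (tail_algebra T k) (\<lambda>x. f (x k)) x =
          (\<integral>z. f (\<phi> k (x (Suc k)) \<otimes>\<^bsub>G k\<^esub> z) \<partial>\<mu> k)" by eventually_elim simp
    qed
    also have "\<dots> = integral\<^sup>L P (step k (\<lambda>x. indicator B x * f (x k)))"
      unfolding set_lebesgue_integral_def
      by (intro Bochner_Integration.integral_cong refl)
         (simp add: space_borel_prob[OF P] step_coord_indicator[OF B])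
    also have "\<dots> = integral\<^sup>L P (step k (\<lambda>x. indicator C (drop_below k x)))"
      by (intro Bochner_Integration.integral_cong refl step_cong) (simp_all add: space_borel_prob[OF P] ind)
    also have "\<dots> = integral\<^sup>L ?M2 (indicator C)"
      by (rule integral_distr_drop_below_update[OF P indC, symmetric])
    also have "\<dots> = measure ?M2 C" using C by (simp add: C_Int)
    finally have "measure ?M1 C = measure ?M2 C" .
    then show "emeasure ?M1 (prod_emb UNIV (\<lambda>j. borel_of (T j)) J (PiE J A)) =
        emeasure ?M2 (prod_emb UNIV (\<lambda>j. borel_of (T j)) J (PiE J A))"
      unfolding C_def[symmetric] M1.emeasure_eq_measure M2.emeasure_eq_measure by simp
  qed
qed

section \<open>Existence of extreme solutions\<close>

definition refresh :: "nat \<Rightarrow> (nat \<Rightarrow> 'a) measure \<Rightarrow> (nat \<Rightarrow> 'a) measure" where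
  "refresh k P = distr (P \<Otimes>\<^sub>M \<mu> k) (borel_of X) (\<lambda>(x, z). update k x z)"

lemma refresh_in: "P \<in> borel_prob_measures X \<Longrightarrow> refresh k P \<in> borel_prob_measures X"
  unfolding refresh_def by (intro distr_in_borel_prob prob_space_pair measurable_update)

lemma integral_refresh:
  assumes P: "P \<in> borel_prob_measures X" and F: "bounded_Borel F"
  shows "integral\<^sup>L (refresh k P) F = integral\<^sup>L P (step k F)"
proof -
  have "integral\<^sup>L (refresh k P) F = (\<integral>p. F (case p of (x, z) \<Rightarrow> update k x z) \<partial>(P \<Otimes>\<^sub>M \<mu> k))"
    unfolding refresh_def using F measurable_update[OF P]
    by (intro integral_distr) (auto simp: bounded_Borel_def)
  then show ?thesis using integral_update[OF P F] by (simp add: case_prod_unfold)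
qed

lemma integral_step_eq:
  assumes P: "P \<in> borel_prob_measures X" and F: "depends_from (Suc k) F"
  shows "integral\<^sup>L P (step k F) = integral\<^sup>L P F"
  by (intro Bochner_Integration.integral_cong refl step_eq[OF F]) (simp add: space_borel_prob[OF P])

text \<open>
  Refreshing coordinate \<open>k\<close> leaves the coordinates beyond \<open>k\<close> alone, so the equations at later levels
  survive, and it makes the equation at level \<open>k\<close> true.
\<close>

lemma solves_refresh:
  assumes P: "P \<in> borel_prob_measures X" and j: "j = k \<or> k < j \<and> solves j P"
  shows "solves j (refresh k P)"
proof (rule solvesI[OF refresh_in[OF P]])
  fix F assume F: "continuous_map X euclideanreal F" "depends_from j F"
  note bF = bounded_Borel_continuous[OF F(1)]
  have "integral\<^sup>L (refresh k P) F = integral\<^sup>L P (step k F)" by (rule integral_refresh[OF P bF])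
  also have "\<dots> = integral\<^sup>L P (step j F)"
  proof (cases "j = k")
    case False
    then have j: "Suc k \<le> j" "solves j P" using j by auto
    have "integral\<^sup>L P (step k F) = integral\<^sup>L P F"
      by (rule integral_step_eq[OF P depends_from_mono[OF F(2) j(1)]])
    also have "\<dots> = integral\<^sup>L P (step j F)" by (rule solvesD[OF P j(2) bF F(2)])
    finally show ?thesis .
  qed simp
  also have "\<dots> = integral\<^sup>L P (step k (step j F))"
    using j by (intro integral_step_eq[OF P, symmetric] depends_from_mono[OF depends_from_step[OF F(2)]]) auto
  also have "\<dots> = integral\<^sup>L (refresh k P) (step j F)"
    by (rule integral_refresh[OF P bounded_Borel_step[OF bF], symmetric])
  finally show "integral\<^sup>L (refresh k P) F = integral\<^sup>L (refresh k P) (step j F)" .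
qed

primrec refresh_below :: "nat \<Rightarrow> (nat \<Rightarrow> 'a) measure \<Rightarrow> (nat \<Rightarrow> 'a) measure" where
  "refresh_below 0 P = P"
| "refresh_below (Suc m) P = refresh_below m (refresh m P)"

text \<open>
  The coordinates are refreshed from the top downwards, so that no refreshment spoils an equation
  that already holds.
\<close>

lemma solves_refresh_below:
  assumes "P \<in> borel_prob_measures X" "\<And>j. m \<le> j \<Longrightarrow> j < n \<Longrightarrow> solves j P"
  shows "refresh_below m P \<in> borel_prob_measures X \<and> (\<forall>j<n. solves j (refresh_below m P))"
  using assms
proof (induction m arbitrary: P)
  case 0
  then show ?case by simp
next
  case (Suc m)
  have "solves j (refresh m P)" if "m \<le> j" "j < n" for j
    using Suc.prems that by (intro solves_refresh) auto
  then show ?case using Suc.IH[OF refresh_in[OF Suc.prems(1)]] by simp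
qed

text \<open>
  Both sides of the equation are integrals of continuous functions, since \<open>step k\<close> preserves
  continuity.
\<close>

lemma solves_weak_limit:
  assumes N: "\<And>m. N m \<in> borel_prob_measures X" and P: "P \<in> borel_prob_measures X"
    and conv: "weakly_converges X N P" and sol: "\<forall>\<^sub>F m in sequentially. solves k (N m)"
  shows "solves k P"
proof (rule solvesI[OF P])
  fix F assume F: "continuous_map X euclideanreal F" "depends_from k F"
  have "(\<lambda>m. integral\<^sup>L (N m) F) \<longlonglongrightarrow> integral\<^sup>L P F" "(\<lambda>m. integral\<^sup>L (N m) (step k F)) \<longlonglongrightarrow> integral\<^sup>L P (step k F)"
    using conv F(1) continuous_step[OF F(1)] by (auto simp: weakly_converges_def)
  moreover have "\<forall>\<^sub>F m in sequentially. integral\<^sup>L (N m) F = integral\<^sup>L (N m) (step k F)"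
    using sol by eventually_elim (rule solvesD[OF N _ bounded_Borel_continuous[OF F(1)] F(2)])
  ultimately have "(\<lambda>m. integral\<^sup>L (N m) F) \<longlonglongrightarrow> integral\<^sup>L P (step k F)"
    by (simp add: tendsto_cong)
  with \<open>(\<lambda>m. integral\<^sup>L (N m) F) \<longlonglongrightarrow> integral\<^sup>L P F\<close>
  show "integral\<^sup>L P F = integral\<^sup>L P (step k F)" by (rule LIMSEQ_unique)
qed

lemma one_in_Omega: "(\<lambda>k. \<one>\<^bsub>G k\<^esub>) \<in> \<Omega>"
  by (simp add: in_Omega one_closed)

text \<open>
  Refreshing the coordinates \<open>m - 1, \<dots>, 0\<close> of a point mass solves the equations below \<open>m\<close>; any weak
  limit point as \<open>m\<close> grows solves all of them.
\<close>

lemma solutions_nonempty: "solutions G T \<phi> \<mu> \<noteq> {}"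
proof -
  have "(\<lambda>k. \<one>\<^bsub>G k\<^esub>) \<in> topspace X" using one_in_Omega by simp
  from point_mass[OF this[unfolded topspace_X]] obtain P0 where P0: "P0 \<in> borel_prob_measures X" by blast
  define N where "N m = refresh_below m P0" for m
  have N: "N m \<in> borel_prob_measures X" "j < m \<Longrightarrow> solves j (N m)" for m j
    using solves_refresh_below[OF P0, of m m] by (auto simp: N_def)
  obtain r P where r: "strict_mono (r :: nat \<Rightarrow> nat)" and P: "P \<in> borel_prob_measures X"
    and lim: "weakly_converges X (\<lambda>m. N (r m)) P"
    using borel_prob_measures_weakly_sequentially_compact[OF compactum_X, of N] N(1) by blast
  have "solves k P" for k
  proof (rule solves_weak_limit[OF N(1) P lim])
    show "\<forall>\<^sub>F m in sequentially. solves k (N (r m))"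
    proof (rule eventually_sequentiallyI[of "Suc k"])
      fix m assume "Suc k \<le> m"
      then have "k < r m" using seq_suble[OF r, of m] by linarith
      then show "solves k (N (r m))" by (rule N(2))
    qed
  qed
  then show ?thesis using P solution_if_solves by blast
qed

lemma extreme_solutions_nonempty: "extreme_measures (solutions G T \<phi> \<mu>) \<noteq> {}"
proof (rule extreme_measures_nonempty[OF compactum_X])
  show "solutions G T \<phi> \<mu> \<subseteq> borel_prob_measures X" using solves_if_solution(1) by blast
  show "solutions G T \<phi> \<mu> \<noteq> {}" by (rule solutions_nonempty)
  show "P \<in> solutions G T \<phi> \<mu>"
    if "\<And>m. N m \<in> solutions G T \<phi> \<mu>" "P \<in> borel_prob_measures X" "weakly_converges X N P" for N P
    using that solves_if_solution by (intro solution_if_solves solves_weak_limit[of N P]) auto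
qed

section \<open>Translations and mixtures of translates\<close>

definition prod_mult :: "(nat \<Rightarrow> 'a) \<Rightarrow> (nat \<Rightarrow> 'a) \<Rightarrow> nat \<Rightarrow> 'a" where
  "prod_mult g x = (\<lambda>k. g k \<otimes>\<^bsub>G k\<^esub> x k)"

definition prod_inv :: "(nat \<Rightarrow> 'a) \<Rightarrow> nat \<Rightarrow> 'a" where
  "prod_inv g = (\<lambda>k. inv\<^bsub>G k\<^esub> g k)"

lemma in_H: "h \<in> H \<longleftrightarrow> h \<in> \<Omega> \<and> (\<forall>k. h k = \<phi> k (h (Suc k)))"
  by (simp add: inverse_limit_group_def in_Omega)

lemma H_Omega: "h \<in> H \<Longrightarrow> h \<in> \<Omega>" by (simp add: in_H)

lemma prod_mult_Omega: "g \<in> \<Omega> \<Longrightarrow> x \<in> \<Omega> \<Longrightarrow> prod_mult g x \<in> \<Omega>"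
  by (simp add: in_Omega prod_mult_def mult_closed)

lemma prod_inv_Omega: "g \<in> \<Omega> \<Longrightarrow> prod_inv g \<in> \<Omega>"
  by (simp add: in_Omega prod_inv_def inv_closed)

lemma prod_inv_H:
  assumes "h \<in> H" shows "prod_inv h \<in> H"
proof -
  have h: "h \<in> \<Omega>" "\<And>k. h k = \<phi> k (h (Suc k))" using assms unfolding in_H by blast+
  have "prod_inv h k = \<phi> k (prod_inv h (Suc k))" for k
    using phi_inv[of "h (Suc k)" k] h(1) h(2)[of k, symmetric] by (simp add: prod_inv_def in_Omega)
  then show ?thesis using prod_inv_Omega[OF h(1)] unfolding in_H by blast
qed

lemma prod_mult_assoc: "f \<in> \<Omega> \<Longrightarrow> g \<in> \<Omega> \<Longrightarrow> x \<in> \<Omega> \<Longrightarrow> prod_mult (prod_mult f g) x = prod_mult f (prod_mult g x)"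
  by (simp add: prod_mult_def in_Omega monoid.m_assoc[OF monoid_G])

lemma prod_mult_cancel_prod_inv: "g \<in> \<Omega> \<Longrightarrow> x \<in> \<Omega> \<Longrightarrow> prod_mult g (prod_mult (prod_inv g) x) = x"
  by (rule ext) (simp add: prod_mult_def prod_inv_def in_Omega monoid.m_assoc[OF monoid_G, symmetric]
      group.r_inv[OF group_G] monoid.l_one[OF monoid_G] inv_closed)

lemma prod_inv_prod_mult: "f \<in> \<Omega> \<Longrightarrow> g \<in> \<Omega> \<Longrightarrow> prod_inv (prod_mult f g) = prod_mult (prod_inv g) (prod_inv f)"
  by (simp add: prod_mult_def prod_inv_def in_Omega group.inv_mult_group[OF group_G])

lemma prod_inv_prod_inv: "g \<in> \<Omega> \<Longrightarrow> prod_inv (prod_inv g) = g"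
  by (simp add: prod_inv_def in_Omega group.inv_inv[OF group_G])

lemma continuous_prod_mult:
  assumes "continuous_map Z X f" "continuous_map Z X g"
  shows "continuous_map Z X (\<lambda>z. prod_mult (f z) (g z))"
  unfolding continuous_map_componentwise_UNIV prod_mult_def
  by (intro allI continuous_mult continuous_coord_comp assms)

lemma continuous_prod_inv:
  assumes "continuous_map Z X f" shows "continuous_map Z X (\<lambda>z. prod_inv (f z))"
  unfolding continuous_map_componentwise_UNIV prod_inv_def
  by (intro allI continuous_inv continuous_coord_comp assms)

lemma continuous_prod_mult_left:
  assumes "g \<in> \<Omega>" shows "continuous_map X X (prod_mult g)"
  using continuous_prod_mult[of X "\<lambda>_. g" "\<lambda>x. x"] assms by simp

lemma measurable_prod_mult_left: "g \<in> \<Omega> \<Longrightarrow> prod_mult g \<in> borel_of X \<rightarrow>\<^sub>M borel_of X"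
  by (rule continuous_map_measurable_borel_of[OF continuous_prod_mult_left])

lemma bounded_Borel_prod_mult:
  assumes "g \<in> \<Omega>" "bounded_Borel F" shows "bounded_Borel (\<lambda>x. F (prod_mult g x))"
  using assms measurable_compose[OF measurable_prod_mult_left[OF assms(1)]] prod_mult_Omega[OF assms(1)]
  unfolding bounded_Borel_def by blast

text \<open>
  An element of \<open>H\<close> multiplies on the left and is transported by \<open>\<phi>\<^sub>k\<close>, whereas the sample multiplies on
  the right; hence translation by \<open>H\<close> commutes with the transition.
\<close>

lemma update_prod_mult:
  assumes h: "h \<in> H" and x: "x \<in> \<Omega>" and z: "z \<in> carrier (G k)"
  shows "update k (prod_mult h x) z = prod_mult h (update k x z)"
proof
  fix j
  have hk: "h k = \<phi> k (h (Suc k))" "h k \<in> carrier (G k)" "h (Suc k) \<in> carrier (G (Suc k))"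
    using h unfolding inverse_limit_group_def by blast+
  have xk: "x (Suc k) \<in> carrier (G (Suc k))" using x by (simp add: in_Omega)
  have "\<phi> k (h (Suc k) \<otimes>\<^bsub>G (Suc k)\<^esub> x (Suc k)) \<otimes>\<^bsub>G k\<^esub> z = h k \<otimes>\<^bsub>G k\<^esub> (\<phi> k (x (Suc k)) \<otimes>\<^bsub>G k\<^esub> z)"
    using hk xk z by (simp add: phi_mult monoid.m_assoc[OF monoid_G] phi_closed)
  then show "update k (prod_mult h x) z j = prod_mult h (update k x z) j"
    by (simp add: update_def prod_mult_def)
qed

lemma step_prod_mult:
  assumes h: "h \<in> H" and x: "x \<in> \<Omega>"
  shows "step k (\<lambda>x. F (prod_mult h x)) x = step k F (prod_mult h x)"
  unfolding step_def
  by (intro Bochner_Integration.integral_cong refl)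
     (simp add: update_prod_mult[OF h x] space_borel_prob[OF prob_mu] topspace_T)

lemma translate_eq: "translate G T h P = distr P (borel_of X) (prod_mult h)"
  by (simp add: translate_def prod_mult_def[abs_def])

lemma translate_in:
  "P \<in> borel_prob_measures X \<Longrightarrow> h \<in> \<Omega> \<Longrightarrow> translate G T h P \<in> borel_prob_measures X"
  unfolding translate_eq using measurable_prod_mult_left
  by (intro distr_in_borel_prob prob_space_borel_prob) (auto simp: measurable_borel_prob)

lemma integral_translate:
  assumes P: "P \<in> borel_prob_measures X" and h: "h \<in> \<Omega>" and F: "bounded_Borel F"
  shows "integral\<^sup>L (translate G T h P) F = (\<integral>x. F (prod_mult h x) \<partial>P)"
  unfolding translate_eq using F measurable_prod_mult_left[OF h]
  by (intro integral_distr) (auto simp: measurable_borel_prob[OF P] bounded_Borel_def)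

lemma solution_integral_prod_mult:
  assumes P: "P \<in> solutions G T \<phi> \<mu>" and h: "h \<in> H" and F: "bounded_Borel F" "depends_from k F"
  shows "(\<integral>x. F (prod_mult h x) \<partial>P) = (\<integral>x. step k F (prod_mult h x) \<partial>P)"
proof -
  note P' = solves_if_solution(1)[OF P]
  have "depends_from k (\<lambda>x. F (prod_mult h x))"
    unfolding depends_from_def
    using prod_mult_Omega[OF H_Omega[OF h]] by (auto intro!: depends_fromD[OF F(2)] simp: prod_mult_def)
  then have "(\<integral>x. F (prod_mult h x) \<partial>P) = integral\<^sup>L P (step k (\<lambda>x. F (prod_mult h x)))"
    by (rule solvesD[OF P' solves_if_solution(2)[OF P] bounded_Borel_prod_mult[OF H_Omega[OF h] F(1)]])
  also have "\<dots> = (\<integral>x. step k F (prod_mult h x) \<partial>P)"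
    by (intro Bochner_Integration.integral_cong refl step_prod_mult[OF h]) (simp add: space_borel_prob[OF P'])
  finally show ?thesis .
qed

lemma translate_solution:
  assumes P: "P \<in> solutions G T \<phi> \<mu>" and h: "h \<in> H"
  shows "translate G T h P \<in> solutions G T \<phi> \<mu>"
proof (rule solution_if_solves)
  note P' = solves_if_solution(1)[OF P] and h' = H_Omega[OF h]
  show hP: "translate G T h P \<in> borel_prob_measures X" by (rule translate_in[OF P' h'])
  show "solves k (translate G T h P)" for k
  proof (rule solvesI[OF hP])
    fix F assume F: "continuous_map X euclideanreal F" "depends_from k F"
    note bF = bounded_Borel_continuous[OF F(1)]
    show "integral\<^sup>L (translate G T h P) F = integral\<^sup>L (translate G T h P) (step k F)"
      unfolding integral_translate[OF P' h' bF] integral_translate[OF P' h' bounded_Borel_step[OF bF]]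
      by (rule solution_integral_prod_mult[OF P h bF F(2)])
  qed
qed

text \<open>
  The law of \<open>h\<^sup>-\<^sup>1 x\<close> for independent \<open>h\<close> and \<open>x\<close>. The inverse is there because averaging
  \<open>F (h\<^sup>-\<^sup>1 x)\<close> over a left-invariant law of \<open>h\<close> gives a left-invariant function of \<open>x\<close>.
\<close>

definition mixture :: "(nat \<Rightarrow> 'a) measure \<Rightarrow> (nat \<Rightarrow> 'a) measure \<Rightarrow> (nat \<Rightarrow> 'a) measure" where
  "mixture \<eta> P = distr (\<eta> \<Otimes>\<^sub>M P) (borel_of X) (\<lambda>(h, x). prod_mult (prod_inv h) x)"

lemma measurable_prod_mult_prod_inv:
  assumes E: "\<eta> \<in> borel_prob_measures X" and P: "P \<in> borel_prob_measures X"
  shows "(\<lambda>(h, x). prod_mult (prod_inv h) x) \<in> \<eta> \<Otimes>\<^sub>M P \<rightarrow>\<^sub>M borel_of X"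
proof -
  have "sets (\<eta> \<Otimes>\<^sub>M P) = sets (borel_of X \<Otimes>\<^sub>M borel_of X)"
    by (intro sets_pair_measure_cong sets_borel_prob E P)
  also have "\<dots> = sets (borel_of (prod_topology X X))"
    using compactum_X by (intro sets_borel_of_prod_topology) (auto simp: compactum_def)
  finally have sets: "sets (\<eta> \<Otimes>\<^sub>M P) = sets (borel_of (prod_topology X X))" .
  have "continuous_map (prod_topology X X) X (\<lambda>p. prod_mult (prod_inv (fst p)) (snd p))"
    by (intro continuous_prod_mult continuous_prod_inv continuous_map_fst continuous_map_snd)
  then show ?thesis
    using continuous_map_measurable_borel_of by (simp add: measurable_cong_sets[OF sets refl] case_prod_unfold)
qed

lemma prob_space_pair_X:
  assumes E: "\<eta> \<in> borel_prob_measures X" and P: "P \<in> borel_prob_measures X"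
  shows "pair_prob_space \<eta> P"
  using prob_space_borel_prob[OF E] prob_space_borel_prob[OF P]
  by (simp add: pair_prob_space_def pair_sigma_finite_def prob_space_imp_sigma_finite)

lemma mixture_in:
  assumes E: "\<eta> \<in> borel_prob_measures X" and P: "P \<in> borel_prob_measures X"
  shows "mixture \<eta> P \<in> borel_prob_measures X"
proof -
  interpret pair_prob_space \<eta> P by (rule prob_space_pair_X[OF E P])
  show ?thesis
    unfolding mixture_def by (intro distr_in_borel_prob prob_space_axioms measurable_prod_mult_prod_inv[OF E P])
qed

lemma integrable_prod_mult_prod_inv:
  assumes E: "\<eta> \<in> borel_prob_measures X" and P: "P \<in> borel_prob_measures X" and F: "bounded_Borel F"
  shows "integrable (\<eta> \<Otimes>\<^sub>M P) (\<lambda>(h, x). F (prod_mult (prod_inv h) x))"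
proof -
  interpret pair_prob_space \<eta> P by (rule prob_space_pair_X[OF E P])
  obtain B where B: "\<forall>x\<in>\<Omega>. \<bar>F x\<bar> \<le> B" using F by (auto simp: bounded_Borel_def)
  have FX: "F \<in> borel_measurable (borel_of X)" using F by (simp add: bounded_Borel_def)
  show ?thesis
  proof (rule integrable_bounded)
    show "(\<lambda>(h, x). F (prod_mult (prod_inv h) x)) \<in> borel_measurable (\<eta> \<Otimes>\<^sub>M P)"
      using measurable_compose[OF measurable_prod_mult_prod_inv[OF E P] FX] by (simp add: case_prod_unfold)
    show "\<bar>case p of (h, x) \<Rightarrow> F (prod_mult (prod_inv h) x)\<bar> \<le> B" if "p \<in> space (\<eta> \<Otimes>\<^sub>M P)" for p
      using B prod_mult_Omega prod_inv_Omega that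
      by (auto simp: space_pair_measure space_borel_prob[OF E] space_borel_prob[OF P])
  qed
qed

lemma integrable_average:
  assumes E: "\<eta> \<in> borel_prob_measures X" and P: "P \<in> borel_prob_measures X" and F: "bounded_Borel F"
  shows "integrable \<eta> (\<lambda>h. \<integral>x. F (prod_mult (prod_inv h) x) \<partial>P)"
proof -
  interpret pair_prob_space \<eta> P by (rule prob_space_pair_X[OF E P])
  show ?thesis using integrable_fst[OF integrable_prod_mult_prod_inv[OF E P F]] .
qed

lemma integral_mixture:
  assumes E: "\<eta> \<in> borel_prob_measures X" and P: "P \<in> borel_prob_measures X" and F: "bounded_Borel F"
  shows "integral\<^sup>L (mixture \<eta> P) F = (\<integral>h. (\<integral>x. F (prod_mult (prod_inv h) x) \<partial>P) \<partial>\<eta>)"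
proof -
  interpret pair_prob_space \<eta> P by (rule prob_space_pair_X[OF E P])
  have "integral\<^sup>L (mixture \<eta> P) F = (\<integral>p. F (case p of (h, x) \<Rightarrow> prod_mult (prod_inv h) x) \<partial>(\<eta> \<Otimes>\<^sub>M P))"
    unfolding mixture_def using F measurable_prod_mult_prod_inv[OF E P]
    by (intro integral_distr) (auto simp: bounded_Borel_def)
  then show ?thesis using integral_fst[OF integrable_prod_mult_prod_inv[OF E P F]] by (simp add: case_prod_unfold)
qed

lemma mixture_solution:
  assumes E: "\<eta> \<in> borel_prob_measures X" and EH: "AE h in \<eta>. h \<in> H" and P: "P \<in> solutions G T \<phi> \<mu>"
  shows "mixture \<eta> P \<in> solutions G T \<phi> \<mu>"
proof (rule solution_if_solves)
  note P' = solves_if_solution(1)[OF P]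
  show M: "mixture \<eta> P \<in> borel_prob_measures X" by (rule mixture_in[OF E P'])
  show "solves k (mixture \<eta> P)" for k
  proof (rule solvesI[OF M])
    fix F assume F: "continuous_map X euclideanreal F" "depends_from k F"
    note bF = bounded_Borel_continuous[OF F(1)] and bS = bounded_Borel_step[OF bounded_Borel_continuous[OF F(1)]]
    show "integral\<^sup>L (mixture \<eta> P) F = integral\<^sup>L (mixture \<eta> P) (step k F)"
      unfolding integral_mixture[OF E P' bF] integral_mixture[OF E P' bS]
    proof (rule integral_cong_AE)
      show "AE h in \<eta>. (\<integral>x. F (prod_mult (prod_inv h) x) \<partial>P) = (\<integral>x. step k F (prod_mult (prod_inv h) x) \<partial>P)"
        using EH by eventually_elim (rule solution_integral_prod_mult[OF P prod_inv_H bF F(2)])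
    qed (use integrable_average[OF E P'] bF bS in auto)
  qed
qed

section \<open>Invariant test functions do not distinguish solutions\<close>

primrec steps :: "nat \<Rightarrow> ((nat \<Rightarrow> 'a) \<Rightarrow> real) \<Rightarrow> (nat \<Rightarrow> 'a) \<Rightarrow> real" where
  "steps 0 F = F"
| "steps (Suc m) F = step m (steps m F)"

lemma bounded_Borel_steps: "bounded_Borel F \<Longrightarrow> bounded_Borel (steps m F)"
  by (induction m) (simp_all add: bounded_Borel_step)

lemma depends_from_steps: "depends_from m (steps m F)"
proof (induction m)
  case 0
  have "x = y" if "\<forall>j\<ge>0. x j = y j" for x y :: "nat \<Rightarrow> 'a" using that by auto
  then show ?case by (auto simp: depends_from_def)
qed (simp add: depends_from_step)

lemma integral_steps:
  assumes P: "P \<in> solutions G T \<phi> \<mu>" and F: "bounded_Borel F"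
  shows "integral\<^sup>L P (steps m F) = integral\<^sup>L P F"
proof (induction m)
  case (Suc m)
  have "integral\<^sup>L P (steps m F) = integral\<^sup>L P (step m (steps m F))"
    by (rule solvesD[OF solves_if_solution[OF P] bounded_Borel_steps[OF F] depends_from_steps])
  then show ?case using Suc by simp
qed simp

text \<open>
  The quotient \<open>x y\<^sup>-\<^sup>1\<close> satisfies the relations that define \<open>H\<close> at the levels \<open>j, \<dots>, m - 1\<close>.
\<close>

definition related :: "nat \<Rightarrow> nat \<Rightarrow> (nat \<Rightarrow> 'a) \<Rightarrow> (nat \<Rightarrow> 'a) \<Rightarrow> bool" where
  "related j m x y \<longleftrightarrow> (\<forall>n. j \<le> n \<and> n < m \<longrightarrow>
     prod_mult x (prod_inv y) n = \<phi> n (prod_mult x (prod_inv y) (Suc n)))"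

lemma related_update:
  assumes x: "x \<in> \<Omega>" and y: "y \<in> \<Omega>" and z: "z \<in> carrier (G j)" and rel: "related (Suc j) m x y"
  shows "related j m (update j x z) (update j y z)"
  unfolding related_def
proof (intro allI impI)
  fix n assume n: "j \<le> n \<and> n < m"
  show "prod_mult (update j x z) (prod_inv (update j y z)) n =
      \<phi> n (prod_mult (update j x z) (prod_inv (update j y z)) (Suc n))"
  proof (cases "n = j")
    case False
    then show ?thesis using n rel by (simp add: related_def prod_mult_def prod_inv_def update_def)
  next
    case True
    interpret Gj: group "G j" by (rule group_G)
    have xc: "x (Suc j) \<in> carrier (G (Suc j))" "y (Suc j) \<in> carrier (G (Suc j))" using x y by (auto simp: in_Omega)
    let ?a = "\<phi> j (x (Suc j))" and ?b = "\<phi> j (y (Suc j))"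
    have c: "?a \<in> carrier (G j)" "?b \<in> carrier (G j)" using xc by (auto intro: phi_closed)
    have "z \<otimes>\<^bsub>G j\<^esub> (inv\<^bsub>G j\<^esub> z \<otimes>\<^bsub>G j\<^esub> inv\<^bsub>G j\<^esub> ?b) = inv\<^bsub>G j\<^esub> ?b"
      using c z by (simp add: Gj.m_assoc[symmetric])
    then have "(?a \<otimes>\<^bsub>G j\<^esub> z) \<otimes>\<^bsub>G j\<^esub> inv\<^bsub>G j\<^esub> (?b \<otimes>\<^bsub>G j\<^esub> z) = ?a \<otimes>\<^bsub>G j\<^esub> inv\<^bsub>G j\<^esub> ?b"
      using c z by (simp add: Gj.inv_mult_group Gj.m_assoc)
    also have "\<dots> = \<phi> j (x (Suc j) \<otimes>\<^bsub>G (Suc j)\<^esub> inv\<^bsub>G (Suc j)\<^esub> y (Suc j))"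
      using xc by (simp add: phi_mult phi_inv inv_closed)
    finally show ?thesis using True by (simp add: prod_mult_def prod_inv_def update_def)
  qed
qed

lemma update_section_measurable:
  assumes F: "bounded_Borel F" and x: "x \<in> \<Omega>"
  shows "(\<lambda>z. F (update k x z)) \<in> borel_measurable (\<mu> k)"
proof -
  have "continuous_map (T k) (prod_topology X (T k)) (\<lambda>z. (x, z))"
    using x by (simp add: continuous_map_pairwise comp_def)
  from continuous_map_compose[OF this continuous_update]
  have "continuous_map (T k) X (update k x)" by (simp add: comp_def)
  from measurable_compose[OF continuous_map_measurable_borel_of[OF this]]
  have "(\<lambda>z. F (update k x z)) \<in> borel_measurable (borel_of (T k))"
    using F unfolding bounded_Borel_def by blast
  then show ?thesis by (simp add: measurable_borel_prob[OF prob_mu])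
qed

text \<open>
  Writing \<open>x = u y\<close>, averaging over the level \<open>j\<close> replaces \<open>u\<^sub>j\<close> by \<open>\<phi>\<^sub>j(u\<^sub>j\<^sub>+\<^sub>1)\<close> because the same
  sample multiplies both points on the right.  Hence the averages over all levels below \<open>m\<close> compare
  points that agree up to left multiplication by a sequence which is compatible below \<open>m\<close>.
\<close>

lemma steps_oscillation:
  assumes F: "bounded_Borel F" and c: "\<And>x y. x \<in> \<Omega> \<Longrightarrow> y \<in> \<Omega> \<Longrightarrow> related 0 m x y \<Longrightarrow> \<bar>F x - F y\<bar> \<le> c"
    and "j \<le> m" "x \<in> \<Omega>" "y \<in> \<Omega>" "related j m x y"
  shows "\<bar>steps j F x - steps j F y\<bar> \<le> c"
  using assms(3-)
proof (induction j arbitrary: x y)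
  case 0
  then show ?case using c by simp
next
  case (Suc j)
  interpret mu: prob_space "\<mu> j" by (rule prob_space_borel_prob[OF prob_mu])
  let ?F = "steps j F"
  note bF = bounded_Borel_steps[OF F, of j]
  obtain B where B: "\<forall>x\<in>\<Omega>. \<bar>?F x\<bar> \<le> B" using bF by (auto simp: bounded_Borel_def)
  have int: "integrable (\<mu> j) (\<lambda>z. ?F (update j w z))" if w: "w \<in> \<Omega>" for w
    using B update_in_Omega[OF w] update_section_measurable[OF bF w]
    by (intro mu.integrable_bounded[of _ B]) (auto simp: space_borel_prob[OF prob_mu] topspace_T)
  have "\<bar>?F (update j x z) - ?F (update j y z)\<bar> \<le> c" if "z \<in> space (\<mu> j)" for z
  proof -
    have z: "z \<in> carrier (G j)" using that by (simp add: space_borel_prob[OF prob_mu] topspace_T)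
    show ?thesis
      using Suc.prems z by (intro Suc.IH related_update update_in_Omega) auto
  qed
  then have "\<bar>\<integral>z. ?F (update j x z) - ?F (update j y z) \<partial>\<mu> j\<bar> \<le> c"
    using int[OF Suc.prems(2)] int[OF Suc.prems(3)] by (intro mu.abs_integral_le) auto
  then show ?case
    using int[OF Suc.prems(2)] int[OF Suc.prems(3)] by (simp add: step_def)
qed

text \<open>
  The compatible sequences below \<open>m\<close> decrease to \<open>H\<close> as \<open>m\<close> grows; compactness turns invariance
  under \<open>H\<close> into uniform near-invariance under these sets.
\<close>

lemma invariant_uniform:
  assumes F: "continuous_map X euclideanreal F"
    and inv: "\<And>h x. h \<in> H \<Longrightarrow> x \<in> \<Omega> \<Longrightarrow> F (prod_mult h x) = F x" and e: "0 < e"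
  shows "\<exists>m. \<forall>x\<in>\<Omega>. \<forall>y\<in>\<Omega>. related 0 m x y \<longrightarrow> \<bar>F x - F y\<bar> \<le> e"
proof (rule ccontr)
  assume contra: "\<nexists>m. \<forall>x\<in>\<Omega>. \<forall>y\<in>\<Omega>. related 0 m x y \<longrightarrow> \<bar>F x - F y\<bar> \<le> e"
  let ?Y = "prod_topology X X"
  let ?u = "\<lambda>p. prod_mult (fst p) (prod_inv (snd p))"
  define D where "D = {p \<in> topspace ?Y. \<bar>F (fst p) - F (snd p)\<bar> \<in> {e..}}"
  define E where "E n = {p \<in> topspace ?Y. ?u p n = \<phi> n (?u p (Suc n))}" for n
  define C where "C m = D \<inter> (\<Inter>n\<in>{..<m}. E n)" for m
  have fst: "continuous_map ?Y X fst" and snd: "continuous_map ?Y X snd"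
    by (simp_all add: continuous_map_fst continuous_map_snd)
  have "continuous_map ?Y euclideanreal (\<lambda>p. \<bar>F (fst p) - F (snd p)\<bar>)"
    using continuous_map_compose[OF fst F] continuous_map_compose[OF snd F]
    by (intro continuous_map_real_abs continuous_map_diff) (simp_all add: comp_def)
  then have D: "closedin ?Y D"
    unfolding D_def by (rule closedin_continuous_map_preimage) simp
  have u: "continuous_map ?Y X ?u" by (intro continuous_prod_mult continuous_prod_inv fst snd)
  have E: "closedin ?Y (E n)" for n
    unfolding E_def
    by (rule closedin_continuous_maps_eq[OF Hausdorff_T continuous_coord_comp[OF u]
          continuous_phi_comp[OF continuous_coord_comp[OF u]]])
  have "(\<Inter>m. C m) \<noteq> {}"
  proof (rule compact_space_imp_nest[of ?Y])
    show "compact_space ?Y" using compactum_X by (simp add: compactum_def compact_space_prod_topology)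
    show "closedin ?Y (C m)" for m
      unfolding C_def using D E
      by (induction m) (auto simp: lessThan_Suc Int_left_commute[of D] intro!: closedin_Int)
    show "decseq C" by (force simp: decseq_def C_def)
    show "C m \<noteq> {}" for m
    proof -
      obtain x y where xy: "x \<in> \<Omega>" "y \<in> \<Omega>" "related 0 m x y" "\<not> \<bar>F x - F y\<bar> \<le> e"
        using contra by blast
      then have "(x, y) \<in> C m" by (auto simp: C_def D_def E_def related_def)
      then show ?thesis by blast
    qed
  qed
  then obtain p where p: "\<And>m. p \<in> C m" by blast
  obtain x y where xy: "p = (x, y)" by (cases p)
  have Om: "x \<in> \<Omega>" "y \<in> \<Omega>" and d: "e \<le> \<bar>F x - F y\<bar>" using p[of 0] xy by (auto simp: C_def D_def)
  have "?u p n = \<phi> n (?u p (Suc n))" for n using p[of "Suc n"] by (auto simp: C_def E_def)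
  then have H: "prod_mult x (prod_inv y) \<in> H"
    using prod_mult_Omega[OF Om(1) prod_inv_Omega[OF Om(2)]] unfolding in_H xy fst_conv snd_conv by blast
  have "prod_mult (prod_mult x (prod_inv y)) y = x"
    using Om by (rule_tac ext) (simp add: prod_mult_def prod_inv_def in_Omega monoid.m_assoc[OF monoid_G]
      group.l_inv[OF group_G] monoid.r_one[OF monoid_G] inv_closed)
  then have "F x = F y" using inv[OF H Om(2)] by simp
  then show False using d e by simp
qed

text \<open>
  The average \<open>steps m F\<close> has the same integral as \<open>F\<close> under every solution. For the empty range of
  levels \<open>m, \<dots>, m - 1\<close> any two points are related, so for large \<open>m\<close> this average is nearly constant.
\<close>

lemma solutions_agree_on_invariant:
  assumes P: "P \<in> solutions G T \<phi> \<mu>" and Q: "Q \<in> solutions G T \<phi> \<mu>"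
    and F: "continuous_map X euclideanreal F"
    and inv: "\<And>h x. h \<in> H \<Longrightarrow> x \<in> \<Omega> \<Longrightarrow> F (prod_mult h x) = F x"
  shows "integral\<^sup>L P F = integral\<^sup>L Q F"
proof -
  note bF = bounded_Borel_continuous[OF F]
  have "\<bar>integral\<^sup>L P F - integral\<^sup>L Q F\<bar> \<le> e" if e: "0 < e" for e
  proof -
    have "0 < e / 2" using e by simp
    from invariant_uniform[OF F inv this] obtain m
      where m: "\<And>x y. x \<in> \<Omega> \<Longrightarrow> y \<in> \<Omega> \<Longrightarrow> related 0 m x y \<Longrightarrow> \<bar>F x - F y\<bar> \<le> e / 2" by blast
    let ?one = "\<lambda>k. \<one>\<^bsub>G k\<^esub>"
    have osc: "\<bar>steps m F x - steps m F ?one\<bar> \<le> e / 2" if "x \<in> \<Omega>" for x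
      using that one_in_Omega by (intro steps_oscillation[OF bF m]) (auto simp: related_def)
    have near: "\<bar>integral\<^sup>L R F - steps m F ?one\<bar> \<le> e / 2" if R: "R \<in> solutions G T \<phi> \<mu>" for R
    proof -
      note R' = solves_if_solution(1)[OF R]
      interpret prob_space R by (rule prob_space_borel_prob[OF R'])
      have int: "integrable R (steps m F)" by (rule bounded_Borel_integrable[OF R' bounded_Borel_steps[OF bF]])
      have "\<bar>\<integral>x. steps m F x - steps m F ?one \<partial>R\<bar> \<le> e / 2"
        using osc int by (intro abs_integral_le) (auto simp: space_borel_prob[OF R'])
      then show ?thesis using int integral_steps[OF R bF, of m] by (simp add: prob_space)
    qed
    show ?thesis using near[OF P] near[OF Q] by linarith
  qed
  then have "\<bar>integral\<^sup>L P F - integral\<^sup>L Q F\<bar> \<le> 0" by (rule field_le_epsilon[of _ 0, simplified])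
  then show ?thesis by simp
qed

section \<open>An invariant solution yields an invariant measure on the limit group\<close>

text \<open>
  Running the recursion with the unit in place of the samples makes the coordinates below \<open>m\<close>
  compatible with the \<open>m\<close>-th one.
\<close>

primrec project :: "nat \<Rightarrow> (nat \<Rightarrow> 'a) \<Rightarrow> nat \<Rightarrow> 'a" where
  "project 0 x = x"
| "project (Suc m) x = project m (update m x \<one>\<^bsub>G m\<^esub>)"

definition compatible_below :: "nat \<Rightarrow> (nat \<Rightarrow> 'a) set" where
  "compatible_below m = {x \<in> \<Omega>. \<forall>n<m. x n = \<phi> n (x (Suc n))}"

lemma continuous_update_one: "continuous_map X X (\<lambda>x. update m x \<one>\<^bsub>G m\<^esub>)"
proof -
  have "continuous_map X (prod_topology X (T m)) (\<lambda>x. (x, \<one>\<^bsub>G m\<^esub>))"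
    by (simp add: continuous_map_pairwise comp_def topspace_T one_closed)
  from continuous_map_compose[OF this continuous_update] show ?thesis by (simp add: comp_def)
qed

lemma continuous_project: "continuous_map X X (project m)"
proof (induction m)
  case (Suc m)
  from continuous_map_compose[OF continuous_update_one Suc] show ?case by (simp add: comp_def)
qed simp

lemma project_compatible:
  assumes "x \<in> \<Omega>"
  shows "project m x \<in> \<Omega> \<and> (\<forall>j\<ge>m. project m x j = x j) \<and>
    (\<forall>n<m. project m x n = \<phi> n (project m x (Suc n)))"
  using assms
proof (induction m arbitrary: x)
  case (Suc m)
  let ?y = "update m x \<one>\<^bsub>G m\<^esub>"
  have y: "?y \<in> \<Omega>" using Suc.prems one_closed by (rule update_in_Omega)
  have "x (Suc m) \<in> carrier (G (Suc m))" using Suc.prems by (simp add: in_Omega)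
  then have "?y m = \<phi> m (x (Suc m))"
    by (simp add: update_def monoid.r_one[OF monoid_G] phi_closed)
  moreover have "?y j = x j" if "m < j" for j using that by (simp add: update_def)
  ultimately show ?case using Suc.IH[OF y] by (auto simp: less_Suc_eq)
qed simp

lemma project_in_compatible_below:
  assumes "x \<in> \<Omega>" "n \<le> m" shows "project m x \<in> compatible_below n"
  unfolding compatible_below_def
proof (intro CollectI conjI allI impI)
  show "project m x \<in> \<Omega>" using project_compatible[OF assms(1)] by blast
  show "project m x i = \<phi> i (project m x (Suc i))" if "i < n" for i
    using project_compatible[OF assms(1), of m] less_le_trans[OF that assms(2)] by blast
qed

lemma project_prod_mult: "h \<in> H \<Longrightarrow> x \<in> \<Omega> \<Longrightarrow> project m (prod_mult h x) = prod_mult h (project m x)"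
  by (induction m arbitrary: x) (simp_all add: update_prod_mult one_closed update_in_Omega)

lemma closedin_compatible_below: "closedin X (compatible_below m)"
proof -
  have id: "continuous_map X X (\<lambda>x. x)" by simp
  have E: "closedin X {x \<in> topspace X. x n = \<phi> n (x (Suc n))}" for n
    by (rule closedin_continuous_maps_eq[OF Hausdorff_T continuous_coord_comp[OF id]
          continuous_phi_comp[OF continuous_coord_comp[OF id]]])
  show ?thesis
  proof (induction m)
    case 0
    then show ?case using closedin_topspace[of X] by (simp add: compatible_below_def)
  next
    case (Suc m)
    have "compatible_below (Suc m) = compatible_below m \<inter> {x \<in> topspace X. x m = \<phi> m (x (Suc m))}"
      by (auto simp: compatible_below_def less_Suc_eq)
    then show ?case using closedin_Int[OF Suc E] by simp
  qed
qed

lemma in_H_iff_compatible: "h \<in> H \<longleftrightarrow> (\<forall>m. h \<in> compatible_below m)"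
proof
  assume "h \<in> H"
  then have "h \<in> \<Omega>" "\<forall>k. h k = \<phi> k (h (Suc k))" unfolding in_H by blast+
  then show "\<forall>m. h \<in> compatible_below m" unfolding compatible_below_def by blast
next
  assume h: "\<forall>m. h \<in> compatible_below m"
  then have "h k = \<phi> k (h (Suc k))" for k
    unfolding compatible_below_def using lessI by blast
  then show "h \<in> H" using h unfolding in_H compatible_below_def by blast
qed

text \<open>
  Under the projections \<open>x \<mapsto> (\<phi>\<^sub>n \<circ> \<dots> \<circ> \<phi>\<^sub>m\<^sub>-\<^sub>1(x\<^sub>m))\<^sub>n\<^sub><\<^sub>m\<close>, which commute with left
  multiplication by elements of \<open>H\<close>, the laws of an invariant solution accumulate at a
  left-invariant probability measure on \<open>H\<close>, that is, at its Haar measure.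
\<close>

lemma invariant_measure_on_H:
  assumes P: "P \<in> borel_prob_measures X" and inv: "\<And>h. h \<in> H \<Longrightarrow> translate G T h P = P"
  shows "\<exists>\<eta>\<in>borel_prob_measures X. (AE h in \<eta>. h \<in> H) \<and>
    (\<forall>F g. continuous_map X euclideanreal F \<longrightarrow> g \<in> H \<longrightarrow> (\<integral>h. F (prod_mult g h) \<partial>\<eta>) = integral\<^sup>L \<eta> F)"
proof -
  interpret P: prob_space P by (rule prob_space_borel_prob[OF P])
  define N where "N m = distr P (borel_of X) (project m)" for m
  have pm: "project m \<in> P \<rightarrow>\<^sub>M borel_of X" for m
    using continuous_map_measurable_borel_of[OF continuous_project] by (simp add: measurable_borel_prob[OF P])
  have N: "N m \<in> borel_prob_measures X" for m
    unfolding N_def using P.prob_space_axioms pm by (rule distr_in_borel_prob)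
  have int_N: "integral\<^sup>L (N m) F = (\<integral>x. F (project m x) \<partial>P)" if "bounded_Borel F" for m F
    unfolding N_def using pm that by (intro integral_distr) (auto simp: bounded_Borel_def)
  obtain r \<eta> where r: "strict_mono (r :: nat \<Rightarrow> nat)" and E: "\<eta> \<in> borel_prob_measures X"
    and lim: "weakly_converges X (\<lambda>m. N (r m)) \<eta>"
    and closed: "\<forall>K e. closedin X K \<longrightarrow> 0 < e \<longrightarrow> (\<forall>\<^sub>F m in sequentially. measure (N (r m)) K < measure \<eta> K + e)"
    using borel_prob_measures_weakly_sequentially_compact[OF compactum_X, of N] N by blast
  interpret E: prob_space \<eta> by (rule prob_space_borel_prob[OF E])
  have "measure \<eta> (compatible_below n) = 1" for n
  proof -
    have K: "compatible_below n \<in> sets (borel_of X)" by (rule closedin_in_borel_of[OF closedin_compatible_below])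
    have one: "measure (N m) (compatible_below n) = 1" if "n \<le> m" for m
    proof -
      have "measure (N m) (compatible_below n) = measure P (project m -` compatible_below n \<inter> space P)"
        unfolding N_def using pm K by (rule measure_distr)
      also have "project m -` compatible_below n \<inter> space P = space P"
        using project_in_compatible_below[OF _ that] by (auto simp: space_borel_prob[OF P])
      finally show ?thesis by (simp add: P.prob_space)
    qed
    have "1 \<le> measure \<eta> (compatible_below n) + e" if e: "0 < e" for e
    proof -
      have "\<forall>\<^sub>F m in sequentially. measure (N (r m)) (compatible_below n) < measure \<eta> (compatible_below n) + e"
        using closed closedin_compatible_below e by blast
      moreover have "\<forall>\<^sub>F m in sequentially. n \<le> r m"
        using eventually_ge_at_top[of n] by eventually_elim (use seq_suble[OF r] le_trans in blast)
      ultimately have "\<forall>\<^sub>F m in sequentially. 1 < measure \<eta> (compatible_below n) + e"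
        by eventually_elim (use one in auto)
      then show ?thesis by simp
    qed
    then have "1 \<le> measure \<eta> (compatible_below n)" by (rule field_le_epsilon)
    then show ?thesis using E.prob_le_1[of "compatible_below n"] by simp
  qed
  then have "AE h in \<eta>. h \<in> compatible_below n" for n
    using E.AE_in_set_eq_1 closedin_in_borel_of[OF closedin_compatible_below]
    by (simp add: sets_borel_prob[OF E])
  then have "AE h in \<eta>. \<forall>n. h \<in> compatible_below n" by (simp add: AE_all_countable)
  then have "AE h in \<eta>. h \<in> H" by (simp only: in_H_iff_compatible)
  moreover have "(\<integral>h. F (prod_mult g h) \<partial>\<eta>) = integral\<^sup>L \<eta> F"
    if F: "continuous_map X euclideanreal F" and g: "g \<in> H" for F g
  proof (rule LIMSEQ_unique)
    note g' = H_Omega[OF g]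
    have Fg: "continuous_map X euclideanreal (\<lambda>h. F (prod_mult g h))"
      using continuous_map_compose[OF continuous_prod_mult_left[OF g'] F] by (simp add: comp_def)
    show "(\<lambda>m. \<integral>h. F (prod_mult g h) \<partial>N (r m)) \<longlonglongrightarrow> (\<integral>h. F (prod_mult g h) \<partial>\<eta>)" using lim Fg unfolding weakly_converges_def by blast
    have "(\<integral>h. F (prod_mult g h) \<partial>N m) = integral\<^sup>L (N m) F" for m
    proof -
      have Fp: "bounded_Borel (\<lambda>x. F (project m x))"
        using continuous_map_compose[OF continuous_project F]
        by (intro bounded_Borel_continuous) (simp add: comp_def)
      have "(\<integral>h. F (prod_mult g h) \<partial>N m) = (\<integral>x. F (prod_mult g (project m x)) \<partial>P)"
        by (rule int_N[OF bounded_Borel_continuous[OF Fg]])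
      also have "\<dots> = (\<integral>x. F (project m (prod_mult g x)) \<partial>P)"
        by (intro Bochner_Integration.integral_cong refl) (simp add: space_borel_prob[OF P] project_prod_mult[OF g])
      also have "\<dots> = integral\<^sup>L (translate G T g P) (\<lambda>x. F (project m x))"
        by (rule integral_translate[OF P g' Fp, symmetric])
      also have "\<dots> = integral\<^sup>L (N m) F"
        unfolding inv[OF g] by (rule int_N[OF bounded_Borel_continuous[OF F], symmetric])
      finally show ?thesis .
    qed
    then show "(\<lambda>m. \<integral>h. F (prod_mult g h) \<partial>N (r m)) \<longlonglongrightarrow> integral\<^sup>L \<eta> F"
      using lim F by (simp add: weakly_converges_def)
  qed
  ultimately show ?thesis using E by blast
qed

section \<open>An invariant extreme solution is the only solution\<close>

text \<open>
  Averaging a test function \<open>F\<close> over \<open>\<eta>\<close> gives a continuous \<open>H\<close>-invariant function, which has the same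
  integral under \<open>P0\<close> and \<open>P\<close>. By Fubini's theorem its integral under \<open>P0\<close> is that of \<open>F\<close>, as \<open>P0\<close> is
  invariant, and its integral under \<open>P\<close> is the integral of \<open>F\<close> under the mixture.
\<close>

lemma invariant_solution_eq_mixture:
  assumes P0: "P0 \<in> solutions G T \<phi> \<mu>" and inv: "\<And>h. h \<in> H \<Longrightarrow> translate G T h P0 = P0"
    and E: "\<eta> \<in> borel_prob_measures X" and EH: "AE h in \<eta>. h \<in> H"
    and Einv: "\<And>F g. continuous_map X euclideanreal F \<Longrightarrow> g \<in> H \<Longrightarrow> (\<integral>h. F (prod_mult g h) \<partial>\<eta>) = integral\<^sup>L \<eta> F"
    and P: "P \<in> solutions G T \<phi> \<mu>"
  shows "P0 = mixture \<eta> P"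
proof (rule borel_prob_eqI[OF compactum_X])
  note P' = solves_if_solution(1)[OF P] and P0' = solves_if_solution(1)[OF P0]
  show "P0 \<in> borel_prob_measures X" by (rule P0')
  show "mixture \<eta> P \<in> borel_prob_measures X" by (rule mixture_in[OF E P'])
  interpret E: prob_space \<eta> by (rule prob_space_borel_prob[OF E])
  fix F assume F: "continuous_map X euclideanreal F"
  note bF = bounded_Borel_continuous[OF F]
  define A where "A x = (\<integral>h. F (prod_mult (prod_inv h) x) \<partial>\<eta>)" for x
  have joint: "continuous_map (prod_topology X X) euclideanreal (\<lambda>(x, h). F (prod_mult (prod_inv h) x))"
  proof -
    have "continuous_map (prod_topology X X) X (\<lambda>p. prod_mult (prod_inv (snd p)) (fst p))"
      by (intro continuous_prod_mult continuous_prod_inv continuous_map_fst continuous_map_snd)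
    from continuous_map_compose[OF this F] show ?thesis by (simp add: comp_def case_prod_unfold)
  qed
  have A: "continuous_map X euclideanreal A"
    unfolding A_def[abs_def]
    by (rule continuous_map_integral_parameter[OF _ E joint]) (use compactum_X in \<open>simp add: compactum_def\<close>)
  have A_inv: "A (prod_mult g x) = A x" if g: "g \<in> H" and x: "x \<in> \<Omega>" for g x
  proof -
    have g': "prod_inv g \<in> H" "g \<in> \<Omega>" "prod_inv g \<in> \<Omega>" using prod_inv_H[OF g] H_Omega g by blast+
    have "continuous_map X (prod_topology X X) (\<lambda>h. (x, h))"
      using x by (simp add: continuous_map_pairwise comp_def)
    from continuous_map_compose[OF this joint]
    have cont: "continuous_map X euclideanreal (\<lambda>h. F (prod_mult (prod_inv h) x))" by (simp add: comp_def)
    have "A (prod_mult g x) = (\<integral>h. F (prod_mult (prod_inv (prod_mult (prod_inv g) h)) x) \<partial>\<eta>)"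
      unfolding A_def
    proof (intro Bochner_Integration.integral_cong refl)
      fix h assume "h \<in> space \<eta>"
      then have h: "h \<in> \<Omega>" by (simp add: space_borel_prob[OF E])
      show "F (prod_mult (prod_inv h) (prod_mult g x)) = F (prod_mult (prod_inv (prod_mult (prod_inv g) h)) x)"
        using h g' x by (simp add: prod_inv_prod_mult prod_inv_prod_inv prod_mult_assoc prod_inv_Omega)
    qed
    also have "\<dots> = A x" unfolding A_def by (rule Einv[OF cont g'(1)])
    finally show ?thesis .
  qed
  have swap: "integral\<^sup>L R A = (\<integral>h. (\<integral>x. F (prod_mult (prod_inv h) x) \<partial>R) \<partial>\<eta>)"
    if R: "R \<in> borel_prob_measures X" for R
  proof -
    interpret pair_prob_space \<eta> R by (rule prob_space_pair_X[OF E R])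
    show ?thesis unfolding A_def by (rule Fubini_integral[OF integrable_prod_mult_prod_inv[OF E R bF]])
  qed
  have "(\<integral>h. (\<integral>x. F (prod_mult (prod_inv h) x) \<partial>P0) \<partial>\<eta>) = (\<integral>h. integral\<^sup>L P0 F \<partial>\<eta>)"
  proof (rule integral_cong_AE)
    show "AE h in \<eta>. (\<integral>x. F (prod_mult (prod_inv h) x) \<partial>P0) = integral\<^sup>L P0 F"
      using EH
    proof eventually_elim
      case (elim h)
      have "integral\<^sup>L (translate G T (prod_inv h) P0) F = (\<integral>x. F (prod_mult (prod_inv h) x) \<partial>P0)"
        by (rule integral_translate[OF P0' H_Omega[OF prod_inv_H[OF elim]] bF])
      then show ?case using inv[OF prod_inv_H[OF elim]] by simp
    qed
  qed (use integrable_average[OF E P0' bF] in auto)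
  then have "integral\<^sup>L P0 F = integral\<^sup>L P0 A" using swap[OF P0'] by (simp add: E.prob_space)
  also have "\<dots> = integral\<^sup>L P A" by (rule solutions_agree_on_invariant[OF P0 P A A_inv])
  also have "\<dots> = integral\<^sup>L (mixture \<eta> P) F"
    using swap[OF P'] integral_mixture[OF E P' bF] by simp
  finally show "integral\<^sup>L P0 F = integral\<^sup>L (mixture \<eta> P) F" .
qed

lemma mixture_restricted:
  assumes E: "\<eta> \<in> borel_prob_measures X" and EH: "AE h in \<eta>. h \<in> H" and P: "P \<in> solutions G T \<phi> \<mu>"
    and B: "B \<in> sets \<eta>" "0 < measure \<eta> B"
  shows "mixture (uniform_measure \<eta> B) P \<in> solutions G T \<phi> \<mu>"
    and "bounded_Borel F \<Longrightarrow> measure \<eta> B * integral\<^sup>L (mixture (uniform_measure \<eta> B) P) F =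
      (\<integral>h\<in>B. (\<integral>x. F (prod_mult (prod_inv h) x) \<partial>P) \<partial>\<eta>)"
proof -
  note P' = solves_if_solution(1)[OF P]
  interpret E: prob_space \<eta> by (rule prob_space_borel_prob[OF E])
  have "prob_space (uniform_measure \<eta> B)"
    using B(2) E.emeasure_finite[of B] by (intro prob_space_uniform_measure) (auto simp: E.emeasure_eq_measure)
  then have U: "uniform_measure \<eta> B \<in> borel_prob_measures X"
    by (simp add: borel_prob_measures_def sets_borel_prob[OF E])
  have "AE h in uniform_measure \<eta> B. h \<in> H"
    using EH by (intro AE_uniform_measureI B(1)) auto
  then show "mixture (uniform_measure \<eta> B) P \<in> solutions G T \<phi> \<mu>" by (rule mixture_solution[OF U _ P])
  assume F: "bounded_Borel F"
  show "measure \<eta> B * integral\<^sup>L (mixture (uniform_measure \<eta> B) P) F =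
      (\<integral>h\<in>B. (\<integral>x. F (prod_mult (prod_inv h) x) \<partial>P) \<partial>\<eta>)"
    unfolding integral_mixture[OF U P' F]
    using B integrable_average[OF E P' F] by (subst E.integral_uniform_measure) auto
qed

text \<open>
  Splitting the mixing measure \<open>\<eta>\<close> along a Borel set exhibits the mixture as a convex combination of
  two solutions. If the mixture is extreme, the two agree, so every part of \<open>\<eta>\<close> gives the same
  mixture, and hence almost every translate equals the mixture.
\<close>

lemma extreme_mixture_integral:
  assumes E: "\<eta> \<in> borel_prob_measures X" and EH: "AE h in \<eta>. h \<in> H" and P: "P \<in> solutions G T \<phi> \<mu>"
    and ext: "mixture \<eta> P \<in> extreme_measures (solutions G T \<phi> \<mu>)" and F: "bounded_Borel F"
  shows "AE h in \<eta>. (\<integral>x. F (prod_mult (prod_inv h) x) \<partial>P) = integral\<^sup>L (mixture \<eta> P) F"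
proof (rule density_unique_real)
  note P' = solves_if_solution(1)[OF P]
  interpret E: prob_space \<eta> by (rule prob_space_borel_prob[OF E])
  define v where "v F h = (\<integral>x. F (prod_mult (prod_inv h) x) \<partial>P)" for F :: "(nat \<Rightarrow> 'a) \<Rightarrow> real" and h
  have v_int: "integrable \<eta> (v F)" if "bounded_Borel F" for F
    unfolding v_def[abs_def] by (rule integrable_average[OF E P' that])
  show "integrable \<eta> (\<lambda>h. \<integral>x. F (prod_mult (prod_inv h) x) \<partial>P)" by (rule integrable_average[OF E P' F])
  show "integrable \<eta> (\<lambda>h. integral\<^sup>L (mixture \<eta> P) F)" by simp
  have mix: "integral\<^sup>L (mixture \<eta> P) F = integral\<^sup>L \<eta> (v F)" if "bounded_Borel F" for F
    unfolding v_def[abs_def] by (rule integral_mixture[OF E P' that])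
  fix B assume B: "B \<in> sets \<eta>"
  let ?B' = "space \<eta> - B"
  have B': "?B' \<in> sets \<eta>" using B by auto
  have split: "integral\<^sup>L \<eta> (v F) = (\<integral>h\<in>B. v F h \<partial>\<eta>) + (\<integral>h\<in>?B'. v F h \<partial>\<eta>)" if "bounded_Borel F" for F
  proof -
    have "(\<integral>h\<in>B \<union> ?B'. v F h \<partial>\<eta>) = (\<integral>h\<in>B. v F h \<partial>\<eta>) + (\<integral>h\<in>?B'. v F h \<partial>\<eta>)"
      unfolding set_integrable_def
      using integrable_mult_indicator[OF B v_int[OF that]] integrable_mult_indicator[OF B' v_int[OF that]]
      by (intro set_integral_Un) (auto simp: set_integrable_def)
    moreover have "(\<integral>h\<in>B \<union> ?B'. v F h \<partial>\<eta>) = integral\<^sup>L \<eta> (v F)"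
      using sets.sets_into_space[OF B] unfolding set_lebesgue_integral_def
      by (intro Bochner_Integration.integral_cong) (auto simp: indicator_def)
    ultimately show ?thesis by simp
  qed
  have compl: "measure \<eta> ?B' = 1 - measure \<eta> B" by (rule E.prob_compl[OF B])
  have null: "(\<integral>h\<in>S. v F h \<partial>\<eta>) = 0" if S: "S \<in> sets \<eta>" "measure \<eta> S = 0" for S
  proof -
    have "AE h in \<eta>. h \<notin> S"
      using S E.emeasure_eq_measure by (intro AE_not_in) (auto simp: null_sets_def)
    then have "(\<integral>h. indicator S h *\<^sub>R v F h \<partial>\<eta>) = (\<integral>h. 0 \<partial>\<eta>)"
      using S v_int[OF F] by (intro integral_cong_AE) auto
    then show ?thesis by (simp add: set_lebesgue_integral_def)
  qed
  have "(\<integral>h\<in>B. v F h \<partial>\<eta>) = measure \<eta> B * integral\<^sup>L (mixture \<eta> P) F"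
  proof (cases "measure \<eta> B = 0 \<or> measure \<eta> ?B' = 0")
    case True
    then show ?thesis using null[OF B] null[OF B'] split[OF F] mix[OF F] compl by auto
  next
    case False
    then have pos: "0 < measure \<eta> B" "0 < measure \<eta> ?B'" by (auto simp: less_le)
    let ?Q = "mixture (uniform_measure \<eta> ?B') P" and ?R = "mixture (uniform_measure \<eta> B) P"
    note Q = mixture_restricted[OF E EH P B' pos(2)] and R = mixture_restricted[OF E EH P B pos(1)]
    have "is_convex_combination (measure \<eta> B) ?Q ?R (mixture \<eta> P)"
      unfolding is_convex_combination_def
    proof
      fix A assume "A \<in> sets (mixture \<eta> P)"
      then have A: "A \<in> sets (borel_of X)" by (simp add: sets_borel_prob[OF mixture_in[OF E P']])
      have bA: "bounded_Borel (indicator A)"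
        using A by (auto simp: bounded_Borel_def indicator_def intro!: exI[of _ 1])
      have meas: "integral\<^sup>L M (indicator A) = measure M A" if "M \<in> borel_prob_measures X" for M
        using A sets.sets_into_space[OF A] by (simp add: sets_borel_prob[OF that] space_borel_prob[OF that] Int_absorb2)
      have "measure (mixture \<eta> P) A = integral\<^sup>L \<eta> (v (indicator A))"
        using mix[OF bA] meas[OF mixture_in[OF E P']] by simp
      also have "\<dots> = measure \<eta> B * integral\<^sup>L ?R (indicator A) + measure \<eta> ?B' * integral\<^sup>L ?Q (indicator A)"
        using split[OF bA] Q(2)[OF bA] R(2)[OF bA] by (simp add: v_def)
      finally show "measure (mixture \<eta> P) A = (1 - measure \<eta> B) * measure ?Q A + measure \<eta> B * measure ?R A"
        using meas[OF solves_if_solution(1)[OF Q(1)]] meas[OF solves_if_solution(1)[OF R(1)]] compl by simp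
    qed
    then have "?Q = ?R"
      using ext Q(1) R(1) pos compl unfolding extreme_measures_def by auto
    moreover have "integral\<^sup>L (mixture \<eta> P) F = measure \<eta> B * integral\<^sup>L ?R F + measure \<eta> ?B' * integral\<^sup>L ?Q F"
      using mix[OF F] split[OF F] Q(2)[OF F] R(2)[OF F] by (simp add: v_def)
    ultimately have "integral\<^sup>L (mixture \<eta> P) F = integral\<^sup>L ?R F"
      using compl by (simp add: algebra_simps)
    then show ?thesis using R(2)[OF F] by (simp add: v_def)
  qed
  then show "(\<integral>h\<in>B. (\<integral>x. F (prod_mult (prod_inv h) x) \<partial>P) \<partial>\<eta>) = (\<integral>h\<in>B. integral\<^sup>L (mixture \<eta> P) F \<partial>\<eta>)"
    using B by (simp add: v_def set_lebesgue_integral_def)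
qed

text \<open>
  Countably many test functions determine a measure, so some \<open>h\<close> in \<open>H\<close> translates \<open>P\<close> to \<open>P0\<close>; the
  inverse translation fixes \<open>P0\<close>.
\<close>

theorem invariant_extreme_solution_unique:
  assumes P0: "P0 \<in> extreme_measures (solutions G T \<phi> \<mu>)"
    and inv: "\<And>h. h \<in> H \<Longrightarrow> translate G T h P0 = P0" and P: "P \<in> solutions G T \<phi> \<mu>"
  shows "P = P0"
proof -
  have S0: "P0 \<in> solutions G T \<phi> \<mu>" using P0 by (simp add: extreme_measures_def)
  note P' = solves_if_solution(1)[OF P] and P0' = solves_if_solution(1)[OF S0]
  obtain \<eta> where E: "\<eta> \<in> borel_prob_measures X" and EH: "AE h in \<eta>. h \<in> H"
    and Einv: "\<And>F g. continuous_map X euclideanreal F \<Longrightarrow> g \<in> H \<Longrightarrow> (\<integral>h. F (prod_mult g h) \<partial>\<eta>) = integral\<^sup>L \<eta> F"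
    using invariant_measure_on_H[OF P0' inv] by blast
  have mix: "P0 = mixture \<eta> P" by (rule invariant_solution_eq_mixture[OF S0 inv E EH Einv P])
  obtain F :: "nat \<Rightarrow> (nat \<Rightarrow> 'a) \<Rightarrow> real" where F: "\<And>i. continuous_map X euclideanreal (F i)"
    "\<And>i x. x \<in> topspace X \<Longrightarrow> 0 \<le> F i x \<and> F i x \<le> 1"
    "\<And>P Q. P \<in> borel_prob_measures X \<Longrightarrow> Q \<in> borel_prob_measures X \<Longrightarrow>
       (\<And>i. integral\<^sup>L P (F i) = integral\<^sup>L Q (F i)) \<Longrightarrow> P = Q"
    using countable_determining_functions[OF compactum_X] by blast
  have "AE h in \<eta>. (\<integral>x. F i (prod_mult (prod_inv h) x) \<partial>P) = integral\<^sup>L P0 (F i)" for i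
    using extreme_mixture_integral[OF E EH P _ bounded_Borel_continuous[OF F(1)]] P0 by (simp add: mix[symmetric])
  then have "AE h in \<eta>. \<forall>i. (\<integral>x. F i (prod_mult (prod_inv h) x) \<partial>P) = integral\<^sup>L P0 (F i)"
    by (simp add: AE_all_countable)
  then have "AE h in \<eta>. h \<in> H \<and> (\<forall>i. (\<integral>x. F i (prod_mult (prod_inv h) x) \<partial>P) = integral\<^sup>L P0 (F i))"
    using EH by eventually_elim blast
  then have "\<exists>h. h \<in> H \<and> (\<forall>i. (\<integral>x. F i (prod_mult (prod_inv h) x) \<partial>P) = integral\<^sup>L P0 (F i))"
  proof (rule contrapos_pp)
    assume "\<nexists>h. h \<in> H \<and> (\<forall>i. (\<integral>x. F i (prod_mult (prod_inv h) x) \<partial>P) = integral\<^sup>L P0 (F i))"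
    then have "(\<lambda>h. h \<in> H \<and> (\<forall>i. (\<integral>x. F i (prod_mult (prod_inv h) x) \<partial>P) = integral\<^sup>L P0 (F i))) = (\<lambda>h. False)"
      by (intro ext) blast
    then show "\<not> (AE h in \<eta>. h \<in> H \<and> (\<forall>i. (\<integral>x. F i (prod_mult (prod_inv h) x) \<partial>P) = integral\<^sup>L P0 (F i)))"
      using prob_space.AE_False[OF prob_space_borel_prob[OF E]] by (simp only: not_False_eq_True)
  qed
  then obtain h where h: "h \<in> H" and eq: "\<And>i. (\<integral>x. F i (prod_mult (prod_inv h) x) \<partial>P) = integral\<^sup>L P0 (F i)"
    by blast
  have h': "h \<in> \<Omega>" "prod_inv h \<in> \<Omega>" using H_Omega h prod_inv_H by blast+
  have shifted: "translate G T (prod_inv h) P = P0"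
  proof (rule F(3)[OF translate_in[OF P' h'(2)] P0'])
    show "integral\<^sup>L (translate G T (prod_inv h) P) (F i) = integral\<^sup>L P0 (F i)" for i
      using eq by (simp add: integral_translate[OF P' h'(2) bounded_Borel_continuous[OF F(1)]])
  qed
  show ?thesis
  proof (rule F(3)[OF P' P0'])
    fix i
    note bF = bounded_Borel_continuous[OF F(1)[of i]]
    have "integral\<^sup>L P (F i) = (\<integral>x. F i (prod_mult h (prod_mult (prod_inv h) x)) \<partial>P)"
      by (intro Bochner_Integration.integral_cong refl) (simp add: space_borel_prob[OF P'] prod_mult_cancel_prod_inv[OF h'(1)])
    also have "\<dots> = integral\<^sup>L (translate G T (prod_inv h) P) (\<lambda>x. F i (prod_mult h x))"
      by (rule integral_translate[OF P' h'(2) bounded_Borel_prod_mult[OF h'(1) bF], symmetric])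
    also have "\<dots> = integral\<^sup>L (translate G T h P0) (F i)"
      unfolding shifted by (rule integral_translate[OF P0' h'(1) bF, symmetric])
    finally show "integral\<^sup>L P (F i) = integral\<^sup>L P0 (F i)" by (simp add: inv[OF h])
  qed
qed

lemma stabilizer_eq_iff: "stabilizer G T \<phi> P = H \<longleftrightarrow> (\<forall>h\<in>H. translate G T h P = P)"
  by (auto simp: stabilizer_def)

lemma unique_solution_stabilizer:
  assumes "solutions G T \<phi> \<mu> = {P}" shows "stabilizer G T \<phi> P = H"
  unfolding stabilizer_eq_iff using translate_solution[of P] assms by auto

lemma card_eq_1_if_invariant_extreme:
  assumes P0: "P0 \<in> extreme_measures (solutions G T \<phi> \<mu>)" and st: "stabilizer G T \<phi> P0 = H"
  shows "card (solutions G T \<phi> \<mu>) = 1"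
proof -
  have "P = P0" if "P \<in> solutions G T \<phi> \<mu>" for P
    using invariant_extreme_solution_unique[OF P0 _ that] st unfolding stabilizer_eq_iff by blast
  moreover have "P0 \<in> solutions G T \<phi> \<mu>" using P0 by (simp add: extreme_measures_def)
  ultimately have "solutions G T \<phi> \<mu> = {P0}" by blast
  then show ?thesis by simp
qed

end

theorem corollary2p14:
  fixes G :: "nat \<Rightarrow> ('a, 'b) monoid_scheme"
    and T :: "nat \<Rightarrow> 'a topology"
    and \<phi> :: "nat \<Rightarrow> 'a \<Rightarrow> 'a"
    and \<mu> :: "nat \<Rightarrow> 'a measure"
  assumes "\<And>k. is_topological_group (G k) (T k)"
    and "\<And>k. compact_space (T k)"
    and "\<And>k. Hausdorff_space (T k)"
    and "\<And>k. second_countable (T k)"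
    and "\<And>k. \<phi> k \<in> hom (G (Suc k)) (G k)"
    and "\<And>k. continuous_map (T (Suc k)) (T k) (\<phi> k)"
    and "\<And>k. \<mu> k \<in> borel_prob_measures (T k)"
  shows "(card (solutions G T \<phi> \<mu>) = 1 \<longleftrightarrow>
            (\<exists>P0 \<in> extreme_measures (solutions G T \<phi> \<mu>).
               stabilizer G T \<phi> P0 = inverse_limit_group G \<phi>)) \<and>
         (card (solutions G T \<phi> \<mu>) = 1 \<longleftrightarrow>
            (\<forall>P0 \<in> extreme_measures (solutions G T \<phi> \<mu>).
               stabilizer G T \<phi> P0 = inverse_limit_group G \<phi>))"
proof -
  interpret group_system G T \<phi> \<mu>
    using assms by unfold_locales
  let ?S = "solutions G T \<phi> \<mu>"
  have all: "\<forall>P0\<in>extreme_measures ?S. stabilizer G T \<phi> P0 = inverse_limit_group G \<phi>" if "card ?S = 1"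
  proof
    fix P0 assume "P0 \<in> extreme_measures ?S"
    then have "P0 \<in> ?S" by (simp add: extreme_measures_def)
    then have "?S = {P0}" using that by (auto simp: card_1_singleton_iff)
    then show "stabilizer G T \<phi> P0 = inverse_limit_group G \<phi>" by (rule unique_solution_stabilizer)
  qed
  have one: "card ?S = 1"
    if "\<exists>P0\<in>extreme_measures ?S. stabilizer G T \<phi> P0 = inverse_limit_group G \<phi>"
    using that card_eq_1_if_invariant_extreme by blast
  show ?thesis
    using all one extreme_solutions_nonempty by blast
qed

end
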